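(* Let $\alpha>0$ and let $(M_n,S_n)_{n\ge0}$ be a nontrivial, positive divergent Markov random walk of type $\alpha$ with irreducible positive recurrent driving chain on a countable set $\mathcal S$. Then the following are equivalent: (a) $\mathbb E_iJ_i(D^i)^{1+\alpha}<\infty$ for some (equivalently all) $i\in\mathcal S$; (b) $\mathbb E_i\rho(x)^\alpha<\infty$ for some (equivalently all) $(i,x)\in\mathcal S\times[0,\infty)$; (c) $\mathbb E_i\sigma_{\min}^\alpha<\infty$ for some (equivalently all) $i\in\mathcal S$; (d) for some (equivalently all) $i\in\mathcal S$ there exists $x\ge0$ with $\mathbb P_i(\sigma^{\le}(-x)=\infty)>0$ and $\mathbb E_i\sigma^{\le}(-x)^\alpha\mathbf 1_{\{\sigma^{\le}(-x)<\infty\}}<\infty$; in this case the last expectation is finite for every other $x\ge0$ as well.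
   Context: $\mathcal S$ countable; $(M_n)_{n\ge0}$ irreducible positive recurrent Markov chain on $\mathcal S$ with stationary distribution $\pi$. Markov random walk (MRW): $S_0=0$, $S_n=X_1+\dots+X_n$, with the $X_n$ conditionally independent given $(M_n)$ and $\mathbb P((X_1,\dots,X_n)\in\cdot\mid M_0=i_0,\dots,M_n=i_n)=K_{i_0i_1}\otimes\cdots\otimes K_{i_{n-1}i_n}$ for a stochastic kernel $K$ from $\mathcal S^2$ to $\mathbb R$. $\mathbb P_i=\mathbb P(\cdot\mid M_0=i)$; "a.s." means $\mathbb P_i$-a.s. for all $i$. Nontrivial = not null-homologous, where null-homologous means $X_n=g(M_n)-g(M_{n-1})$ $\mathbb P_\pi$-a.s. for all $n$ for some $g:\mathcal S\to\mathbb R$. Positive divergent: $S_n\to\infty$ a.s. $\tau(i)=\inf\{n\ge1:M_n=i\}$; the MRW is of type $\alpha$ if $\mathbb E_i\tau(i)^{1+\alpha}<\infty$ for some (equivalently all) $i$. $J_i(0)=1$, and for $x>0$, $J_i(x)=x/\mathbb E_i(S_{\tau(i)}^+\wedge x)$ if $\mathbb P_i(S_{\tau(i)}>0)>0$, else $J_i(x)=x$. $D^i$ has the $\mathbb P_i$-law of $\max_{0<k\le\tau(i)}S_k^-$. $\rho(x)=\sup\{n\ge0:S_n\le x\}$; $\sigma_{\min}=\inf\{n\ge1:S_n=\inf_{k\ge1}S_k\}$; $\sigma^{\le}(-x)=\inf\{n\ge1:S_n\le-x\}$. *)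

theory Defs
  imports "HOL-Probability.Probability"
begin

definition Ssum :: "(nat \<Rightarrow> 'w \<Rightarrow> real) \<Rightarrow> nat \<Rightarrow> 'w \<Rightarrow> real" where
  "Ssum X n \<omega> = (\<Sum>k\<in>{1..n}. X k \<omega>)"

definition epow :: "enat \<Rightarrow> real \<Rightarrow> ennreal" where
  "epow t a = (case t of enat n \<Rightarrow> ennreal (real n powr a) | \<infinity> \<Rightarrow> \<infinity>)"

definition first_time :: "(nat \<Rightarrow> bool) \<Rightarrow> enat" where
  "first_time Q = (if \<exists>n\<ge>1. Q n then enat (LEAST n. 1 \<le> n \<and> Q n) else \<infinity>)"

definition return_time :: "(nat \<Rightarrow> 'w \<Rightarrow> 's) \<Rightarrow> 's \<Rightarrow> 'w \<Rightarrow> enat" where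
  "return_time M i \<omega> = first_time (\<lambda>n. M n \<omega> = i)"

text \<open>Markov random walk: P i is the law P_i (M_0 = i), p the transition matrix of (M_n),
  K the stochastic kernel; the joint finite-dimensional distributions of (M_n, X_n) are
  P_i(M_0=j_0,...,M_n=j_n, X_1 in B_1,...,X_n in B_n)
    = [j_0 = i] * prod_{k=1}^n p(j_{k-1},j_k) K_{j_{k-1} j_k}(B_k).\<close>
definition is_MRW :: "('s \<Rightarrow> 'w measure) \<Rightarrow> (nat \<Rightarrow> 'w \<Rightarrow> 's) \<Rightarrow> (nat \<Rightarrow> 'w \<Rightarrow> real)
    \<Rightarrow> ('s \<Rightarrow> 's \<Rightarrow> real) \<Rightarrow> ('s \<Rightarrow> 's \<Rightarrow> real measure) \<Rightarrow> bool" where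
  "is_MRW P M X p K \<longleftrightarrow>
     (\<forall>i j. 0 \<le> p i j) \<and> (\<forall>i. (p i has_sum 1) UNIV) \<and>
     (\<forall>i j. prob_space (K i j) \<and> sets (K i j) = sets borel) \<and>
     (\<forall>i. prob_space (P i)) \<and>
     (\<forall>i n. M n \<in> measurable (P i) (count_space UNIV) \<and> X n \<in> borel_measurable (P i)) \<and>
     (\<forall>i n (js :: nat \<Rightarrow> 's) (Bs :: nat \<Rightarrow> real set). (\<forall>k. Bs k \<in> sets borel) \<longrightarrow>
        measure (P i) {\<omega> \<in> space (P i). (\<forall>k\<le>n. M k \<omega> = js k) \<and> (\<forall>k\<in>{1..n}. X k \<omega> \<in> Bs k)}
        = (if js 0 = i then 1 else 0) *
          (\<Prod>k\<in>{1..n}. p (js (k - 1)) (js k) * measure (K (js (k - 1)) (js k)) (Bs k)))"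

definition irreducible_chain :: "('s \<Rightarrow> 'w measure) \<Rightarrow> (nat \<Rightarrow> 'w \<Rightarrow> 's) \<Rightarrow> bool" where
  "irreducible_chain P M \<longleftrightarrow>
     (\<forall>i j. measure (P i) {\<omega> \<in> space (P i). \<exists>n. M n \<omega> = j} > 0)"

definition positive_recurrent :: "('s \<Rightarrow> 'w measure) \<Rightarrow> (nat \<Rightarrow> 'w \<Rightarrow> 's) \<Rightarrow> bool" where
  "positive_recurrent P M \<longleftrightarrow>
     (\<forall>i. (\<integral>\<^sup>+ \<omega>. epow (return_time M i \<omega>) 1 \<partial>P i) < \<infinity>)"

definition stationary_distr :: "('s \<Rightarrow> 's \<Rightarrow> real) \<Rightarrow> ('s \<Rightarrow> real) \<Rightarrow> bool" where
  "stationary_distr p \<pi> \<longleftrightarrow>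
     (\<forall>j. 0 \<le> \<pi> j) \<and> (\<pi> has_sum 1) UNIV \<and> (\<forall>j. ((\<lambda>i. \<pi> i * p i j) has_sum \<pi> j) UNIV)"

text \<open>Null-homologous: X_n = g(M_n) - g(M_{n-1}) P_pi-a.s. for all n; since
  P_pi = sum_i pi_i P_i, P_pi-a.s. means P_i-a.s. for every i with pi_i > 0.\<close>
definition null_homologous :: "('s \<Rightarrow> 'w measure) \<Rightarrow> (nat \<Rightarrow> 'w \<Rightarrow> 's) \<Rightarrow> (nat \<Rightarrow> 'w \<Rightarrow> real)
    \<Rightarrow> ('s \<Rightarrow> real) \<Rightarrow> bool" where
  "null_homologous P M X \<pi> \<longleftrightarrow>
     (\<exists>g :: 's \<Rightarrow> real. \<forall>n\<ge>1. \<forall>i. \<pi> i > 0 \<longrightarrow>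
        (AE \<omega> in P i. X n \<omega> = g (M n \<omega>) - g (M (n - 1) \<omega>)))"

definition positive_divergent :: "('s \<Rightarrow> 'w measure) \<Rightarrow> (nat \<Rightarrow> 'w \<Rightarrow> real) \<Rightarrow> bool" where
  "positive_divergent P X \<longleftrightarrow>
     (\<forall>i. AE \<omega> in P i. filterlim (\<lambda>n. Ssum X n \<omega>) at_top sequentially)"

definition of_type :: "('s \<Rightarrow> 'w measure) \<Rightarrow> (nat \<Rightarrow> 'w \<Rightarrow> 's) \<Rightarrow> real \<Rightarrow> bool" where
  "of_type P M \<alpha> \<longleftrightarrow>
     (\<exists>i. (\<integral>\<^sup>+ \<omega>. epow (return_time M i \<omega>) (1 + \<alpha>) \<partial>P i) < \<infinity>)"

text \<open>S_{tau(i)} (set to 0 on the null event tau(i) = infinity).\<close>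
definition S_tau :: "(nat \<Rightarrow> 'w \<Rightarrow> 's) \<Rightarrow> (nat \<Rightarrow> 'w \<Rightarrow> real) \<Rightarrow> 's \<Rightarrow> 'w \<Rightarrow> real" where
  "S_tau M X i \<omega> = (case return_time M i \<omega> of enat n \<Rightarrow> Ssum X n \<omega> | \<infinity> \<Rightarrow> 0)"

definition J_fun :: "('s \<Rightarrow> 'w measure) \<Rightarrow> (nat \<Rightarrow> 'w \<Rightarrow> 's) \<Rightarrow> (nat \<Rightarrow> 'w \<Rightarrow> real) \<Rightarrow> 's \<Rightarrow> real \<Rightarrow> real" where
  "J_fun P M X i x =
     (if x = 0 then 1
      else if measure (P i) {\<omega> \<in> space (P i). S_tau M X i \<omega> > 0} > 0
      then x / (\<integral>\<omega>. min (max (S_tau M X i \<omega>) 0) x \<partial>P i)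
      else x)"

text \<open>D^i = max_{0<k<=tau(i)} S_k^- (set to 0 on the null event tau(i) = infinity).\<close>
definition D_var :: "(nat \<Rightarrow> 'w \<Rightarrow> 's) \<Rightarrow> (nat \<Rightarrow> 'w \<Rightarrow> real) \<Rightarrow> 's \<Rightarrow> 'w \<Rightarrow> real" where
  "D_var M X i \<omega> = (case return_time M i \<omega> of
       enat n \<Rightarrow> Max ((\<lambda>k. max (- Ssum X k \<omega>) 0) ` {1..n}) | \<infinity> \<Rightarrow> 0)"

definition rho :: "(nat \<Rightarrow> 'w \<Rightarrow> real) \<Rightarrow> real \<Rightarrow> 'w \<Rightarrow> enat" where
  "rho X x \<omega> = (if finite {n. Ssum X n \<omega> \<le> x} then enat (Max {n. Ssum X n \<omega> \<le> x}) else \<infinity>)"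

definition sigma_min :: "(nat \<Rightarrow> 'w \<Rightarrow> real) \<Rightarrow> 'w \<Rightarrow> enat" where
  "sigma_min X \<omega> = first_time (\<lambda>n. \<forall>k\<ge>1. Ssum X n \<omega> \<le> Ssum X k \<omega>)"

definition sigma_le :: "(nat \<Rightarrow> 'w \<Rightarrow> real) \<Rightarrow> real \<Rightarrow> 'w \<Rightarrow> enat" where
  "sigma_le X x \<omega> = first_time (\<lambda>n. Ssum X n \<omega> \<le> - x)"

definition condA :: "('s \<Rightarrow> 'w measure) \<Rightarrow> (nat \<Rightarrow> 'w \<Rightarrow> 's) \<Rightarrow> (nat \<Rightarrow> 'w \<Rightarrow> real) \<Rightarrow> real \<Rightarrow> 's \<Rightarrow> bool" where
  "condA P M X \<alpha> i \<longleftrightarrow>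
     (\<integral>\<^sup>+ \<omega>. ennreal (J_fun P M X i (D_var M X i \<omega>) powr (1 + \<alpha>)) \<partial>P i) < \<infinity>"

definition condB :: "('s \<Rightarrow> 'w measure) \<Rightarrow> (nat \<Rightarrow> 'w \<Rightarrow> real) \<Rightarrow> real \<Rightarrow> 's \<Rightarrow> real \<Rightarrow> bool" where
  "condB P X \<alpha> i x \<longleftrightarrow> (\<integral>\<^sup>+ \<omega>. epow (rho X x \<omega>) \<alpha> \<partial>P i) < \<infinity>"

definition condC :: "('s \<Rightarrow> 'w measure) \<Rightarrow> (nat \<Rightarrow> 'w \<Rightarrow> real) \<Rightarrow> real \<Rightarrow> 's \<Rightarrow> bool" where
  "condC P X \<alpha> i \<longleftrightarrow> (\<integral>\<^sup>+ \<omega>. epow (sigma_min X \<omega>) \<alpha> \<partial>P i) < \<infinity>"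

definition sigma_moment_finite :: "('s \<Rightarrow> 'w measure) \<Rightarrow> (nat \<Rightarrow> 'w \<Rightarrow> real) \<Rightarrow> real \<Rightarrow> 's \<Rightarrow> real \<Rightarrow> bool" where
  "sigma_moment_finite P X \<alpha> i x \<longleftrightarrow>
     (\<integral>\<^sup>+ \<omega>. (if sigma_le X x \<omega> < \<infinity> then epow (sigma_le X x \<omega>) \<alpha> else 0) \<partial>P i) < \<infinity>"

definition condD :: "('s \<Rightarrow> 'w measure) \<Rightarrow> (nat \<Rightarrow> 'w \<Rightarrow> real) \<Rightarrow> real \<Rightarrow> 's \<Rightarrow> bool" where
  "condD P X \<alpha> i \<longleftrightarrow>
     (\<exists>x\<ge>0. measure (P i) {\<omega> \<in> space (P i). sigma_le X x \<omega> = \<infinity>} > 0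
            \<and> sigma_moment_finite P X \<alpha> i x)"

end

theory Submission
  imports Defs
begin

text \<open>
  Cut the path at the visits to a fixed state \<open>i\<close>. The cycles are i.i.d., so the values of the walk
  at the visits form an ordinary random walk \<open>W\<close> tending to infinity; let \<open>D\<close> be the depth of a cycle,
  \<open>T\<close> its length, and weigh a cycle by \<open>G = 1 + T + J D\<close>.

  (a) implies (b): let \<open>\<Gamma>\<close> be the total weight up to the first strict ascending ladder epoch of \<open>W\<close>.
  Since \<open>J y\<close> is comparable to the expected number of ladder heights below \<open>y\<close>, and \<open>J\<close> is
  subadditive, summing over the ladder epochs shows that \<open>E \<Gamma>\<^sup>1\<^sup>+\<^sup>\<alpha> < \<infinity>\<close> bounds the last exit time.
  That moment is bootstrapped from \<open>E \<Gamma>\<^sup>\<alpha> < \<infinity>\<close>: reversing time turns "\<open>W\<close> has stayed positive up to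
  time \<open>n\<close>" into "\<open>n\<close> is an ascending ladder epoch", and "\<open>W\<close> has stayed nonpositive" into
  "\<open>n\<close> is a weak descending ladder epoch"; the former controls the moments of the first descending
  epoch, of which there are only geometrically many, and the latter those of \<open>\<Gamma>\<close>.

  (d) implies (a): before \<open>W\<close> exceeds \<open>y\<close>, which takes time of order \<open>J y\<close> by Markov's inequality, a
  cycle of depth \<open>D > y + x\<close> forces the walk below \<open>-x\<close>.

  The remaining implications compare the random times pathwise. Independence of the state follows
  for (b) from the Markov property, and for the moments of \<open>T\<close> from the geometric number of cycles
  which miss the other state.
\<close>

section \<open>Power inequalities\<close>

text \<open>The exponents are decided by one Laplace transform bound. If the first step of
  \<open>W\<close> is positive, it is itself the first ladder height; hence the transform of the
  ladder height at \<open>1 / y\<close> is at most \<open>1 - 1 / (2 * J y)\<close>. Geometric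
  series with this ratio replace renewal theory: \<open>exp (1 - w / y)\<close> dominates the
  indicator of \<open>w \<le> y\<close>, and a factor \<open>(k + 1) powr a\<close> in the ladder
  index \<open>k\<close> sums up to the order \<open>J y powr (1 + a)\<close>. This is how a moment
  of order \<open>\<alpha>\<close> of a random time comes to match a moment of order
  \<open>1 + \<alpha>\<close> of \<open>J\<close>. The obstacle is that elapsed time and height at a
  ladder epoch are dependent, so every estimate is made for functions of both, with the exponential
  tilt acting on the height alone. Moments of order \<open>a\<close> over many ladder blocks need
  moments of order \<open>max 1 a\<close> of a single block, so the bootstrap starts from the mean,
  where Wald's identity is available, and then gains one order at a time. Random times are treated
  as sums over deterministic times, and conditioning as the independence of the first
  \<open>n\<close> cycles from the rest.\<close>

lemma powr_add_le_add_powr: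
  fixes x y s :: real
  assumes "0 \<le> x" "0 \<le> y" "0 < s" "s \<le> 1"
  shows "(x + y) powr s \<le> x powr s + y powr s"
proof (cases "x + y = 0")
  case True
  then have "x = 0" "y = 0" using assms by auto
  then show ?thesis by simp
next
  case False
  then have p: "x + y > 0" using assms by simp
  have *: "t \<le> t powr s" if "0 \<le> t" "t \<le> 1" for t :: real
    using powr_mono'[of s 1 t] assms that by simp
  have "1 = x / (x + y) + y / (x + y)" using p by (simp add: add_divide_distrib [symmetric])
  also have "\<dots> \<le> (x / (x + y)) powr s + (y / (x + y)) powr s"
    by (intro add_mono *) (use assms p in auto)
  also have "\<dots> = (x powr s + y powr s) / (x + y) powr s"
    using assms p by (simp add: powr_divide add_divide_distrib)
  finally show ?thesis using p by (simp add: pos_le_divide_eq)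
qed

lemma powr_add_le_two_powr:
  fixes x y s :: real
  assumes "0 \<le> x" "0 \<le> y" "0 \<le> s"
  shows "(x + y) powr s \<le> 2 powr s * (x powr s + y powr s)"
proof -
  have "(x + y) powr s \<le> (2 * max x y) powr s"
    by (intro powr_mono2) (use assms in auto)
  also have "\<dots> = 2 powr s * max x y powr s" using assms by (simp add: powr_mult)
  also have "\<dots> \<le> 2 powr s * (x powr s + y powr s)"
    by (intro mult_left_mono) (auto simp: max_def)
  finally show ?thesis .
qed

text \<open>Convexity with the weights \<open>k / (k + 1)\<close> and \<open>1 / (k + 1)\<close>.
  The first factor turns \<open>real k powr max (s - 1) 0\<close> exactly into
  \<open>(real k + 1) powr max (s - 1) 0\<close>, so an induction over the number of summands costs
  only a power of \<open>k\<close>. It also tends to 1 as \<open>k\<close> grows, which later yields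
  a contraction.\<close>

lemma powr_add_le_weighted:
  fixes x y s :: real and k :: nat
  assumes "0 \<le> x" "0 \<le> y" "0 < s" "k \<ge> 1"
  shows "(x + y) powr s \<le> ((real k + 1) / real k) powr max (s - 1) 0 * x powr s
           + (real k + 1) powr max (s - 1) 0 * y powr s"
proof (cases "s \<le> 1")
  case True
  then show ?thesis using powr_add_le_add_powr[of x y s] assms by (simp add: max_def)
next
  case False
  then have s1: "s > 1" by simp
  let ?a = "(real k + 1) / real k" and ?b = "real k + 1"
  have k: "real k > 0" using assms by simp
  consider "x = 0" | "y = 0" | "x > 0" "y > 0" using assms by fastforce
  then show ?thesis
  proof cases
    case 1
    have "1 \<le> ?b powr (s - 1)" using s1 k by (intro ge_one_powr_ge_zero) auto
    then have "1 * y powr s \<le> ?b powr (s - 1) * y powr s" by (intro mult_right_mono) auto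
    then show ?thesis using 1 s1 by (simp add: max_def)
  next
    case 2
    have "1 \<le> ?a powr (s - 1)" using s1 k by (intro ge_one_powr_ge_zero) (auto simp: field_simps)
    then have "1 * x powr s \<le> ?a powr (s - 1) * x powr s" by (intro mult_right_mono) auto
    then show ?thesis using 2 s1 by (simp add: max_def)
  next
    case 3
    have c: "convex_on {0<..} (\<lambda>x. x powr s)" using powr_convex s1 by simp
    have w: "1 / ?a + 1 / ?b = 1" using k by (simp add: add_divide_distrib[symmetric])
    have "1 / ?a * (?a * x) = x" "1 / ?b * (?b * y) = y" using k by simp_all
    then have "(x + y) powr s = ((1 / ?a) * (?a * x) + (1 / ?b) * (?b * y)) powr s" by presburger
    also have "\<dots> \<le> (1 / ?a) * (?a * x) powr s + (1 / ?b) * (?b * y) powr s"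
    proof -
      have "1 - 1 / ?b = 1 / ?a" using w by simp
      then show ?thesis
        using convex_onD[OF c, of "1 / ?b" "?a * x" "?b * y"] k 3
        by (simp del: times_divide_eq_left times_divide_eq_right)
    qed
    also have "\<dots> = ?a powr (s - 1) * x powr s + ?b powr (s - 1) * y powr s"
      using k 3 by (simp add: powr_mult powr_diff powr_divide mult_ac)
    finally show ?thesis using s1 by (simp add: max_def)
  qed
qed

lemma powr_Suc_add_le_mvt:
  fixes v g a :: real
  assumes "0 \<le> v" "0 \<le> g" "0 < a"
  shows "(v + g) powr (1 + a) \<le> v powr (1 + a) + (1 + a) * g * (v + g) powr a"
proof (cases "v = 0 \<or> g = 0")
  case True
  then show ?thesis
  proof
    assume "v = 0"
    have "g * g powr a = g powr (1 + a)" using assms by (cases "g = 0") (auto simp: powr_add)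
    then show ?thesis using assms \<open>v = 0\<close> by (simp add: algebra_simps)
  qed (use assms in auto)
next
  case False
  then have vg: "v > 0" "g > 0" using assms by auto
  have "\<exists>z>v. z < v + g \<and> (v + g) powr (1 + a) - v powr (1 + a) = (v + g - v) * ((1 + a) * z powr (1 + a - 1))"
    by (rule MVT2) (use vg has_real_derivative_powr[of _ "1 + a"] in auto)
  then obtain z where z: "z > v" "z < v + g"
    "(v + g) powr (1 + a) - v powr (1 + a) = g * ((1 + a) * z powr a)" by auto
  have "g * ((1 + a) * z powr a) \<le> g * ((1 + a) * (v + g) powr a)"
    using z vg assms by (intro mult_left_mono powr_mono2) auto
  then show ?thesis using z(3) by (simp add: algebra_simps)
qed

text \<open>The mixed term contains the past \<open>v\<close> only to the order \<open>a\<close>;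
  when \<open>g\<close> is independent of \<open>v\<close>, this lifts moments from order
  \<open>a\<close> to order \<open>1 + a\<close>.\<close>

lemma powr_Suc_add_le:
  fixes v g a :: real
  assumes "0 \<le> v" "0 \<le> g" "0 < a"
  shows "(v + g) powr (1 + a) \<le> v powr (1 + a)
           + (1 + a) * 2 powr a * (v powr a * g + g powr (1 + a))"
proof -
  have "g * (v + g) powr a \<le> g * (2 powr a * (v powr a + g powr a))"
    using assms by (intro mult_left_mono powr_add_le_two_powr) auto
  also have "\<dots> = 2 powr a * (v powr a * g + g powr (1 + a))"
    using assms by (cases "g = 0") (auto simp: powr_add algebra_simps)
  finally have "(1 + a) * (g * (v + g) powr a) \<le> (1 + a) * (2 powr a * (v powr a * g + g powr (1 + a)))"
    using assms by (intro mult_left_mono) auto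
  then show ?thesis using powr_Suc_add_le_mvt[OF assms] by (simp add: algebra_simps)
qed

lemma powr_le_exp:
  fixes x a :: real
  assumes "0 \<le> x" "0 \<le> a"
  shows "x powr a \<le> (a + 1) powr a * exp x"
proof -
  have "x / (a + 1) \<le> exp (x / (a + 1))" using exp_ge_add_one_self[of "x / (a + 1)"] by linarith
  then have "(x / (a + 1)) powr a \<le> exp (x / (a + 1)) powr a"
    using assms by (intro powr_mono2) auto
  also have "\<dots> = exp (a * (x / (a + 1)))" by (simp add: powr_def)
  also have "a * (x / (a + 1)) \<le> x" using assms by (simp add: field_simps)
  finally have "(x / (a + 1)) powr a \<le> exp x" by simp
  then have "x powr a / (a + 1) powr a \<le> exp x" using assms by (simp add: powr_divide)
  then show ?thesis using assms by (simp add: pos_divide_le_eq mult.commute)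
qed

text \<open>The exponent \<open>1 + a\<close> is the true order as \<open>r\<close> tends to 1. In
  the main application \<open>1 - r\<close> is \<open>1 / (2 * J y)\<close>, which produces
  \<open>J y powr (1 + a)\<close>.\<close>

lemma suminf_powr_geometric_le:
  fixes a :: real
  assumes "0 \<le> a"
  obtains C where "C > 0"
    "\<And>r. 0 \<le> r \<Longrightarrow> r < 1 \<Longrightarrow>
       (\<Sum>k. ennreal ((real k + 1) powr a) * ennreal r ^ k) \<le> ennreal (C / (1 - r) powr (1 + a))"
proof
  define C where "C = exp 1 * (2 powr a * (a + 1) powr a) * 4"
  show "C > 0" using assms by (auto simp: C_def)
  fix r :: real assume r: "0 \<le> r" "r < 1"
  define u where "u = 1 - r"
  have u: "0 < u" "u \<le> 1" using r by (auto simp: u_def)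
  define K where "K = exp 1 * (2 powr a * (a + 1) powr a) / u powr a"
  have K0: "K > 0" using u assms by (auto simp: K_def)
  have le: "(real k + 1) powr a * r ^ k \<le> K * exp (- u / 2) ^ k" for k
  proof -
    have "r \<le> exp (- u)" using exp_ge_add_one_self[of "-u"] by (simp add: u_def)
    then have "r ^ k \<le> exp (- u) ^ k" using r by (intro power_mono) auto
    also have "\<dots> = exp (u - (real k + 1) * u)" by (simp add: exp_of_nat_mult[symmetric] algebra_simps)
    also have "\<dots> \<le> exp (1 - (real k + 1) * u)" using u by simp
    also have "\<dots> = exp 1 * exp (- (real k + 1) * u)" by (simp add: exp_add[symmetric] algebra_simps)
    finally have 1: "r ^ k \<le> exp 1 * exp (- (real k + 1) * u)" .
    \<comment> \<open>Half of the exponent \<open>(k + 1) * u\<close> pays for the power of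
      \<open>k + 1\<close>; the other half leaves a geometric series with ratio
      \<open>exp (- u / 2)\<close>.\<close>
    define x where "x = (real k + 1) * u / 2"
    have "real k + 1 = 2 / u * x" using u by (simp add: x_def)
    then have "(real k + 1) powr a = (2 / u * x) powr a" by simp
    also have "\<dots> = (2 / u) powr a * x powr a" using u by (intro powr_mult)
    also have "\<dots> = 2 powr a / u powr a * x powr a" using u by (simp add: powr_divide)
    also have "\<dots> \<le> 2 powr a / u powr a * ((a + 1) powr a * exp x)"
      using assms u by (intro mult_left_mono powr_le_exp) (auto simp: x_def)
    finally have "(real k + 1) powr a * r ^ k
       \<le> 2 powr a / u powr a * ((a + 1) powr a * exp x) * (exp 1 * exp (- (real k + 1) * u))"
      using 1 r assms by (intro mult_mono) auto
    also have "\<dots> = K * (exp x * exp (- (real k + 1) * u))" by (simp add: K_def)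
    also have "exp x * exp (- (real k + 1) * u) = exp (- u / 2 * (real k + 1))"
      by (simp add: x_def exp_add[symmetric] field_simps)
    also have "\<dots> \<le> exp (real k * (- u / 2))" using u by (simp add: field_simps)
    also have "\<dots> = exp (- u / 2) ^ k" by (rule exp_of_nat_mult)
    finally show ?thesis using K0 by simp
  qed
  have "(1 + u / 2) * exp (- u / 2) \<le> exp (u / 2) * exp (- u / 2)"
    by (intro mult_right_mono exp_ge_add_one_self) auto
  also have "\<dots> = 1" by (simp add: exp_add[symmetric])
  finally have e: "exp (- u / 2) \<le> 1 / (1 + u / 2)" using u by (simp add: field_simps)
  have "u / 4 * (1 + u / 2) \<le> u / 2" using u mult_left_le[of u u] by (simp add: field_simps)
  then have "u / 4 \<le> 1 - 1 / (1 + u / 2)" using u by (simp add: field_simps)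
  with e have e2: "u / 4 \<le> 1 - exp (- u / 2)" by linarith
  have el: "exp (- u / 2) < 1" using u by simp
  have "(\<Sum>k. ennreal ((real k + 1) powr a) * ennreal r ^ k) = (\<Sum>k. ennreal ((real k + 1) powr a * r ^ k))"
    using r by (simp add: ennreal_mult ennreal_power)
  also have "\<dots> \<le> (\<Sum>k. ennreal (K * exp (- u / 2) ^ k))"
    by (intro suminf_le ennreal_leI le) auto
  also have "\<dots> = ennreal (\<Sum>k. K * exp (- u / 2) ^ k)"
    using K0 el by (intro suminf_ennreal2 summable_mult summable_geometric) auto
  also have "(\<Sum>k. K * exp (- u / 2) ^ k) = K * (1 / (1 - exp (- u / 2)))"
    using el by (subst suminf_mult) (simp_all add: summable_geometric suminf_geometric)
  also have "K * (1 / (1 - exp (- u / 2))) \<le> K * (1 / (u / 4))"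
    using e2 u K0 by (intro mult_left_mono divide_left_mono) auto
  also have "\<dots> = C / u powr (1 + a)"
    using u by (simp add: K_def C_def powr_add field_simps)
  finally show "(\<Sum>k. ennreal ((real k + 1) powr a) * ennreal r ^ k) \<le> ennreal (C / (1 - r) powr (1 + a))"
    by (simp add: u_def ennreal_leI)
qed

section \<open>Ladder epochs of random walks\<close>

definition shift :: "nat \<Rightarrow> (nat \<Rightarrow> 'a) \<Rightarrow> nat \<Rightarrow> 'a" where
  "shift n c = (\<lambda>k. c (n + k))"

lemma shift_apply [simp]: "shift n c k = c (n + k)" by (simp add: shift_def)
lemma shift_shift [simp]: "shift m (shift n c) = shift (n + m) c"
  by (simp add: shift_def add.assoc)

lemma shift_case_nat_Suc [simp]: "shift (Suc n) (case_nat a z) = shift n z"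
  by (simp add: shift_def)

lemma measurable_shift [measurable]:
  "shift n \<in> measurable (PiM UNIV (\<lambda>_. N)) (PiM UNIV (\<lambda>_. N))"
  unfolding shift_def by (rule measurable_abs_UNIV) measurable

lemma shift_comb_seq [simp]: "shift n (comb_seq n c c') = c'"
  by (simp add: shift_def comb_seq_def)

text \<open>Reversing only the first \<open>n\<close> entries is a permutation of the indices, so
  the product law is invariant under it.\<close>

definition flip :: "nat \<Rightarrow> (nat \<Rightarrow> 'a) \<Rightarrow> nat \<Rightarrow> 'a" where
  "flip n c = (\<lambda>k. c (if k < n then n - 1 - k else k))"

lemma measurable_flip [measurable]:
  "flip n \<in> measurable (PiM UNIV (\<lambda>_. N)) (PiM UNIV (\<lambda>_. N))"
  unfolding flip_def by (rule measurable_abs_UNIV) measurable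

lemma suminf_ennreal_commute:
  fixes f :: "nat \<Rightarrow> nat \<Rightarrow> ennreal"
  shows "(\<Sum>m. \<Sum>n. f m n) = (\<Sum>n. \<Sum>m. f m n)"
proof -
  have "(\<Sum>m. \<Sum>n. f m n) = (\<integral>\<^sup>+ m. (\<Sum>n. f m n) \<partial>count_space UNIV)"
    by (simp add: nn_integral_count_space_nat)
  also have "\<dots> = (\<Sum>n. \<integral>\<^sup>+ m. f m n \<partial>count_space UNIV)"
    by (rule nn_integral_suminf) simp
  finally show ?thesis by (simp add: nn_integral_count_space_nat)
qed

lemma suminf_ennreal_offset:
  fixes g :: "nat \<Rightarrow> ennreal"
  shows "(\<Sum>n. if m \<le> n then g (n - m) else 0) = (\<Sum>n. g n)"
proof -
  have "(\<Sum>n. if m \<le> n then g (n - m) else 0)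
      = (\<Sum>n. if m \<le> n + m then g (n + m - m) else 0) + (\<Sum>i<m. if m \<le> i then g (i - m) else 0)"
    by (rule suminf_offset) (rule summableI)
  also have "(\<Sum>i<m. if m \<le> i then g (i - m) else 0) = 0" by (rule sum.neutral) auto
  finally show ?thesis by simp
qed

lemma le_suminf_ennreal:
  fixes g :: "nat \<Rightarrow> ennreal"
  shows "g k \<le> (\<Sum>n. g n)"
  using sum_le_suminf[of g "{k}"] summableI[of g] by simp

section \<open>Independence and time reversal for i.i.d. sequences\<close>

locale iid_seq = Q: prob_space Q for Q :: "'e measure" +
  assumes space_Q: "space Q = UNIV"
begin

lemma prob_space_Q: "prob_space Q" by (rule Q.prob_space_axioms)

sublocale sequence_space Q by unfold_locales

abbreviation R :: "(nat \<Rightarrow> 'e) measure" where "R \<equiv> PiM UNIV (\<lambda>_. Q)"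

lemma space_R [simp]: "space R = UNIV" by (auto simp: space_PiM space_Q)

text \<open>Stands in for conditioning on the first \<open>n\<close> entries: gluing an independent
  continuation to them by \<open>comb_seq\<close> does not change the law.\<close>

lemma nn_integral_split:
  assumes [measurable]: "(\<lambda>(c, c'). F c c') \<in> borel_measurable (R \<Otimes>\<^sub>M R)"
    and dep: "\<And>c d c'. (\<And>k. k < n \<Longrightarrow> c k = d k) \<Longrightarrow> F c c' = F d c'"
  shows "(\<integral>\<^sup>+ c. F c (shift n c) \<partial>R) = (\<integral>\<^sup>+ c. \<integral>\<^sup>+ c'. F c c' \<partial>R \<partial>R)"
proof -
  have [measurable]: "(\<lambda>c. F c (shift n c)) \<in> borel_measurable R"
    using measurable_compose[OF measurable_Pair[OF measurable_ident measurable_shift] assms(1)] by simp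
  have "(\<integral>\<^sup>+ c. F c (shift n c) \<partial>R)
      = (\<integral>\<^sup>+ c. F c (shift n c) \<partial>distr (R \<Otimes>\<^sub>M R) R (\<lambda>(\<omega>, \<omega>'). comb_seq n \<omega> \<omega>'))"
    by (simp add: PiM_comb_seq)
  also have "\<dots> = (\<integral>\<^sup>+ z. F (comb_seq n (fst z) (snd z)) (snd z) \<partial>(R \<Otimes>\<^sub>M R))"
    by (subst nn_integral_distr) (auto simp: split_beta')
  also have "\<dots> = (\<integral>\<^sup>+ z. F (fst z) (snd z) \<partial>(R \<Otimes>\<^sub>M R))"
    by (intro nn_integral_cong dep) (simp add: comb_seq_less)
  also have "\<dots> = (\<integral>\<^sup>+ c. \<integral>\<^sup>+ c'. F c c' \<partial>R \<partial>R)"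
    using P.nn_integral_fst[of "\<lambda>z. F (fst z) (snd z)" R] by (simp add: split_beta')
  finally show ?thesis .
qed

text \<open>The past is integrated first, with the tail frozen; this order is needed when the tail
  determines a threshold for the past.\<close>

lemma nn_integral_split_swap:
  assumes F [measurable]: "(\<lambda>(c, c'). F c c') \<in> borel_measurable (R \<Otimes>\<^sub>M R)"
    and dep: "\<And>c d c'. (\<And>k. k < n \<Longrightarrow> c k = d k) \<Longrightarrow> F c c' = F d c'"
  shows "(\<integral>\<^sup>+ c. F c (shift n c) \<partial>R) = (\<integral>\<^sup>+ c'. \<integral>\<^sup>+ c. F c c' \<partial>R \<partial>R)"
proof -
  interpret RR: pair_sigma_finite R R ..
  show ?thesis
    using RR.Fubini[of "\<lambda>z. F (fst z) (snd z)"] nn_integral_split[OF F dep]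
    by (simp add: split_beta')
qed

lemma nn_integral_flip:
  assumes [measurable]: "f \<in> borel_measurable R"
  shows "(\<integral>\<^sup>+ c. f (flip n c) \<partial>R) = (\<integral>\<^sup>+ c. f c \<partial>R)"
proof -
  have "distr R R (\<lambda>\<omega>. \<lambda>k\<in>UNIV. \<omega> (if k < n then n - 1 - k else k)) = R"
    by (rule distr_PiM_reindex) (auto simp: inj_on_def split: if_splits intro: prob_space_Q)
  then have "(\<integral>\<^sup>+ c. f c \<partial>R) = (\<integral>\<^sup>+ c. f c \<partial>distr R R (flip n))"
    by (simp add: flip_def[abs_def] restrict_def)
  also have "\<dots> = (\<integral>\<^sup>+ c. f (flip n c) \<partial>R)"
    by (subst nn_integral_distr) auto
  finally show ?thesis by simp
qed

lemma nn_integral_component: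
  assumes [measurable]: "f \<in> borel_measurable Q"
  shows "(\<integral>\<^sup>+ c. f (c k) \<partial>R) = (\<integral>\<^sup>+ e. f e \<partial>Q)"
proof -
  have "distr R Q (\<lambda>c. c k) = Q" using PiM_component[of k] by simp
  then have "(\<integral>\<^sup>+ e. f e \<partial>Q) = (\<integral>\<^sup>+ e. f e \<partial>distr R Q (\<lambda>c. c k))" by simp
  then show ?thesis by (simp add: nn_integral_distr)
qed

end

section \<open>The walk \<open>W\<close>, its clock \<open>V\<close>, and expectations over ladder
  epochs\<close>

locale iid_walk = iid_seq Q for Q :: "'e measure" +
  fixes Y G :: "'e \<Rightarrow> real"
  assumes measurable_Y [measurable]: "Y \<in> borel_measurable Q"
    and measurable_G [measurable]: "G \<in> borel_measurable Q"
    and G_ge_1: "\<And>e. 1 \<le> G e"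
begin

definition W :: "nat \<Rightarrow> (nat \<Rightarrow> 'e) \<Rightarrow> real" where "W n c = (\<Sum>k<n. Y (c k))"
abbreviation borel2 :: "(real \<Rightarrow> real \<Rightarrow> ennreal) \<Rightarrow> bool" where
  "borel2 f \<equiv> (\<lambda>(v, w). f v w) \<in> borel_measurable (borel \<Otimes>\<^sub>M borel)"

definition V :: "nat \<Rightarrow> (nat \<Rightarrow> 'e) \<Rightarrow> real" where "V n c = (\<Sum>k<n. G (c k))"

lemma measurable_W [measurable]: "W n \<in> borel_measurable R" unfolding W_def by measurable
lemma measurable_V [measurable]: "V n \<in> borel_measurable R" unfolding V_def by measurable

lemma W_0 [simp]: "W 0 c = 0" and V_0 [simp]: "V 0 c = 0" by (simp_all add: W_def V_def)
lemma W_Suc: "W (Suc n) c = W n c + Y (c n)" and V_Suc: "V (Suc n) c = V n c + G (c n)"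
  by (simp_all add: W_def V_def)
lemma W_add: "W (m + n) c = W m c + W n (shift m c)"
  by (induction n) (simp_all add: W_Suc)
lemma V_add: "V (m + n) c = V m c + V n (shift m c)"
  by (induction n) (simp_all add: V_Suc)
lemma W_cong: "(\<And>k. k < n \<Longrightarrow> c k = d k) \<Longrightarrow> W n c = W n d" by (simp add: W_def)
lemma V_cong: "(\<And>k. k < n \<Longrightarrow> c k = d k) \<Longrightarrow> V n c = V n d" by (simp add: V_def)
lemma V_ge: "real n \<le> V n c"
  unfolding V_def using sum_mono[of "{..<n}" "\<lambda>_. 1" "\<lambda>k. G (c k)"] G_ge_1 by simp
lemma V_nonneg [simp]: "0 \<le> V n c" using V_ge[of n c] by linarith
lemma V_mono: "m \<le> n \<Longrightarrow> V m c \<le> V n c"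
  using V_add[of m "n - m" c] V_nonneg[of "n - m" "shift m c"] by simp

lemma W_flip: "m \<le> n \<Longrightarrow> W m (flip n c) = W n c - W (n - m) c"
proof (induction m)
  case (Suc m)
  then have "n - m = Suc (n - Suc m)" by simp
  then have "W (n - m) c = W (n - Suc m) c + Y (c (n - Suc m))" using W_Suc by metis
  then show ?case using Suc by (simp add: W_Suc flip_def)
qed simp

lemma V_flip: "V n (flip n c) = V n c"
proof -
  have "m \<le> n \<Longrightarrow> V m (flip n c) = V n c - V (n - m) c" for m
  proof (induction m)
    case (Suc m)
    then have "n - m = Suc (n - Suc m)" by simp
    then have "V (n - m) c = V (n - Suc m) c + G (c (n - Suc m))" using V_Suc by metis
    then show ?case using Suc by (simp add: V_Suc flip_def)
  qed simp
  from this[of n] show ?thesis by simp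
qed

text \<open>For \<^term>\<open>A = {0<..}\<close> these describe the strict ascending ladder epochs of the walk, for
  \<^term>\<open>A = {..0}\<close> the weak descending ones.\<close>

definition entry :: "real set \<Rightarrow> nat \<Rightarrow> (nat \<Rightarrow> 'e) \<Rightarrow> bool" where
  "entry A n c \<longleftrightarrow> 1 \<le> n \<and> W n c \<in> A \<and> (\<forall>m. 1 \<le> m \<and> m < n \<longrightarrow> W m c \<notin> A)"

definition stay :: "real set \<Rightarrow> nat \<Rightarrow> (nat \<Rightarrow> 'e) \<Rightarrow> bool" where
  "stay A n c \<longleftrightarrow> (\<forall>m. 1 \<le> m \<and> m \<le> n \<longrightarrow> W m c \<in> A)"

definition ladder :: "real set \<Rightarrow> nat \<Rightarrow> (nat \<Rightarrow> 'e) \<Rightarrow> bool" where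
  "ladder A n c \<longleftrightarrow> (\<forall>m<n. W n c - W m c \<in> A)"

text \<open>Peeling off the first entry, not the last one, leaves a ladder epoch of the shifted
  path, which is independent of what was removed.\<close>

primrec ladder_at :: "real set \<Rightarrow> nat \<Rightarrow> nat \<Rightarrow> (nat \<Rightarrow> 'e) \<Rightarrow> bool" where
  "ladder_at A 0 n c = (n = 0)"
| "ladder_at A (Suc k) n c = (\<exists>m\<in>{..n}. entry A m c \<and> ladder_at A k (n - m) (shift m c))"

lemma measurable_entry [measurable]:
  assumes [measurable]: "A \<in> sets borel"
  shows "Measurable.pred R (entry A n)"
  unfolding entry_def by measurable

lemma measurable_stay [measurable]:
  assumes [measurable]: "A \<in> sets borel"
  shows "Measurable.pred R (stay A n)"
  unfolding stay_def by measurable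

lemma measurable_ladder [measurable]:
  assumes [measurable]: "A \<in> sets borel"
  shows "Measurable.pred R (ladder A n)"
  unfolding ladder_def by measurable

lemma measurable_ladder_at [measurable]:
  assumes A [measurable]: "A \<in> sets borel"
  shows "Measurable.pred R (ladder_at A k n)"
proof (induction k arbitrary: n)
  case 0
  then show ?case by simp
next
  case (Suc k)
  note [measurable] = Suc
  have "Measurable.pred R (\<lambda>c. ladder_at A k (n - m) (shift m c))" for m
    by (rule measurable_compose[OF measurable_shift Suc])
  note [measurable] = this
  show ?case by simp
qed

lemma entry_cong:
  assumes "\<And>k. k < n \<Longrightarrow> c k = d k"
  shows "entry A n c = entry A n d"
proof -
  have "W m c = W m d" if "m \<le> n" for m using W_cong[of m c d] assms that by auto
  then show ?thesis unfolding entry_def by auto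
qed

lemma stay_cong:
  assumes "\<And>k. k < n \<Longrightarrow> c k = d k"
  shows "stay A n c = stay A n d"
proof -
  have "W m c = W m d" if "m \<le> n" for m using W_cong[of m c d] assms that by auto
  then show ?thesis unfolding stay_def by auto
qed

lemma ladder_cong:
  assumes "\<And>k. k < n \<Longrightarrow> c k = d k"
  shows "ladder A n c = ladder A n d"
proof -
  have "W m c = W m d" if "m \<le> n" for m using W_cong[of m c d] assms that by auto
  then show ?thesis unfolding ladder_def by auto
qed

lemma stay_flip: "stay A n (flip n c) = ladder A n c"
proof -
  have "stay A n (flip n c) \<longleftrightarrow> (\<forall>m. 1 \<le> m \<and> m \<le> n \<longrightarrow> W n c - W (n - m) c \<in> A)"
    unfolding stay_def by (auto simp: W_flip)
  also have "\<dots> \<longleftrightarrow> (\<forall>m<n. W n c - W m c \<in> A)"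
  proof safe
    fix m assume *: "\<forall>m. 1 \<le> m \<and> m \<le> n \<longrightarrow> W n c - W (n - m) c \<in> A" "m < n"
    then have "n - (n - m) = m" "1 \<le> n - m" "n - m \<le> n" by auto
    then show "W n c - W m c \<in> A" using * by metis
  qed simp
  finally show ?thesis unfolding ladder_def .
qed

text \<open>Reversing the first \<open>n\<close> steps changes neither \<open>V n\<close> nor
  \<open>W n\<close>, so the duality holds jointly with both.\<close>

lemma nn_integral_stay_eq_ladder:
  assumes [measurable]: "borel2 f" "A \<in> sets borel"
  shows "(\<integral>\<^sup>+ c. (if stay A n c then f (V n c) (W n c) else 0) \<partial>R)
       = (\<integral>\<^sup>+ c. (if ladder A n c then f (V n c) (W n c) else (0::ennreal)) \<partial>R)"
proof -
  have [measurable]: "(\<lambda>c. f (V n c) (W n c)) \<in> borel_measurable R"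
    using measurable_compose[OF measurable_Pair[OF measurable_V measurable_W] assms(1)] by simp
  have "(\<integral>\<^sup>+ c. (if stay A n c then f (V n c) (W n c) else 0) \<partial>R)
      = (\<integral>\<^sup>+ c. (if stay A n (flip n c) then f (V n (flip n c)) (W n (flip n c)) else 0) \<partial>R)"
    by (rule nn_integral_flip[symmetric]) measurable
  then show ?thesis by (simp add: stay_flip V_flip W_flip cong: if_cong)
qed

lemma entry_unique: "entry A m c \<Longrightarrow> entry A n c \<Longrightarrow> m = n"
  unfolding entry_def by (metis linorder_neqE_nat)

text \<open>The first entry into \<open>A\<close> happens by time \<open>n\<close> because
  \<open>W n c - W 0 c\<close> lies in \<open>A\<close>; the remaining stretch ends in a ladder
  epoch of the shifted path.\<close>

lemma ladder_imp_ladder_at: "ladder A n c \<Longrightarrow> \<exists>k. ladder_at A k n c"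
proof (induction n arbitrary: c rule: less_induct)
  case (less n)
  show ?case
  proof (cases "n = 0")
    case True
    then show ?thesis by (intro exI[of _ 0]) simp
  next
    case False
    then have "1 \<le> n \<and> W n c \<in> A" using less.prems unfolding ladder_def by force
    then obtain m where m: "m \<le> n" "entry A m c"
      using exists_least_iff[of "\<lambda>m. 1 \<le> m \<and> W m c \<in> A"] unfolding entry_def
      by (metis not_le)
    then have "1 \<le> m" by (simp add: entry_def)
    have "ladder A (n - m) (shift m c)"
      unfolding ladder_def
    proof (intro allI impI)
      fix j assume j: "j < n - m"
      have "W n c = W m c + W (n - m) (shift m c)" using W_add[of m "n - m" c] m by simp
      then have "W (n - m) (shift m c) - W j (shift m c) = W n c - W (m + j) c"
        using W_add[of m j c] by simp
      then show "W (n - m) (shift m c) - W j (shift m c) \<in> A"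
        using less.prems j unfolding ladder_def by simp
    qed
    then obtain k where "ladder_at A k (n - m) (shift m c)"
      using less.IH[of "n - m"] \<open>1 \<le> m\<close> False by fastforce
    then have "ladder_at A (Suc k) n c" using m by auto
    then show ?thesis by blast
  qed
qed

text \<open>For \<open>entry A\<close> at most one \<open>n\<close> contributes, so this is an
  expectation at the first entry, restricted to the event that it happens; the constant 1 gives the
  probability of that event. For \<open>ladder A\<close> it is integration against the renewal
  measure of the ladder process.\<close>

definition epoch_sum :: "(nat \<Rightarrow> (nat \<Rightarrow> 'e) \<Rightarrow> bool) \<Rightarrow> (real \<Rightarrow> real \<Rightarrow> ennreal) \<Rightarrow> ennreal" where
  "epoch_sum P f = (\<Sum>n. \<integral>\<^sup>+ c. (if P n c then f (V n c) (W n c) else 0) \<partial>R)"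

abbreviation "entry_sum A \<equiv> epoch_sum (entry A)"
abbreviation "nth_ladder_sum A k \<equiv> epoch_sum (ladder_at A k)"

lemma measurable_fVW:
  assumes "borel2 f"
  shows "(\<lambda>c. f (V n c) (W n c)) \<in> borel_measurable R"
  using measurable_compose[OF measurable_Pair[OF measurable_V measurable_W] assms] by simp

lemma epoch_sum_mono: "(\<And>v w. 0 \<le> v \<Longrightarrow> f v w \<le> g v w) \<Longrightarrow> epoch_sum P f \<le> epoch_sum P g"
  unfolding epoch_sum_def by (intro suminf_le nn_integral_mono) auto

lemma entry_sum_mono:
  assumes "\<And>v w. 1 \<le> v \<Longrightarrow> w \<in> A \<Longrightarrow> f v w \<le> g v w"
  shows "entry_sum A f \<le> entry_sum A g"
proof -
  have "1 \<le> V n c" if "entry A n c" for n c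
    using V_ge[of n c] that by (simp add: entry_def)
  then show ?thesis
    unfolding epoch_sum_def using assms by (intro suminf_le nn_integral_mono) (auto simp: entry_def)
qed

lemma epoch_sum_lin:
  assumes f: "borel2 f" and g: "borel2 g" and P [measurable]: "\<And>n. Measurable.pred R (P n)"
  shows "epoch_sum P (\<lambda>v w. x * f v w + y * g v w) = x * epoch_sum P f + y * epoch_sum P g"
proof -
  note [measurable] = measurable_fVW[OF f] measurable_fVW[OF g]
  have "epoch_sum P (\<lambda>v w. x * f v w + y * g v w)
      = (\<Sum>n. \<integral>\<^sup>+ c. x * (if P n c then f (V n c) (W n c) else 0)
             + y * (if P n c then g (V n c) (W n c) else 0) \<partial>R)"
    unfolding epoch_sum_def by (intro suminf_cong nn_integral_cong) auto
  also have "\<dots> = x * epoch_sum P f + y * epoch_sum P g"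
    unfolding epoch_sum_def
    by (simp add: nn_integral_add nn_integral_cmult suminf_add[OF summableI summableI, symmetric])
  finally show ?thesis .
qed

lemma epoch_sum_cmult:
  assumes "borel2 f" "\<And>n. Measurable.pred R (P n)"
  shows "epoch_sum P (\<lambda>v w. x * f v w) = x * epoch_sum P f"
  using epoch_sum_lin[OF assms(1) assms(1) assms(2), where x = x and y = 0] by simp

lemma nth_ladder_sum_0: "nth_ladder_sum A 0 f = f 0 0"
proof -
  have "nth_ladder_sum A 0 f = (\<Sum>n. if n = 0 then f 0 0 else 0)"
    unfolding epoch_sum_def by (intro suminf_cong) (simp add: P.emeasure_space_1[simplified])
  also have "\<dots> = f 0 0"
    using suminf_finite[of "{0::nat}" "\<lambda>n. if n = 0 then f 0 0 else 0"] by simp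
  finally show ?thesis .
qed

text \<open>The strong Markov property at the first entry, stated with a majorant \<open>g\<close>
  of the continuation: \<open>g\<close> is measurable by hypothesis, and explicit bounds can be
  passed through an induction over \<open>k\<close>.\<close>

lemma nth_ladder_sum_Suc_le:
  assumes f: "borel2 f"
    and A [measurable]: "A \<in> sets borel"
    and g: "borel2 g"
    and le: "\<And>v w. 0 \<le> v \<Longrightarrow> nth_ladder_sum A k (\<lambda>v' w'. f (v + v') (w + w')) \<le> g v w"
  shows "nth_ladder_sum A (Suc k) f \<le> entry_sum A g"
proof -
  note [measurable] = measurable_fVW[OF f] measurable_fVW[OF g]
  have [measurable]: "(\<lambda>(v, v', w, w'). f (v + v') (w + w')) \<in> borel_measurable (borel \<Otimes>\<^sub>M borel \<Otimes>\<^sub>M borel \<Otimes>\<^sub>M borel)"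
    using measurable_compose[OF _ f, of "\<lambda>(v, v', w, w'). (v + v', w + w')" "borel \<Otimes>\<^sub>M borel \<Otimes>\<^sub>M borel \<Otimes>\<^sub>M borel"]
    by (simp add: split_beta')
  have fm [measurable]: "(\<lambda>(c, c'). f (V m c + V j c') (W m c + W j c')) \<in> borel_measurable (R \<Otimes>\<^sub>M R)" for m j
  proof -
    have "(\<lambda>z. (V m (fst z) + V j (snd z), W m (fst z) + W j (snd z))) \<in> R \<Otimes>\<^sub>M R \<rightarrow>\<^sub>M borel \<Otimes>\<^sub>M borel"
      by measurable
    from measurable_compose[OF this f] show ?thesis by (simp add: split_beta')
  qed
  \<comment> \<open>First entry at time \<open>m\<close>, then \<open>j\<close> further steps; the
    total time is \<open>m + j\<close>, so the double sum over \<open>n\<close> and \<open>m\<close>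
    is reindexed by \<open>j = n - m\<close>.\<close>
  define H where "H m j c c' = (if entry A m c \<and> ladder_at A k j c'
      then f (V m c + V j c') (W m c + W j c') else 0)" for m j c c'
  have Hm [measurable]: "(\<lambda>(c, c'). H m j c c') \<in> borel_measurable (R \<Otimes>\<^sub>M R)" for m j
    unfolding H_def by measurable
  have Hm' [measurable]: "(\<lambda>c. H m j c (shift m c)) \<in> borel_measurable R" for m j
    using measurable_compose[OF measurable_Pair[OF measurable_ident measurable_shift] Hm] by simp
  have "nth_ladder_sum A (Suc k) f \<le> (\<Sum>n. \<integral>\<^sup>+ c. (\<Sum>m. if m \<le> n then H m (n - m) c (shift m c) else 0) \<partial>R)"
    unfolding epoch_sum_def
  proof (intro suminf_le nn_integral_mono)
    fix n c
    show "(if ladder_at A (Suc k) n c then f (V n c) (W n c) else 0)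
       \<le> (\<Sum>m. if m \<le> n then H m (n - m) c (shift m c) else 0)"
    proof (cases "ladder_at A (Suc k) n c")
      case True
      then obtain m where m: "m \<le> n" "entry A m c" "ladder_at A k (n - m) (shift m c)" by auto
      then have "f (V n c) (W n c) = (if m \<le> n then H m (n - m) c (shift m c) else 0)"
        using V_add[of m "n - m" c] W_add[of m "n - m" c] by (simp add: H_def)
      also have "\<dots> \<le> (\<Sum>m. if m \<le> n then H m (n - m) c (shift m c) else 0)"
        by (rule le_suminf_ennreal[where k = m])
      finally show ?thesis by simp
    next
      case False
      then show ?thesis unfolding if_not_P[OF False] by simp
    qed
  qed auto
  also have "\<dots> = (\<Sum>n. \<Sum>m. \<integral>\<^sup>+ c. (if m \<le> n then H m (n - m) c (shift m c) else 0) \<partial>R)"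
    by (intro suminf_cong nn_integral_suminf) simp
  also have "\<dots> = (\<Sum>m. \<Sum>n. \<integral>\<^sup>+ c. (if m \<le> n then H m (n - m) c (shift m c) else 0) \<partial>R)"
    by (rule suminf_ennreal_commute)
  also have "\<dots> = (\<Sum>m. \<Sum>n. if m \<le> n then (\<integral>\<^sup>+ c. H m (n - m) c (shift m c) \<partial>R) else 0)"
    by (intro suminf_cong) simp
  also have "\<dots> = (\<Sum>m. \<Sum>j. (\<integral>\<^sup>+ c. H m j c (shift m c) \<partial>R))"
    by (intro suminf_cong suminf_ennreal_offset)
  also have "\<dots> = (\<Sum>m. \<Sum>j. \<integral>\<^sup>+ c. \<integral>\<^sup>+ c'. H m j c c' \<partial>R \<partial>R)"
  proof (intro suminf_cong nn_integral_split Hm)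
    fix m j and c d c' :: "nat \<Rightarrow> 'e" assume "\<And>k. k < m \<Longrightarrow> c k = d k"
    then have "W m c = W m d" "V m c = V m d" "entry A m c = entry A m d"
      using W_cong V_cong entry_cong by blast+
    then show "H m j c c' = H m j d c'" by (simp add: H_def)
  qed
  also have "\<dots> = (\<Sum>m. \<integral>\<^sup>+ c. (\<Sum>j. \<integral>\<^sup>+ c'. H m j c c' \<partial>R) \<partial>R)"
    by (intro suminf_cong nn_integral_suminf[symmetric]) measurable
  also have "\<dots> \<le> entry_sum A g"
    unfolding epoch_sum_def
  proof (intro suminf_le nn_integral_mono)
    fix m c
    show "(\<Sum>j. \<integral>\<^sup>+ c'. H m j c c' \<partial>R) \<le> (if entry A m c then g (V m c) (W m c) else 0)"
    proof (cases "entry A m c")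
      case True
      then have "(\<Sum>j. \<integral>\<^sup>+ c'. H m j c c' \<partial>R) = nth_ladder_sum A k (\<lambda>v' w'. f (V m c + v') (W m c + w'))"
        unfolding epoch_sum_def H_def by simp
      with le True show ?thesis by simp
    qed (simp add: H_def)
  qed auto
  finally show ?thesis .
qed

declare ladder_at.simps [simp del]

lemma ladder_sum_le:
  assumes f: "borel2 f"
    and A [measurable]: "A \<in> sets borel"
  shows "epoch_sum (ladder A) f \<le> (\<Sum>k. nth_ladder_sum A k f)"
proof -
  note [measurable] = measurable_fVW[OF f]
  have "epoch_sum (ladder A) f \<le> (\<Sum>n. \<integral>\<^sup>+ c. (\<Sum>k. if ladder_at A k n c then f (V n c) (W n c) else 0) \<partial>R)"
    unfolding epoch_sum_def
  proof (intro suminf_le nn_integral_mono)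
    fix n c
    show "(if ladder A n c then f (V n c) (W n c) else 0)
       \<le> (\<Sum>k. if ladder_at A k n c then f (V n c) (W n c) else 0)"
    proof (cases "ladder A n c")
      case True
      then obtain k where k: "ladder_at A k n c" using ladder_imp_ladder_at by blast
      then show ?thesis
        using le_suminf_ennreal[of "\<lambda>k. if ladder_at A k n c then f (V n c) (W n c) else 0" k] True by simp
    qed simp
  qed auto
  also have "\<dots> = (\<Sum>n. \<Sum>k. \<integral>\<^sup>+ c. (if ladder_at A k n c then f (V n c) (W n c) else 0) \<partial>R)"
    by (intro suminf_cong nn_integral_suminf) measurable
  also have "\<dots> = (\<Sum>k. nth_ladder_sum A k f)"
    unfolding epoch_sum_def by (rule suminf_ennreal_commute)
  finally show ?thesis .
qed

lemma stay_sum_le: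
  assumes f: "borel2 f" and A: "A \<in> sets borel"
  shows "epoch_sum (stay A) f \<le> (\<Sum>k. nth_ladder_sum A k f)"
  using ladder_sum_le[OF f A] by (simp add: epoch_sum_def nn_integral_stay_eq_ladder[OF f A])

text \<open>Successive ladder heights are independent with the same law, and the exponential turns
  their sum into a product. With \<open>l = 0\<close> this bounds the probability that a
  \<open>k\<close>-th epoch exists.\<close>

lemma nth_ladder_sum_exp_le:
  assumes A: "A \<in> sets borel"
  shows "nth_ladder_sum A k (\<lambda>v w. ennreal (exp (- (l * w)))) \<le> entry_sum A (\<lambda>v w. ennreal (exp (- (l * w)))) ^ k"
    (is "nth_ladder_sum A k ?f \<le> ?p ^ k")
proof (induction k)
  case 0
  then show ?case by (simp add: nth_ladder_sum_0)
next
  case (Suc k)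
  have m: "borel2 ?f" by measurable
  have "nth_ladder_sum A (Suc k) ?f \<le> entry_sum A (\<lambda>v w. nth_ladder_sum A k ?f * ?f v w)"
  proof (rule nth_ladder_sum_Suc_le[OF m A])
    fix v w :: real
    have "nth_ladder_sum A k (\<lambda>v' w'. ?f (v + v') (w + w')) = nth_ladder_sum A k (\<lambda>v' w'. ?f v w * ?f v' w')"
      by (simp add: distrib_left exp_add[symmetric] ennreal_mult[symmetric])
    also have "\<dots> = ?f v w * nth_ladder_sum A k ?f" by (rule epoch_sum_cmult[OF m measurable_ladder_at[OF A]])
    finally show "nth_ladder_sum A k (\<lambda>v' w'. ?f (v + v') (w + w')) \<le> nth_ladder_sum A k ?f * ?f v w"
      by (simp add: mult.commute)
  qed measurable
  also have "\<dots> = nth_ladder_sum A k ?f * ?p" by (rule epoch_sum_cmult[OF m measurable_entry[OF A]])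
  also have "\<dots> \<le> ?p ^ k * ?p" by (intro mult_right_mono Suc) simp
  finally show ?case by (simp add: mult.commute)
qed

text \<open>The power of a sum of \<open>k\<close> block weights is at most
  \<open>real k powr max (s - 1) 0\<close> times the sum of their powers. In each of the
  \<open>k\<close> resulting terms one block carries the moment, and the others contribute
  \<open>k - 1\<close> Laplace factors.\<close>

lemma nth_ladder_sum_powr_exp_le:
  assumes A: "A \<in> sets borel" and s: "0 < s"
  shows "nth_ladder_sum A k (\<lambda>v w. ennreal (v powr s * exp (- (l * w))))
      \<le> ennreal (real k * real k powr max (s - 1) 0)
         * entry_sum A (\<lambda>v w. ennreal (exp (- (l * w)))) ^ (k - 1)
         * entry_sum A (\<lambda>v w. ennreal (v powr s * exp (- (l * w))))"
    (is "nth_ladder_sum A k ?f \<le> _ * ?p ^ _ * ?m")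
proof (induction k)
  case 0
  then show ?case using s by (simp add: nth_ladder_sum_0)
next
  case (Suc k)
  let ?e = "\<lambda>v w :: real. ennreal (exp (- (l * w)))"
  have m: "borel2 ?f"
    and me: "borel2 ?e" by measurable
  show ?case
  proof (cases "k = 0")
    case True
    have "nth_ladder_sum A (Suc 0) ?f \<le> entry_sum A ?f"
      by (rule nth_ladder_sum_Suc_le[OF m A m]) (simp add: nth_ladder_sum_0)
    then show ?thesis using True by simp
  next
    case False
    let ?r = "max (s - 1) 0"
    define c1 where "c1 = ((real k + 1) / real k) powr ?r"
    define c2 where "c2 = (real k + 1) powr ?r"
    have "nth_ladder_sum A (Suc k) ?f \<le> entry_sum A (\<lambda>v w. (ennreal c1 * nth_ladder_sum A k ?f) * ?e v w + (ennreal c2 * nth_ladder_sum A k ?e) * ?f v w)"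
    proof (rule nth_ladder_sum_Suc_le[OF m A])
      fix v w :: real assume v: "0 \<le> v"
      have "nth_ladder_sum A k (\<lambda>v' w'. ?f (v + v') (w + w'))
         \<le> nth_ladder_sum A k (\<lambda>v' w'. (ennreal c1 * ?e v w) * ?f v' w' + (ennreal c2 * ?f v w) * ?e v' w')"
      proof (rule epoch_sum_mono)
        fix v' w' :: real assume v': "0 \<le> v'"
        have "(v + v') powr s \<le> c1 * v' powr s + c2 * v powr s"
          using powr_add_le_weighted[of v' v s k] v v' s False by (simp add: c1_def c2_def add.commute)
        then have "(v + v') powr s * (exp (- (l * w)) * exp (- (l * w')))
             \<le> (c1 * v' powr s + c2 * v powr s) * (exp (- (l * w)) * exp (- (l * w')))"
          by (intro mult_right_mono) auto
        then have "(v + v') powr s * exp (- (l * (w + w')))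
             \<le> (c1 * exp (- (l * w))) * (v' powr s * exp (- (l * w')))
               + (c2 * (v powr s * exp (- (l * w)))) * exp (- (l * w'))"
          by (simp add: algebra_simps exp_add[symmetric])
        then have "ennreal ((v + v') powr s * exp (- (l * (w + w'))))
             \<le> ennreal ((c1 * exp (- (l * w))) * (v' powr s * exp (- (l * w')))
               + (c2 * (v powr s * exp (- (l * w)))) * exp (- (l * w')))"
          by (rule ennreal_leI)
        also have "\<dots> = (ennreal c1 * ?e v w) * ?f v' w' + (ennreal c2 * ?f v w) * ?e v' w'"
          by (simp add: ennreal_mult ennreal_plus c1_def c2_def)
        finally show "?f (v + v') (w + w')
           \<le> (ennreal c1 * ?e v w) * ?f v' w' + (ennreal c2 * ?f v w) * ?e v' w'" .
      qed
      also have "\<dots> = (ennreal c1 * ?e v w) * nth_ladder_sum A k ?f + (ennreal c2 * ?f v w) * nth_ladder_sum A k ?e"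
        by (rule epoch_sum_lin[OF m me measurable_ladder_at[OF A]])
      finally show "nth_ladder_sum A k (\<lambda>v' w'. ?f (v + v') (w + w'))
         \<le> (ennreal c1 * nth_ladder_sum A k ?f) * ?e v w + (ennreal c2 * nth_ladder_sum A k ?e) * ?f v w"
        by (simp add: mult_ac)
    qed measurable
    also have "\<dots> = (ennreal c1 * nth_ladder_sum A k ?f) * ?p + (ennreal c2 * nth_ladder_sum A k ?e) * ?m"
      by (rule epoch_sum_lin[OF me m measurable_entry[OF A]])
    also have "\<dots> \<le> (ennreal c1 * (ennreal (real k * real k powr ?r) * ?p ^ (k - 1) * ?m)) * ?p
        + (ennreal c2 * ?p ^ k) * ?m"
      by (intro add_mono mult_right_mono mult_left_mono Suc nth_ladder_sum_exp_le A) auto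
    also have "\<dots> = (ennreal c1 * ennreal (real k * real k powr ?r) + ennreal c2) * (?p ^ k * ?m)"
      using False by (cases k) (simp_all add: algebra_simps)
    also have "ennreal c1 * ennreal (real k * real k powr ?r) + ennreal c2
        = ennreal (c1 * (real k * real k powr ?r) + c2)"
      by (simp add: ennreal_mult ennreal_plus c1_def c2_def)
    \<comment> \<open>The weights in \<open>powr_add_le_weighted\<close> are chosen so that this is
      an identity and the induction closes without loss.\<close>
    also have "c1 * (real k * real k powr ?r) + c2 = (real k + 1) * (real k + 1) powr ?r"
      using False by (simp add: c1_def c2_def powr_divide field_simps)
    finally show ?thesis by (simp add: mult_ac add.commute)
  qed
qed

lemma entry_sum_le_nn_integral:
  assumes f: "borel2 f"
    and A [measurable]: "A \<in> sets borel"
    and le: "\<And>n c. entry A n c \<Longrightarrow> f (V n c) (W n c) \<le> g c"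
  shows "entry_sum A f \<le> (\<integral>\<^sup>+ c. g c \<partial>R)"
proof -
  note [measurable] = measurable_fVW[OF f]
  have "entry_sum A f = (\<integral>\<^sup>+ c. (\<Sum>n. if entry A n c then f (V n c) (W n c) else 0) \<partial>R)"
    unfolding epoch_sum_def by (intro nn_integral_suminf[symmetric]) measurable
  also have "\<dots> \<le> (\<integral>\<^sup>+ c. g c \<partial>R)"
  proof (intro nn_integral_mono)
    fix c
    show "(\<Sum>n. if entry A n c then f (V n c) (W n c) else 0) \<le> g c"
    proof (cases "\<exists>n. entry A n c")
      case True
      then obtain n where n: "entry A n c" by blast
      then have "(\<Sum>m. if entry A m c then f (V m c) (W m c) else 0)
          = (\<Sum>m\<in>{n}. if entry A m c then f (V m c) (W m c) else 0)"
        by (intro suminf_finite) (auto dest: entry_unique)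
      then show ?thesis using n le by simp
    qed simp
  qed
  finally show ?thesis .
qed

section \<open>The truncated mean and the function \<open>J\<close>\<close>

definition trunc_mean :: "real \<Rightarrow> real" where
  "trunc_mean y = (\<integral>e. min (max (Y e) 0) y \<partial>Q)"

text \<open>Agrees with \<open>J_fun\<close> once the step is positive with positive probability, as
  \<open>iid_walk_up\<close> assumes. At 0 the quotient would be 0 and \<open>J_ge_1\<close> would
  fail.\<close>

definition J :: "real \<Rightarrow> real" where
  "J y = (if y = 0 then 1 else y / trunc_mean y)"

lemma integrable_trunc: "0 \<le> y \<Longrightarrow> integrable Q (\<lambda>e. min (max (Y e) 0) y)"
  by (intro Q.integrable_const_bound[where B = y]) (auto simp: space_Q)

lemma trunc_mean_nonneg: "0 \<le> y \<Longrightarrow> 0 \<le> trunc_mean y"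
  unfolding trunc_mean_def by (intro Bochner_Integration.integral_nonneg) auto

lemma trunc_mean_le: "0 \<le> y \<Longrightarrow> trunc_mean y \<le> y"
  using integral_mono[OF integrable_trunc[of y], of "\<lambda>_. y"] by (simp add: trunc_mean_def Q.prob_space)

lemma trunc_mean_mono: "0 \<le> x \<Longrightarrow> x \<le> y \<Longrightarrow> trunc_mean x \<le> trunc_mean y"
  unfolding trunc_mean_def by (intro integral_mono integrable_trunc) auto

text \<open>In other words \<open>trunc_mean y / y\<close> is nonincreasing in \<open>y\<close>,
  which makes \<open>J\<close> nondecreasing.\<close>

lemma trunc_mean_le_mult:
  assumes "0 < x" "x \<le> y"
  shows "trunc_mean y \<le> y / x * trunc_mean x"
proof -
  have "min (max u 0) y \<le> y / x * min (max u 0) x" for u :: real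
  proof -
    have "max u 0 * x \<le> max u 0 * y" by (intro mult_left_mono) (use assms in auto)
    then show ?thesis using assms by (auto simp: min_def field_simps)
  qed
  then have "trunc_mean y \<le> (\<integral>e. y / x * min (max (Y e) 0) x \<partial>Q)"
    unfolding trunc_mean_def
    by (intro integral_mono integrable_trunc integrable_mult_right) (use assms in auto)
  then show ?thesis by (simp add: trunc_mean_def)
qed

lemma measurable_trunc_mean [measurable]: "trunc_mean \<in> borel_measurable borel"
proof -
  have "(\<lambda>y. \<integral>e. (case (y, e) of (y, e) \<Rightarrow> min (max (Y e) 0) y) \<partial>Q) \<in> borel_measurable borel"
    by (rule Q.borel_measurable_lebesgue_integral) measurable
  then show ?thesis by (simp add: trunc_mean_def[abs_def])
qed

lemma measurable_J [measurable]: "J \<in> borel_measurable borel"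
  unfolding J_def[abs_def] by measurable

end

locale iid_walk_up = iid_walk Q Y G for Q :: "'e measure" and Y G +
  assumes pos_up: "measure Q {e. 0 < Y e} > 0"
begin

lemma trunc_mean_pos:
  assumes "0 < y"
  shows "0 < trunc_mean y"
proof -
  have "trunc_mean y \<noteq> 0"
  proof
    assume "trunc_mean y = 0"
    then have "AE e in Q. min (max (Y e) 0) y = 0"
      unfolding trunc_mean_def using assms
      by (subst (asm) integral_nonneg_eq_0_iff_AE) (auto intro: integrable_trunc)
    then have "AE e in Q. e \<notin> {e. 0 < Y e}"
      by eventually_elim (use assms in \<open>auto simp: min_def max_def split: if_splits\<close>)
    then have "measure Q {e. 0 < Y e} = 0"
    proof (subst Q.prob_eq_0)
      have "{e \<in> space Q. 0 < Y e} \<in> sets Q" by measurable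
      then show "{e. 0 < Y e} \<in> sets Q" by (simp add: space_Q)
    qed
    then show False using pos_up by simp
  qed
  then show ?thesis using trunc_mean_nonneg[of y] assms by simp
qed

lemma J_ge_1: "0 \<le> y \<Longrightarrow> 1 \<le> J y"
  using trunc_mean_pos[of y] trunc_mean_le[of y] by (auto simp: J_def)

lemma J_mono:
  assumes "0 \<le> x" "x \<le> y"
  shows "J x \<le> J y"
proof (cases "x = 0")
  case True
  then show ?thesis using J_ge_1[of y] assms by (simp add: J_def)
next
  case False
  then have "0 < x" "0 < y" using assms by auto
  then show ?thesis
    using trunc_mean_le_mult[of x y] trunc_mean_pos[of x] trunc_mean_pos[of y] assms
    by (simp add: J_def field_simps)
qed

text \<open>Away from 0, \<open>J\<close> is the identity divided by a nondecreasing
  function.\<close>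

lemma J_add_le:
  assumes "0 \<le> x" "0 \<le> y"
  shows "J (x + y) \<le> J x + J y"
proof (cases "x = 0 \<or> y = 0")
  case True
  then show ?thesis using J_ge_1[of x] J_ge_1[of y] assms by (auto simp: J_def)
next
  case False
  then have "0 < x" "0 < y" using assms by auto
  then have "x / trunc_mean (x + y) \<le> x / trunc_mean x" "y / trunc_mean (x + y) \<le> y / trunc_mean y"
    by (auto intro!: divide_left_mono trunc_mean_mono mult_pos_pos trunc_mean_pos)
  then show ?thesis using \<open>0 < x\<close> \<open>0 < y\<close> by (simp add: J_def add_divide_distrib)
qed

lemma J_sum_le:
  assumes "finite I" "I \<noteq> {}" "\<And>i. i \<in> I \<Longrightarrow> 0 \<le> x i"
  shows "J (\<Sum>i\<in>I. x i) \<le> (\<Sum>i\<in>I. J (x i))"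
  using assms
proof (induction I rule: finite_ne_induct)
  case (insert i I)
  then have "J (x i + (\<Sum>i\<in>I. x i)) \<le> J (x i) + J (\<Sum>i\<in>I. x i)"
    by (intro J_add_le sum_nonneg) auto
  with insert show ?case by fastforce
qed simp

text \<open>If the first step is not positive, its truncated positive part vanishes and the
  exponential is simply bounded by 1. The constant 2 comes from
  \<open>exp (- t) \<le> 1 - t / 2\<close> on the unit interval.\<close>

lemma entry_sum_up_exp_le:
  assumes y: "0 < y"
  shows "entry_sum {0<..} (\<lambda>v w. ennreal (exp (- (1 / y * w)))) \<le> ennreal (1 - 1 / (2 * J y))"
proof -
  have *: "exp (- t) \<le> 1 - t / 2" if "0 \<le> t" "t \<le> 1" for t :: real
  proof -
    have "(1 + t) * exp (- t) \<le> exp t * exp (- t)"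
      by (intro mult_right_mono exp_ge_add_one_self) auto
    also have "\<dots> = 1" by (simp add: exp_add[symmetric])
    finally have "exp (- t) \<le> 1 / (1 + t)" using that by (simp add: field_simps)
    also have "\<dots> \<le> 1 - t / 2" using that mult_left_le[of t t] by (simp add: field_simps)
    finally show ?thesis .
  qed
  have "entry_sum {0<..} (\<lambda>v w. ennreal (exp (- (1 / y * w))))
     \<le> (\<integral>\<^sup>+ c. ennreal (1 - min (max (Y (c 0)) 0) y / (2 * y)) \<partial>R)"
  proof (rule entry_sum_le_nn_integral)
    fix n c assume e: "entry {0<..} n c"
    then have Wn: "0 < W n c" and n: "1 \<le> n" by (auto simp: entry_def)
    have "exp (- (1 / y * W n c)) \<le> 1 - min (max (Y (c 0)) 0) y / (2 * y)"
    proof (cases "0 < Y (c 0)")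
      case True
      have "W 1 c = Y (c 0)" by (simp add: W_def)
      then have "n = 1" using e True n unfolding entry_def
        by (metis greaterThan_iff le_neq_implies_less order.refl)
      have "exp (- (1 / y * W n c)) \<le> exp (- (min (Y (c 0)) y / y))"
        using y \<open>n = 1\<close> \<open>W 1 c = Y (c 0)\<close> by (auto simp: field_simps min_def)
      also have "\<dots> \<le> 1 - min (Y (c 0)) y / y / 2"
        by (intro *) (use y True in auto)
      finally show ?thesis using True by (simp add: mult.commute)
    next
      case False
      then show ?thesis using Wn y by (simp add: max_def min_def)
    qed
    then show "ennreal (exp (- (1 / y * W n c))) \<le> ennreal (1 - min (max (Y (c 0)) 0) y / (2 * y))"
      by (rule ennreal_leI)
  qed measurable
  also have "\<dots> = (\<integral>\<^sup>+ e. ennreal (1 - min (max (Y e) 0) y / (2 * y)) \<partial>Q)"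
    by (rule nn_integral_component) measurable
  also have "\<dots> = ennreal (\<integral>e. 1 - min (max (Y e) 0) y / (2 * y) \<partial>Q)"
    using y by (intro nn_integral_eq_integral Bochner_Integration.integrable_diff Q.integrable_const
        integrable_divide_zero integrable_trunc) (auto simp: field_simps)
  also have "(\<integral>e. 1 - min (max (Y e) 0) y / (2 * y) \<partial>Q) = 1 - trunc_mean y / (2 * y)"
    using y integrable_trunc[of y] by (subst Bochner_Integration.integral_diff) (auto simp: trunc_mean_def Q.prob_space)
  also have "\<dots> = 1 - 1 / (2 * J y)" using y by (simp add: J_def)
  finally show ?thesis .
qed

section \<open>Renewal bounds for the ascending ladder heights\<close>

abbreviation "ladder_sum \<equiv> epoch_sum (ladder {0<..})"

text \<open>Only epoch 0 has height at most 0. This covers the level \<open>y = 0\<close>, where a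
  tilt by \<open>1 / y\<close> makes no sense.\<close>

lemma ladder_sum_at_0:
  "ladder_sum (\<lambda>v w. if w \<le> 0 then f v else 0) = f 0"
proof -
  have *: "(if ladder {0<..} n c then if W n c \<le> 0 then f (V n c) else 0 else 0) = (if n = 0 then f 0 else 0)" for n c
    using V_0[of c] W_0[of c] by (cases "n = 0") (auto simp: ladder_def simp del: V_0 W_0 dest!: spec[of _ 0])
  have "ladder_sum (\<lambda>v w. if w \<le> 0 then f v else 0) = (\<Sum>n. if n = 0 then f 0 else 0)"
    unfolding epoch_sum_def by (intro suminf_cong) (simp add: * P.emeasure_space_1[simplified])
  also have "\<dots> = f 0"
    using suminf_finite[of "{0::nat}" "\<lambda>n. if n = 0 then f 0 else 0"] by simp
  finally show ?thesis .
qed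

text \<open>The upper half of the comparison of \<open>J\<close> with the renewal function: Markov's
  inequality for the tilted heights, then a geometric series. The maximum with 1 in \<open>C\<close>
  covers \<open>y = 0\<close>, where exactly epoch 0 is counted.\<close>

lemma ladder_sum_count_le:
  obtains C where "C \<ge> 1"
    "\<And>y. 0 \<le> y \<Longrightarrow> ladder_sum (\<lambda>v w. if w \<le> y then 1 else 0) \<le> ennreal (C * J y)"
proof -
  obtain C0 :: real where C0: "C0 > 0" "\<And>r. 0 \<le> r \<Longrightarrow> r < 1 \<Longrightarrow>
       (\<Sum>k. ennreal ((real k + 1) powr 0) * ennreal r ^ k) \<le> ennreal (C0 / (1 - r) powr (1 + 0))"
    using suminf_powr_geometric_le[of 0] by auto
  define C where "C = max 1 (2 * exp 1 * C0)"
  have "ladder_sum (\<lambda>v w. if w \<le> y then 1 else 0) \<le> ennreal (C * J y)" if "0 \<le> y" for y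
  proof (cases "y = 0")
    case True
    have "C \<ge> 1" by (simp add: C_def)
    then show ?thesis using ladder_sum_at_0[of "\<lambda>_. 1"] True by (simp add: J_def)
  next
    case False
    then have y: "0 < y" using that by simp
    let ?r = "1 - 1 / (2 * J y)"
    have J: "1 \<le> J y" using J_ge_1 y by simp
    then have r: "0 \<le> ?r" "?r < 1" by (auto simp: field_simps)
    have "ladder_sum (\<lambda>v w. if w \<le> y then 1 else 0)
       \<le> (\<Sum>k. nth_ladder_sum {0<..} k (\<lambda>v w. if w \<le> y then 1 else 0))"
      by (rule ladder_sum_le) measurable
    also have "\<dots> \<le> (\<Sum>k. nth_ladder_sum {0<..} k (\<lambda>v w. ennreal (exp 1) * ennreal (exp (- (1 / y * w)))))"
      using y by (intro suminf_le epoch_sum_mono)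
        (auto simp: ennreal_mult[symmetric] exp_add[symmetric] ennreal_leI field_simps simp flip: ennreal_1)
    also have "\<dots> = (\<Sum>k. ennreal (exp 1) * nth_ladder_sum {0<..} k (\<lambda>v w. ennreal (exp (- (1 / y * w)))))"
      by (intro suminf_cong epoch_sum_cmult) measurable
    also have "\<dots> \<le> (\<Sum>k. ennreal (exp 1) * (ennreal ((real k + 1) powr 0) * ennreal ?r ^ k))"
    proof (intro suminf_le mult_left_mono)
      fix k
      have "nth_ladder_sum {0<..} k (\<lambda>v w. ennreal (exp (- (1 / y * w))))
          \<le> entry_sum {0<..} (\<lambda>v w. ennreal (exp (- (1 / y * w)))) ^ k" by (rule nth_ladder_sum_exp_le) simp
      also have "\<dots> \<le> ennreal ?r ^ k" by (intro power_mono entry_sum_up_exp_le y) simp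
      finally show "nth_ladder_sum {0<..} k (\<lambda>v w. ennreal (exp (- (1 / y * w))))
         \<le> ennreal ((real k + 1) powr 0) * ennreal ?r ^ k" by simp
    qed auto
    also have "\<dots> = ennreal (exp 1) * (\<Sum>k. ennreal ((real k + 1) powr 0) * ennreal ?r ^ k)"
      by (rule ennreal_suminf_cmult)
    also have "\<dots> \<le> ennreal (exp 1) * ennreal (C0 / (1 - ?r) powr (1 + 0))"
      by (intro mult_left_mono C0 r) auto
    also have "\<dots> = ennreal (2 * exp 1 * C0 * J y)"
      using C0 J by (subst ennreal_mult[symmetric]) (auto simp: field_simps)
    also have "\<dots> \<le> ennreal (C * J y)"
      using J by (intro ennreal_leI mult_right_mono) (auto simp: C_def)
    finally show ?thesis .
  qed
  then show ?thesis by (intro that[of C]) (auto simp: C_def)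
qed

text \<open>For \<open>a < 1\<close> the general bound would give the factor \<open>k\<close> in
  place of \<open>k powr a\<close>. Therefore \<open>v powr a\<close> is bounded by a linear
  function of \<open>v / ?K\<close>, where \<open>?K\<close> is the number of blocks and thus the
  natural scale of \<open>v\<close>. This costs a first moment, whence the order
  \<open>max 1 a\<close>.\<close>

lemma nth_ladder_sum_up_powr_le:
  assumes a: "0 < a" and y: "0 < y"
  shows "nth_ladder_sum {0<..} (Suc j) (\<lambda>v w. ennreal (v powr a * exp (- (1 / y * w))))
     \<le> ennreal ((real j + 1) powr a) * ennreal (1 - 1 / (2 * J y)) ^ j
        * (1 + entry_sum {0<..} (\<lambda>v w. ennreal (v powr max 1 a)))"
    (is "?L \<le> _ * ?p ^ j * (1 + ?M)")
proof -
  let ?r = "1 - 1 / (2 * J y)" and ?K = "real j + 1" and ?A = "{0<..} :: real set"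
  let ?e = "\<lambda>w. exp (- (1 / y * w))"
  have J: "1 \<le> J y" using J_ge_1 y by simp
  then have r: "0 \<le> ?r" "?r < 1" by (auto simp: field_simps)
  have p1: "?p \<le> 1" using J by (simp add: ennreal_le_1)
  let ?q = "entry_sum ?A (\<lambda>v w. ennreal (?e w))"
  have qp: "?q \<le> ?p" by (rule entry_sum_up_exp_le[OF y])
  have EFle: "entry_sum ?A (\<lambda>v w. ennreal (v powr s * ?e w)) \<le> entry_sum ?A (\<lambda>v w. ennreal (v powr s))" for s
    using y by (intro entry_sum_mono ennreal_leI mult_left_le) auto
  show ?thesis
  proof (cases "1 \<le> a")
    case True
    have "?L \<le> ennreal (real (Suc j) * real (Suc j) powr max (a - 1) 0) * ?q ^ (Suc j - 1)
       * entry_sum ?A (\<lambda>v w. ennreal (v powr a * ?e w))"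
      by (rule nth_ladder_sum_powr_exp_le) (use a in auto)
    also have "\<dots> \<le> ennreal (?K powr a) * ?p ^ j * (1 + ?M)"
    proof (intro mult_mono)
      have "real (Suc j) * real (Suc j) powr max (a - 1) 0 = ?K powr a"
        using True by (simp add: powr_diff add.commute)
      then show "ennreal (real (Suc j) * real (Suc j) powr max (a - 1) 0) \<le> ennreal (?K powr a)" by simp
      show "?q ^ (Suc j - 1) \<le> ?p ^ j" using qp by (simp add: power_mono)
      have "entry_sum ?A (\<lambda>v w. ennreal (v powr a * ?e w)) \<le> ?M"
        using EFle[of a] True by (simp add: max_def)
      then show "entry_sum ?A (\<lambda>v w. ennreal (v powr a * ?e w)) \<le> 1 + ?M"
        by (rule order_trans) simp
    qed auto
    finally show ?thesis .
  next
    case False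
    have K: "?K > 0" by simp
    have "v powr a \<le> ?K powr a + ?K powr (a - 1) * v" if "0 \<le> v" for v
    proof -
      have "(v / ?K) powr a \<le> 1 + v / ?K"
      proof (cases "v / ?K \<le> 1")
        case True
        then have "(v / ?K) powr a \<le> 1" using a that by (intro powr_le1) auto
        also have "\<dots> \<le> 1 + v / ?K" using that by simp
        finally show ?thesis .
      next
        case Fa: False
        then have "(v / ?K) powr a \<le> (v / ?K) powr 1" using False by (intro powr_mono) auto
        then show ?thesis using that by simp
      qed
      then have "?K powr a * (v / ?K) powr a \<le> ?K powr a * (1 + v / ?K)"
        by (intro mult_left_mono) auto
      moreover have "?K powr a * (v / ?K) powr a = v powr a"
        using that by (simp add: powr_divide)
      ultimately show ?thesis by (simp add: powr_diff algebra_simps)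
    qed
    then have *: "ennreal (v powr a * ?e w) \<le> ennreal (?K powr a) * ennreal (?e w)
        + ennreal (?K powr (a - 1)) * ennreal (v powr 1 * ?e w)" if "0 \<le> v" for v w
      using mult_right_mono[of "v powr a" "?K powr a + ?K powr (a - 1) * v" "?e w"] that
      by (simp add: ennreal_mult[symmetric] ennreal_plus[symmetric] algebra_simps ennreal_leI del: ennreal_plus)
    have "?L \<le> nth_ladder_sum ?A (Suc j) (\<lambda>v w. ennreal (?K powr a) * ennreal (?e w)
        + ennreal (?K powr (a - 1)) * ennreal (v powr 1 * ?e w))"
      by (rule epoch_sum_mono) (use * in auto)
    also have "\<dots> = ennreal (?K powr a) * nth_ladder_sum ?A (Suc j) (\<lambda>v w. ennreal (?e w))
        + ennreal (?K powr (a - 1)) * nth_ladder_sum ?A (Suc j) (\<lambda>v w. ennreal (v powr 1 * ?e w))"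
      by (rule epoch_sum_lin) measurable
    also have "\<dots> \<le> ennreal (?K powr a) * ?p ^ j
        + ennreal (?K powr (a - 1)) * (ennreal ?K * ?p ^ j * ?M)"
    proof (intro add_mono mult_left_mono)
      have "nth_ladder_sum ?A (Suc j) (\<lambda>v w. ennreal (?e w)) \<le> ?q ^ Suc j" by (rule nth_ladder_sum_exp_le) simp
      also have "\<dots> \<le> ?p ^ Suc j" by (intro power_mono qp) simp
      also have "\<dots> \<le> 1 * ?p ^ j" unfolding power_Suc by (intro mult_right_mono p1) auto
      finally show "nth_ladder_sum ?A (Suc j) (\<lambda>v w. ennreal (?e w)) \<le> ?p ^ j" by simp
      have "nth_ladder_sum ?A (Suc j) (\<lambda>v w. ennreal (v powr 1 * ?e w))
        \<le> ennreal (real (Suc j) * real (Suc j) powr max (1 - 1) 0) * ?q ^ (Suc j - 1)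
          * entry_sum ?A (\<lambda>v w. ennreal (v powr 1 * ?e w))"
        by (rule nth_ladder_sum_powr_exp_le) auto
      also have "\<dots> \<le> ennreal ?K * ?p ^ j * ?M"
      proof (intro mult_mono)
        show "?q ^ (Suc j - 1) \<le> ?p ^ j" using qp by (simp add: power_mono)
        show "entry_sum ?A (\<lambda>v w. ennreal (v powr 1 * ?e w)) \<le> ?M"
          using EFle[of 1] False by (simp add: max_def)
      qed (auto simp: add.commute)
      finally show "nth_ladder_sum ?A (Suc j) (\<lambda>v w. ennreal (v powr 1 * ?e w)) \<le> ennreal ?K * ?p ^ j * ?M" .
    qed auto
    also have "ennreal (?K powr (a - 1)) * (ennreal ?K * ?p ^ j * ?M)
        = (ennreal (?K powr (a - 1)) * ennreal ?K) * (?p ^ j * ?M)" by (simp add: mult_ac)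
    also have "ennreal (?K powr (a - 1)) * ennreal ?K = ennreal (?K powr a)"
      using K by (subst ennreal_mult[symmetric]) (auto simp: powr_diff)
    finally show ?thesis by (simp add: distrib_left mult_ac)
  qed
qed

lemma ladder_sum_powr_le:
  assumes a: "0 < a" and M: "entry_sum {0<..} (\<lambda>v w. ennreal (v powr max 1 a)) < \<infinity>"
  obtains C where "C \<ge> 0"
    "\<And>y. 0 \<le> y \<Longrightarrow> ladder_sum (\<lambda>v w. if w \<le> y then ennreal (v powr a) else 0)
        \<le> ennreal (C * J y powr (1 + a))"
proof -
  let ?A = "{0<..} :: real set"
  obtain C0 :: real where C0: "C0 > 0" "\<And>r. 0 \<le> r \<Longrightarrow> r < 1 \<Longrightarrow>
       (\<Sum>k. ennreal ((real k + 1) powr a) * ennreal r ^ k) \<le> ennreal (C0 / (1 - r) powr (1 + a))"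
    using suminf_powr_geometric_le[of a] a by auto
  define M' where "M' = enn2real (1 + entry_sum ?A (\<lambda>v w. ennreal (v powr max 1 a)))"
  have M': "1 + entry_sum ?A (\<lambda>v w. ennreal (v powr max 1 a)) = ennreal M'" "M' \<ge> 0"
    using M by (auto simp: M'_def ennreal_enn2real_if)
  define C where "C = exp 1 * M' * C0 * 2 powr (1 + a)"
  have "ladder_sum (\<lambda>v w. if w \<le> y then ennreal (v powr a) else 0) \<le> ennreal (C * J y powr (1 + a))"
    if "0 \<le> y" for y
  proof (cases "y = 0")
    case True
    then show ?thesis using ladder_sum_at_0[of "\<lambda>v. ennreal (v powr a)"] by simp
  next
    case False
    then have y: "0 < y" using that by simp
    let ?r = "1 - 1 / (2 * J y)"
    let ?f = "\<lambda>v w. ennreal (v powr a * exp (- (1 / y * w)))"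
    have J: "1 \<le> J y" using J_ge_1 y by simp
    then have r: "0 \<le> ?r" "?r < 1" by (auto simp: field_simps)
    have "ladder_sum (\<lambda>v w. if w \<le> y then ennreal (v powr a) else 0)
       \<le> (\<Sum>k. nth_ladder_sum ?A k (\<lambda>v w. if w \<le> y then ennreal (v powr a) else 0))"
      by (rule ladder_sum_le) measurable
    also have "\<dots> \<le> (\<Sum>k. nth_ladder_sum ?A k (\<lambda>v w. ennreal (exp 1) * ?f v w))"
    proof (intro suminf_le epoch_sum_mono)
      fix v w :: real
      have "v powr a * 1 \<le> v powr a * (exp 1 * exp (- (1 / y * w)))" if "w \<le> y"
        using y that by (intro mult_left_mono) (auto simp: exp_add[symmetric] field_simps)
      then show "(if w \<le> y then ennreal (v powr a) else 0) \<le> ennreal (exp 1) * ?f v w"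
        by (auto simp: ennreal_mult[symmetric] mult_ac intro!: ennreal_leI)
    qed auto
    also have "\<dots> = (\<Sum>k. ennreal (exp 1) * nth_ladder_sum ?A k ?f)"
      by (intro suminf_cong epoch_sum_cmult) measurable
    also have "\<dots> = ennreal (exp 1) * (\<Sum>k. nth_ladder_sum ?A k ?f)"
      by (rule ennreal_suminf_cmult)
    also have "(\<Sum>k. nth_ladder_sum ?A k ?f) = (\<Sum>k. nth_ladder_sum ?A (Suc k) ?f)"
      using suminf_offset[OF summableI, of "\<lambda>k. nth_ladder_sum ?A k ?f" 1] a by (simp add: nth_ladder_sum_0)
    also have "ennreal (exp 1) * (\<Sum>k. nth_ladder_sum ?A (Suc k) ?f)
        \<le> ennreal (exp 1) * (\<Sum>k. ennreal ((real k + 1) powr a) * ennreal ?r ^ k * ennreal M')"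
      using nth_ladder_sum_up_powr_le[OF a y] unfolding M'(1) by (intro mult_left_mono suminf_le) auto
    also have "\<dots> = ennreal (exp 1) * ((\<Sum>k. ennreal ((real k + 1) powr a) * ennreal ?r ^ k) * ennreal M')"
      by simp
    also have "\<dots> \<le> ennreal (exp 1) * (ennreal (C0 / (1 - ?r) powr (1 + a)) * ennreal M')"
      by (intro mult_left_mono mult_right_mono C0 r) auto
    also have "\<dots> = ennreal (C * J y powr (1 + a))"
    proof -
      have "C0 / (1 - ?r) powr (1 + a) = C0 * (2 * J y) powr (1 + a)"
        using J by (simp add: powr_divide)
      also have "\<dots> = C0 * 2 powr (1 + a) * J y powr (1 + a)" using J by (simp add: powr_mult)
      finally show ?thesis
        using C0 M' by (simp add: ennreal_mult[symmetric] C_def mult_ac)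
    qed
    finally show ?thesis .
  qed
  moreover have "C \<ge> 0" using C0 M' by (simp add: C_def)
  ultimately show ?thesis using that by blast
qed

end

section \<open>The walk before its first ascent, seen through descending ladder epochs\<close>

context iid_walk
begin

lemma nn_integral_stay_mult:
  assumes f: "f \<in> borel_measurable borel" and g [measurable]: "g \<in> borel_measurable Q"
    and A [measurable]: "A \<in> sets borel"
  shows "(\<integral>\<^sup>+ c. (if stay A n c then f (V n c) * g (c n) else 0) \<partial>R)
       = (\<integral>\<^sup>+ c. (if stay A n c then f (V n c) else 0) \<partial>R) * (\<integral>\<^sup>+ e. g e \<partial>Q :: ennreal)"
proof -
  have [measurable]: "(\<lambda>c. f (V n c)) \<in> borel_measurable R"
    by (rule measurable_compose[OF measurable_V f])
  define F where "F c c' = (if stay A n c then f (V n c) else 0) * g (c' 0)" for c c' :: "nat \<Rightarrow> 'e"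
  have "(\<integral>\<^sup>+ c. (if stay A n c then f (V n c) * g (c n) else 0) \<partial>R) = (\<integral>\<^sup>+ c. F c (shift n c) \<partial>R)"
    by (intro nn_integral_cong) (simp add: F_def)
  also have "\<dots> = (\<integral>\<^sup>+ c. \<integral>\<^sup>+ c'. F c c' \<partial>R \<partial>R)"
  proof (rule nn_integral_split)
    show "(\<lambda>(c, c'). F c c') \<in> borel_measurable (R \<Otimes>\<^sub>M R)" unfolding F_def by measurable
    fix c d c' :: "nat \<Rightarrow> 'e" assume "\<And>k. k < n \<Longrightarrow> c k = d k"
    then show "F c c' = F d c'" using V_cong[of n c d] stay_cong[of n c d A] by (simp add: F_def)
  qed
  also have "\<dots> = (\<integral>\<^sup>+ c. (if stay A n c then f (V n c) else 0) * (\<integral>\<^sup>+ e. g e \<partial>Q) \<partial>R)"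
    unfolding F_def by (intro nn_integral_cong) (simp add: nn_integral_cmult nn_integral_component)
  also have "\<dots> = (\<integral>\<^sup>+ c. (if stay A n c then f (V n c) else 0) \<partial>R) * (\<integral>\<^sup>+ e. g e \<partial>Q)"
    by (rule nn_integral_multc) measurable
  finally show ?thesis .
qed

text \<open>Until the first ascent the walk stays in \<open>{..0}\<close>. Replacing the sum up to
  that random time by a sum over all times with \<open>stay\<close> makes each summand a function of
  the past and the next step only.\<close>

lemma entry_sum_up_le_stay_sum:
  assumes f: "borel2 f"
    and H [measurable]: "\<And>n. H n \<in> borel_measurable R"
    and le: "\<And>n c. f (V n c) (W n c) \<le> (\<Sum>k<n. H k c)"
  shows "entry_sum {0<..} f \<le> (\<Sum>n. \<integral>\<^sup>+ c. (if stay {..0} n c then H n c else 0) \<partial>R)"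
proof -
  have "entry_sum {0<..} f \<le> (\<integral>\<^sup>+ c. (\<Sum>n. if stay {..0} n c then H n c else 0) \<partial>R)"
  proof (rule entry_sum_le_nn_integral[OF f])
    fix n c assume e: "entry {0<..} n c"
    have "f (V n c) (W n c) \<le> (\<Sum>k<n. H k c)" by (rule le)
    also have "\<dots> = (\<Sum>k<n. if stay {..0} k c then H k c else 0)"
    proof (intro sum.cong refl)
      fix k assume "k \<in> {..<n}"
      with e have "stay {..0} k c" by (fastforce simp: entry_def stay_def)
      then show "H k c = (if stay {..0} k c then H k c else 0)" by simp
    qed
    also have "\<dots> \<le> (\<Sum>k. if stay {..0} k c then H k c else 0)"
      by (intro sum_le_suminf summableI) auto
    finally show "f (V n c) (W n c) \<le> (\<Sum>k. if stay {..0} k c then H k c else 0)" .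
  qed simp
  also have "\<dots> = (\<Sum>n. \<integral>\<^sup>+ c. (if stay {..0} n c then H n c else 0) \<partial>R)"
    by (rule nn_integral_suminf) measurable
  finally show ?thesis .
qed

text \<open>As a sum of tail probabilities, this is the expected first ascending ladder
  epoch.\<close>

lemma stay_down_count_finite:
  assumes q: "entry_sum {..0} (\<lambda>v w. 1) < 1"
  shows "epoch_sum (stay {..0}) (\<lambda>v w. 1) < \<infinity>"
proof -
  obtain C where C: "C > 0" "\<And>r. 0 \<le> r \<Longrightarrow> r < 1 \<Longrightarrow>
       (\<Sum>k. ennreal ((real k + 1) powr 0) * ennreal r ^ k) \<le> ennreal (C / (1 - r) powr (1 + 0))"
    using suminf_powr_geometric_le[of 0] by auto
  obtain r where r: "entry_sum {..0} (\<lambda>v w. 1) = ennreal r" "0 \<le> r" "r < 1"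
    using q by (cases "entry_sum {..0} (\<lambda>v w. 1)") (auto simp: ennreal_less_one_iff top_unique)
  have "epoch_sum (stay {..0}) (\<lambda>v w. 1) \<le> (\<Sum>k. nth_ladder_sum {..0} k (\<lambda>v w. 1))"
    by (rule stay_sum_le) auto
  also have "\<dots> \<le> (\<Sum>k. ennreal ((real k + 1) powr 0) * ennreal r ^ k)"
    using nth_ladder_sum_exp_le[of "{..0}" _ 0] r(1) by (intro suminf_le) auto
  also have "\<dots> \<le> ennreal (C / (1 - r) powr (1 + 0))" by (rule C(2)[OF r(2,3)])
  also have "\<dots> < \<infinity>" by simp
  finally show ?thesis .
qed

lemma stay_down_powr_finite:
  assumes q: "entry_sum {..0} (\<lambda>v w. 1) < 1" and a: "0 < a"
    and m: "entry_sum {..0} (\<lambda>v w. ennreal (v powr a)) < \<infinity>"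
  shows "epoch_sum (stay {..0}) (\<lambda>v w. ennreal (v powr a)) < \<infinity>"
proof -
  \<comment> \<open>One power of \<open>k\<close> for the choice of the block that carries the
    moment, and \<open>max (a - 1) 0\<close> for the power of a sum of \<open>k\<close>
    terms.\<close>
  let ?b = "1 + max (a - 1) 0" and ?f = "\<lambda>v w :: real. ennreal (v powr a)"
  obtain C where C: "C > 0" "\<And>r. 0 \<le> r \<Longrightarrow> r < 1 \<Longrightarrow>
       (\<Sum>k. ennreal ((real k + 1) powr ?b) * ennreal r ^ k) \<le> ennreal (C / (1 - r) powr (1 + ?b))"
    using suminf_powr_geometric_le[of ?b] by auto
  obtain r where r: "entry_sum {..0} (\<lambda>v w. 1) = ennreal r" "0 \<le> r" "r < 1"
    using q by (cases "entry_sum {..0} (\<lambda>v w. 1)") (auto simp: ennreal_less_one_iff top_unique)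
  have "epoch_sum (stay {..0}) ?f \<le> (\<Sum>k. nth_ladder_sum {..0} k ?f)"
    by (rule stay_sum_le) measurable
  also have "\<dots> = (\<Sum>k. nth_ladder_sum {..0} (Suc k) ?f)"
    using suminf_offset[OF summableI, of "\<lambda>k. nth_ladder_sum {..0} k ?f" 1] a by (simp add: nth_ladder_sum_0)
  also have "\<dots> \<le> (\<Sum>k. ennreal ((real k + 1) powr ?b) * ennreal r ^ k * entry_sum {..0} ?f)"
  proof (intro suminf_le)
    fix k
    have "(real k + 1) powr ?b = real (Suc k) * real (Suc k) powr max (a - 1) 0"
      by (simp add: powr_add add.commute)
    then show "nth_ladder_sum {..0} (Suc k) ?f \<le> ennreal ((real k + 1) powr ?b) * ennreal r ^ k * entry_sum {..0} ?f"
      using nth_ladder_sum_powr_exp_le[of "{..0}" a "Suc k" 0] a r(1) by simp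
  qed auto
  also have "\<dots> = (\<Sum>k. ennreal ((real k + 1) powr ?b) * ennreal r ^ k) * entry_sum {..0} ?f"
    by simp
  also have "\<dots> \<le> ennreal (C / (1 - r) powr (1 + ?b)) * entry_sum {..0} ?f"
    by (intro mult_right_mono C r) auto
  also have "\<dots> < \<infinity>" using m by (simp add: ennreal_mult_less_top)
  finally show ?thesis .
qed

end

section \<open>Bootstrapping the moments of the first ladder epochs\<close>

context iid_walk_up
begin

text \<open>The condition \<open>J y \<le> B * g\<close> makes both contributions,
  \<open>J y powr (1 + a)\<close> and \<open>g powr a * J y\<close>, of the order
  \<open>g powr (1 + a)\<close>.\<close>

lemma ladder_sum_add_powr_le:
  assumes a: "0 < a" and M: "entry_sum {0<..} (\<lambda>v w. ennreal (v powr max 1 a)) < \<infinity>" and B: "0 \<le> B"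
  obtains C where "C \<ge> 0"
    "\<And>y g. 0 \<le> y \<Longrightarrow> 1 \<le> g \<Longrightarrow> J y \<le> B * g \<Longrightarrow>
        ladder_sum (\<lambda>v w. if w \<le> y then ennreal ((v + g) powr a) else 0) \<le> ennreal (C * g powr (1 + a))"
proof -
  obtain C1 where C1: "C1 \<ge> 0" "\<And>y. 0 \<le> y \<Longrightarrow>
      ladder_sum (\<lambda>v w. if w \<le> y then ennreal (v powr a) else 0) \<le> ennreal (C1 * J y powr (1 + a))"
    using ladder_sum_powr_le[OF a M] by blast
  obtain C2 where C2: "C2 \<ge> 1" "\<And>y. 0 \<le> y \<Longrightarrow>
      ladder_sum (\<lambda>v w. if w \<le> y then 1 else 0) \<le> ennreal (C2 * J y)"
    using ladder_sum_count_le by blast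
  define C where "C = 2 powr a * C1 * B powr (1 + a) + 2 powr a * C2 * B"
  have "ladder_sum (\<lambda>v w. if w \<le> y then ennreal ((v + g) powr a) else 0) \<le> ennreal (C * g powr (1 + a))"
    if y: "0 \<le> y" and g: "1 \<le> g" and Jg: "J y \<le> B * g" for y g
  proof -
    have J: "1 \<le> J y" by (rule J_ge_1[OF y])
    have "ladder_sum (\<lambda>v w. if w \<le> y then ennreal ((v + g) powr a) else 0)
      \<le> ladder_sum (\<lambda>v w. ennreal (2 powr a) * (if w \<le> y then ennreal (v powr a) else 0)
           + ennreal (2 powr a * g powr a) * (if w \<le> y then 1 else 0))"
    proof (rule epoch_sum_mono)
      fix v w :: real assume "0 \<le> v"
      then have "(v + g) powr a \<le> 2 powr a * v powr a + 2 powr a * g powr a"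
        using powr_add_le_two_powr[of v g a] g a by (simp add: algebra_simps)
      then show "(if w \<le> y then ennreal ((v + g) powr a) else 0)
        \<le> ennreal (2 powr a) * (if w \<le> y then ennreal (v powr a) else 0)
           + ennreal (2 powr a * g powr a) * (if w \<le> y then 1 else 0)"
        by (auto simp: ennreal_mult[symmetric] ennreal_plus[symmetric] simp del: ennreal_plus intro!: ennreal_leI)
    qed
    also have "\<dots> = ennreal (2 powr a) * ladder_sum (\<lambda>v w. if w \<le> y then ennreal (v powr a) else 0)
        + ennreal (2 powr a * g powr a) * ladder_sum (\<lambda>v w. if w \<le> y then 1 else 0)"
      by (rule epoch_sum_lin) measurable
    also have "\<dots> \<le> ennreal (2 powr a) * ennreal (C1 * J y powr (1 + a))
        + ennreal (2 powr a * g powr a) * ennreal (C2 * J y)"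
      by (intro add_mono mult_left_mono C1 C2 y) auto
    also have "\<dots> = ennreal (2 powr a * (C1 * J y powr (1 + a)) + 2 powr a * g powr a * (C2 * J y))"
      using C1 C2 J by (simp add: ennreal_mult ennreal_plus)
    also have "\<dots> \<le> ennreal (C * g powr (1 + a))"
    proof (rule ennreal_leI)
      have "J y powr (1 + a) \<le> (B * g) powr (1 + a)" using J Jg a by (intro powr_mono2) auto
      also have "\<dots> = B powr (1 + a) * g powr (1 + a)" using B g by (simp add: powr_mult)
      finally have "2 powr a * (C1 * J y powr (1 + a)) \<le> 2 powr a * (C1 * (B powr (1 + a) * g powr (1 + a)))"
        using C1 by (intro mult_left_mono) auto
      also have "\<dots> = 2 powr a * C1 * B powr (1 + a) * g powr (1 + a)" by simp
      finally have 1: "2 powr a * (C1 * J y powr (1 + a)) \<le> 2 powr a * C1 * B powr (1 + a) * g powr (1 + a)" .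
      have "2 powr a * g powr a * (C2 * J y) \<le> 2 powr a * g powr a * (C2 * (B * g))"
        using C2 Jg by (intro mult_left_mono) auto
      also have "\<dots> = 2 powr a * C2 * B * (g * g powr a)" by simp
      also have "g * g powr a = g powr (1 + a)" using g by (simp add: powr_add)
      finally show "2 powr a * (C1 * J y powr (1 + a)) + 2 powr a * g powr a * (C2 * J y) \<le> C * g powr (1 + a)"
        using 1 by (simp only: C_def distrib_right)
    qed
    finally show ?thesis .
  qed
  moreover have "C \<ge> 0" using C1 C2 B by (simp add: C_def)
  ultimately show ?thesis using that by blast
qed

text \<open>With the tail frozen, the sum over the past is a ladder sum at level \<open>y\<close>:
  directly for \<open>ladder\<close>, by duality for \<open>stay\<close>. The first case serves the
  last exit, the second the first descent.\<close>

lemma renewal_sum_le: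
  assumes a: "0 < a" and M: "entry_sum {0<..} (\<lambda>v w. ennreal (v powr max 1 a)) < \<infinity>" and B: "0 \<le> B"
    and P: "P = ladder {0<..} \<or> P = stay {0<..}"
    and y [measurable]: "y \<in> borel_measurable R" and g [measurable]: "g \<in> borel_measurable R"
    and y0: "\<And>c. 0 \<le> y c" and g1: "\<And>c. 1 \<le> g c" and Jy: "\<And>c. J (y c) \<le> B * g c"
    and fin: "(\<integral>\<^sup>+ c. ennreal (g c powr (1 + a)) \<partial>R) < \<infinity>"
  shows "(\<Sum>n. \<integral>\<^sup>+ c. (if P n c \<and> W n c \<le> y (shift n c)
             then ennreal ((V n c + g (shift n c)) powr a) else 0) \<partial>R) < \<infinity>"
proof -
  obtain C where C: "C \<ge> 0" "\<And>y g. 0 \<le> y \<Longrightarrow> 1 \<le> g \<Longrightarrow> J y \<le> B * g \<Longrightarrow>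
        ladder_sum (\<lambda>v w. if w \<le> y then ennreal ((v + g) powr a) else 0) \<le> ennreal (C * g powr (1 + a))"
    using ladder_sum_add_powr_le[OF a M B] by blast
  define F where "F n c c' = (if P n c then if W n c \<le> y c' then ennreal ((V n c + g c') powr a) else 0 else 0)"
    for n and c c' :: "nat \<Rightarrow> 'e"
  have [measurable]: "Measurable.pred R (P n)" for n using P by auto
  have Fm [measurable]: "(\<lambda>(c, c'). F n c c') \<in> borel_measurable (R \<Otimes>\<^sub>M R)" for n
    unfolding F_def by measurable
  have "(\<Sum>n. \<integral>\<^sup>+ c. (if P n c \<and> W n c \<le> y (shift n c)
             then ennreal ((V n c + g (shift n c)) powr a) else 0) \<partial>R)
      = (\<Sum>n. \<integral>\<^sup>+ c. F n c (shift n c) \<partial>R)"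
    by (intro suminf_cong nn_integral_cong) (simp add: F_def)
  also have "\<dots> = (\<Sum>n. \<integral>\<^sup>+ c'. \<integral>\<^sup>+ c. F n c c' \<partial>R \<partial>R)"
  proof (intro suminf_cong nn_integral_split_swap Fm)
    fix n and c d c' :: "nat \<Rightarrow> 'e" assume *: "\<And>k. k < n \<Longrightarrow> c k = d k"
    then have "P n c = P n d" using P ladder_cong[of n c d] stay_cong[of n c d] by auto
    then show "F n c c' = F n d c'" using V_cong[of n c d] W_cong[of n c d] * by (simp add: F_def)
  qed
  also have "\<dots> = (\<integral>\<^sup>+ c'. (\<Sum>n. \<integral>\<^sup>+ c. F n c c' \<partial>R) \<partial>R)"
  proof (rule nn_integral_suminf[symmetric])
    fix n
    have "(\<lambda>(c', c). F n c c') \<in> borel_measurable (R \<Otimes>\<^sub>M R)" unfolding F_def by measurable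
    then show "(\<lambda>c'. \<integral>\<^sup>+ c. F n c c' \<partial>R) \<in> borel_measurable R"
      by (rule P.borel_measurable_nn_integral)
  qed
  also have "\<dots> = (\<integral>\<^sup>+ c'. ladder_sum (\<lambda>v w. if w \<le> y c' then ennreal ((v + g c') powr a) else 0) \<partial>R)"
  proof (intro nn_integral_cong)
    fix c'
    have "(\<integral>\<^sup>+ c. F n c c' \<partial>R) = (\<integral>\<^sup>+ c. (if ladder {0<..} n c
        then if W n c \<le> y c' then ennreal ((V n c + g c') powr a) else 0 else 0) \<partial>R)" for n
    proof -
      have "(\<lambda>(v, w). if w \<le> y c' then ennreal ((v + g c') powr a) else 0) \<in> borel_measurable (borel \<Otimes>\<^sub>M borel)"
        by measurable
      from nn_integral_stay_eq_ladder[OF this, of "{0<..}" n] show ?thesis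
        using P by (auto simp: F_def)
    qed
    then show "(\<Sum>n. \<integral>\<^sup>+ c. F n c c' \<partial>R)
        = ladder_sum (\<lambda>v w. if w \<le> y c' then ennreal ((v + g c') powr a) else 0)"
      by (simp add: epoch_sum_def)
  qed
  also have "\<dots> \<le> (\<integral>\<^sup>+ c'. ennreal C * ennreal (g c' powr (1 + a)) \<partial>R)"
    using C y0 g1 Jy by (intro nn_integral_mono) (simp add: ennreal_mult[symmetric])
  also have "\<dots> = ennreal C * (\<integral>\<^sup>+ c'. ennreal (g c' powr (1 + a)) \<partial>R)"
    by (rule nn_integral_cmult) measurable
  also have "\<dots> < \<infinity>" using fin by (simp add: ennreal_mult_less_top)
  finally show ?thesis .
qed

text \<open>A first descent at time \<open>n + 1\<close> means that the walk stayed positive up to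
  \<open>n\<close> and that \<open>W n\<close> is at most the negative part of the next step, whose
  \<open>J\<close> is dominated by \<open>G\<close>.\<close>

lemma entry_sum_down_powr_finite:
  assumes a: "0 < a" and M: "entry_sum {0<..} (\<lambda>v w. ennreal (v powr max 1 a)) < \<infinity>"
    and JG: "\<And>e. J (max (- Y e) 0) \<le> G e"
    and G: "(\<integral>\<^sup>+ e. ennreal (G e powr (1 + a)) \<partial>Q) < \<infinity>"
  shows "entry_sum {..0} (\<lambda>v w. ennreal (v powr a)) < \<infinity>"
proof -
  have fin: "(\<Sum>n. \<integral>\<^sup>+ c. (if stay {0<..} n c \<and> W n c \<le> max (- Y (shift n c 0)) 0
             then ennreal ((V n c + G (shift n c 0)) powr a) else 0) \<partial>R) < \<infinity>"
  proof (rule renewal_sum_le[OF a M, of 1])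
    show "(\<integral>\<^sup>+ c. ennreal (G (c 0) powr (1 + a)) \<partial>R) < \<infinity>"
      using G by (subst nn_integral_component) auto
  qed (use JG G_ge_1 in auto)
  have "entry_sum {..0} (\<lambda>v w. ennreal (v powr a))
      = (\<Sum>n. \<integral>\<^sup>+ c. (if entry {..0} (Suc n) c then ennreal (V (Suc n) c powr a) else 0) \<partial>R)"
    using suminf_offset[OF summableI, of "\<lambda>n. \<integral>\<^sup>+ c. (if entry {..0} n c then ennreal (V n c powr a) else 0) \<partial>R" 1]
    by (simp add: epoch_sum_def entry_def cong: if_cong)
  also have "\<dots> \<le> (\<Sum>n. \<integral>\<^sup>+ c. (if stay {0<..} n c \<and> W n c \<le> max (- Y (shift n c 0)) 0
             then ennreal ((V n c + G (shift n c 0)) powr a) else 0) \<partial>R)"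
  proof (intro suminf_le nn_integral_mono)
    fix n c
    show "(if entry {..0} (Suc n) c then ennreal (V (Suc n) c powr a) else 0)
      \<le> (if stay {0<..} n c \<and> W n c \<le> max (- Y (shift n c 0)) 0
             then ennreal ((V n c + G (shift n c 0)) powr a) else 0)"
    proof (cases "entry {..0} (Suc n) c")
      case True
      then have "stay {0<..} n c" by (fastforce simp: entry_def stay_def)
      moreover have "W n c \<le> max (- Y (c n)) 0" using True by (auto simp: entry_def W_Suc)
      ultimately show ?thesis by (simp add: V_Suc)
    qed simp
  qed auto
  finally show ?thesis using fin by (rule le_less_trans)
qed

text \<open>Before the first ascent \<open>V powr (1 + a)\<close> telescopes into terms
  \<open>V k powr a * G\<close> and \<open>G powr (1 + a)\<close>. The new step splits off by
  independence, and the remaining sums over times with \<open>stay {..0}\<close> are finite by the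
  bounds for the descending epochs.\<close>

lemma entry_sum_up_powr_finite_step:
  assumes a: "0 < a" and M: "entry_sum {0<..} (\<lambda>v w. ennreal (v powr max 1 a)) < \<infinity>"
    and JG: "\<And>e. J (max (- Y e) 0) \<le> G e"
    and q: "entry_sum {..0} (\<lambda>v w. 1) < 1"
    and G: "(\<integral>\<^sup>+ e. ennreal (G e powr (1 + a)) \<partial>Q) < \<infinity>"
  shows "entry_sum {0<..} (\<lambda>v w. ennreal (v powr (1 + a))) < \<infinity>"
proof -
  define K where "K = (1 + a) * 2 powr a"
  have K: "K \<ge> 0" using a by (simp add: K_def)
  let ?G1 = "\<integral>\<^sup>+ e. ennreal (G e) \<partial>Q" and ?Ga = "\<integral>\<^sup>+ e. ennreal (G e powr (1 + a)) \<partial>Q"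
  let ?S = "epoch_sum (stay {..0}) (\<lambda>v w. ennreal (v powr a))"
  let ?N = "epoch_sum (stay {..0}) (\<lambda>v w. 1)"
  have "?G1 \<le> ?Ga"
  proof (intro nn_integral_mono ennreal_leI)
    fix e show "G e \<le> G e powr (1 + a)"
      using powr_mono[of 1 "1 + a" "G e"] G_ge_1[of e] a by simp
  qed
  then have G1: "?G1 < \<infinity>" using G by (rule le_less_trans)
  have S: "?S < \<infinity>" by (intro stay_down_powr_finite q a entry_sum_down_powr_finite[OF a M JG G])
  have N: "?N < \<infinity>" by (rule stay_down_count_finite[OF q])
  let ?H = "\<lambda>n c. ennreal K * (ennreal (V n c powr a) * ennreal (G (c n))) + ennreal K * (1 * ennreal (G (c n) powr (1 + a)))"
  have "entry_sum {0<..} (\<lambda>v w. ennreal (v powr (1 + a)))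
     \<le> (\<Sum>n. \<integral>\<^sup>+ c. (if stay {..0} n c then ?H n c else 0) \<partial>R)"
  proof (rule entry_sum_up_le_stay_sum)
    fix n c
    have "V n c powr (1 + a) \<le> (\<Sum>k<n. K * (V k c powr a * G (c k)) + K * (1 * G (c k) powr (1 + a)))"
    proof (induction n)
      case (Suc n)
      have "0 \<le> G (c n)" using G_ge_1[of "c n"] by simp
      then have "V (Suc n) c powr (1 + a) \<le> V n c powr (1 + a) + K * (V n c powr a * G (c n) + G (c n) powr (1 + a))"
        using powr_Suc_add_le[of "V n c" "G (c n)" a] a by (simp add: V_Suc K_def)
      with Suc show ?case by (simp add: algebra_simps)
    qed (use a in simp)
    then have "ennreal (V n c powr (1 + a)) \<le> ennreal (\<Sum>k<n. K * (V k c powr a * G (c k)) + K * (1 * G (c k) powr (1 + a)))"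
      by (rule ennreal_leI)
    also have "\<dots> = (\<Sum>k<n. ?H k c)"
    proof -
      have "0 \<le> G e" for e using G_ge_1[of e] by simp
      then show ?thesis
        using K by (subst sum_ennreal[symmetric]) (auto simp: ennreal_mult ennreal_plus intro!: sum.cong add_nonneg_nonneg mult_nonneg_nonneg)
    qed
    finally show "ennreal (V n c powr (1 + a)) \<le> (\<Sum>k<n. ?H k c)" .
  qed measurable
  also have "\<dots> = (\<Sum>n. ennreal K * (\<integral>\<^sup>+ c. (if stay {..0} n c then ennreal (V n c powr a) * ennreal (G (c n)) else 0) \<partial>R)
       + ennreal K * (\<integral>\<^sup>+ c. (if stay {..0} n c then 1 * ennreal (G (c n) powr (1 + a)) else 0) \<partial>R))"
  proof (intro suminf_cong)
    fix n
    have "(\<integral>\<^sup>+ c. (if stay {..0} n c then ?H n c else 0) \<partial>R)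
        = (\<integral>\<^sup>+ c. ennreal K * (if stay {..0} n c then ennreal (V n c powr a) * ennreal (G (c n)) else 0)
           + ennreal K * (if stay {..0} n c then 1 * ennreal (G (c n) powr (1 + a)) else 0) \<partial>R)"
      by (intro nn_integral_cong) auto
    then show "(\<integral>\<^sup>+ c. (if stay {..0} n c then ?H n c else 0) \<partial>R)
      = ennreal K * (\<integral>\<^sup>+ c. (if stay {..0} n c then ennreal (V n c powr a) * ennreal (G (c n)) else 0) \<partial>R)
       + ennreal K * (\<integral>\<^sup>+ c. (if stay {..0} n c then 1 * ennreal (G (c n) powr (1 + a)) else 0) \<partial>R)"
      by (simp add: nn_integral_add nn_integral_cmult)
  qed
  also have "\<dots> = (\<Sum>n. ennreal K * ((\<integral>\<^sup>+ c. (if stay {..0} n c then ennreal (V n c powr a) else 0) \<partial>R) * ?G1)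
       + ennreal K * ((\<integral>\<^sup>+ c. (if stay {..0} n c then 1 else 0) \<partial>R) * ?Ga))"
    using nn_integral_stay_mult[of "\<lambda>v. ennreal (v powr a)" "\<lambda>e. ennreal (G e)" "{..0}"]
      nn_integral_stay_mult[of "\<lambda>v. 1" "\<lambda>e. ennreal (G e powr (1 + a))" "{..0}"]
    by (intro suminf_cong) simp
  also have "\<dots> = ennreal K * (?S * ?G1) + ennreal K * (?N * ?Ga)"
    by (simp add: epoch_sum_def suminf_add[OF summableI summableI, symmetric])
  also have "\<dots> < \<infinity>" using S N G1 G by (simp add: ennreal_mult_less_top)
  finally show ?thesis .
qed

text \<open>Wald's identity, as an upper bound; it starts the bootstrap.\<close>

lemma entry_sum_up_mean_finite:
  assumes q: "entry_sum {..0} (\<lambda>v w. 1) < 1"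
    and G: "(\<integral>\<^sup>+ e. ennreal (G e) \<partial>Q) < \<infinity>"
  shows "entry_sum {0<..} (\<lambda>v w. ennreal (v powr 1)) < \<infinity>"
proof -
  have G0: "0 \<le> G e" for e using G_ge_1[of e] by simp
  have "entry_sum {0<..} (\<lambda>v w. ennreal (v powr 1)) \<le> (\<Sum>n. \<integral>\<^sup>+ c. (if stay {..0} n c then 1 * ennreal (G (c n)) else 0) \<partial>R)"
    by (rule entry_sum_up_le_stay_sum) (auto simp: V_def G0 sum_nonneg)
  also have "\<dots> = epoch_sum (stay {..0}) (\<lambda>v w. 1) * (\<integral>\<^sup>+ e. ennreal (G e) \<partial>Q)"
    using nn_integral_stay_mult[of "\<lambda>v. 1" "\<lambda>e. ennreal (G e)" "{..0}"] by (simp add: epoch_sum_def)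
  also have "\<dots> < \<infinity>" using stay_down_count_finite[OF q] G by (simp add: ennreal_mult_less_top)
  finally show ?thesis .
qed

text \<open>Moments of order \<open>1 + a\<close> of the first ladder epoch are bootstrapped from those of order
  \<open>a\<close>: by duality the ascending and the descending ladder structures control each other.\<close>

lemma entry_sum_up_powr_finite:
  assumes a: "0 < a"
    and JG: "\<And>e. J (max (- Y e) 0) \<le> G e"
    and q: "entry_sum {..0} (\<lambda>v w. 1) < 1"
    and G: "(\<integral>\<^sup>+ e. ennreal (G e powr (1 + a)) \<partial>Q) < \<infinity>"
  shows "entry_sum {0<..} (\<lambda>v w. ennreal (v powr (1 + a))) < \<infinity>"
proof -
  have G_le: "(\<integral>\<^sup>+ e. ennreal (G e powr s) \<partial>Q) \<le> (\<integral>\<^sup>+ e. ennreal (G e powr t) \<partial>Q)" if "s \<le> t" for s t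
    by (intro nn_integral_mono ennreal_leI powr_mono that G_ge_1)
  \<comment> \<open>Induction on an integer above \<open>a\<close>: each step lowers the order by 1
    until \<open>a \<le> 1\<close>, where the first moment is enough.\<close>
  have "a \<le> real n \<Longrightarrow> ?thesis" for n using a G
  proof (induction n arbitrary: a)
    case (Suc n)
    show ?case
    proof (rule entry_sum_up_powr_finite_step[OF Suc.prems(2) _ JG q Suc.prems(3)])
      show "entry_sum {0<..} (\<lambda>v w. ennreal (v powr max 1 a)) < \<infinity>"
      proof (cases "a \<le> 1")
        case True
        have "(\<integral>\<^sup>+ e. ennreal (G e powr 1) \<partial>Q) < \<infinity>"
          using G_le[of 1 "1 + a"] Suc.prems by (intro le_less_trans[OF _ Suc.prems(3)]) auto
        moreover have "G e powr 1 = G e" for e using G_ge_1[of e] by simp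
        ultimately show ?thesis using entry_sum_up_mean_finite[OF q] True by (simp add: max_def)
      next
        case False
        have "(\<integral>\<^sup>+ e. ennreal (G e powr (1 + (a - 1))) \<partial>Q) < \<infinity>"
          using G_le[of "1 + (a - 1)" "1 + a"] by (intro le_less_trans[OF _ Suc.prems(3)]) auto
        then have "entry_sum {0<..} (\<lambda>v w. ennreal (v powr (1 + (a - 1)))) < \<infinity>"
          using False Suc.prems by (intro Suc.IH) auto
        then show ?thesis using False by (simp add: max_def)
      qed
    qed
  qed simp
  from this[of "nat \<lceil>a\<rceil>"] show ?thesis by linarith
qed

end

section \<open>Paths that stay positive, and blocks between ladder epochs\<close>

context iid_walk
begin

definition stay_up :: "(nat \<Rightarrow> 'e) \<Rightarrow> bool" where
  "stay_up c \<longleftrightarrow> (\<forall>n\<ge>1. 0 < W n c)"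

lemma measurable_stay_up [measurable]: "Measurable.pred R stay_up"
  unfolding stay_up_def[abs_def] by measurable

lemma entry_sum_down_less_1:
  assumes "emeasure R {c. stay_up c} > 0"
  shows "entry_sum {..0} (\<lambda>v w. 1) < 1"
proof -
  have m: "{c. stay_up c} \<in> sets R" using measurable_stay_up by (simp add: pred_def)
  have "entry_sum {..0} (\<lambda>v w. 1) \<le> (\<integral>\<^sup>+ c. indicator (space R - {c. stay_up c}) c \<partial>R)"
    by (rule entry_sum_le_nn_integral) (auto simp: entry_def stay_up_def not_less intro!: exI split: split_indicator)
  also have "\<dots> = emeasure R (space R - {c. stay_up c})"
    by (rule nn_integral_indicator) (rule sets.compl_sets[OF m])
  also have "\<dots> = 1 - emeasure R {c. stay_up c}"
    using emeasure_compl[OF m] P.emeasure_space_1 by simp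
  also have "\<dots> < 1"
    using assms emeasure_space[of R "{c. stay_up c}"] P.emeasure_space_1
    by (intro ennreal_between) auto
  finally show ?thesis .
qed

lemma nn_integral_shift:
  assumes [measurable]: "f \<in> borel_measurable R"
  shows "(\<integral>\<^sup>+ c. f (shift n c) \<partial>R) = (\<integral>\<^sup>+ c. f c \<partial>R)"
proof -
  have "(\<integral>\<^sup>+ c. f (shift n c) \<partial>R) = (\<integral>\<^sup>+ c. \<integral>\<^sup>+ c'. f c' \<partial>R \<partial>R)"
    by (rule nn_integral_split) auto
  then show ?thesis by (simp add: P.emeasure_space_1[simplified])
qed

text \<open>After the last time at which a divergent path attains its minimum, it stays strictly
  above that value. So almost surely some shift of the path satisfies \<open>stay_up\<close>; all
  shifts have the same law, and countably many null events cannot cover everything.\<close>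

lemma emeasure_stay_up_pos:
  assumes lim: "AE c in R. filterlim (\<lambda>n. W n c) at_top sequentially"
  shows "emeasure R {c. stay_up c} > 0"
proof (rule ccontr)
  assume "\<not> emeasure R {c. stay_up c} > 0"
  then have "(\<integral>\<^sup>+ c. (if stay_up c then 1 else 0) \<partial>R) = 0"
    using nn_integral_indicator[of "{c. stay_up c}" R] measurable_stay_up
    by (simp add: pred_def indicator_def of_bool_def)
  then have "(\<integral>\<^sup>+ c. (if stay_up (shift n c) then 1 else 0) \<partial>R) = 0" for n
    using nn_integral_shift[of "\<lambda>c. if stay_up c then 1 else 0" n] by simp
  then have "(\<Sum>n. \<integral>\<^sup>+ c. (if stay_up (shift n c) then 1 else 0) \<partial>R) = 0" by simp
  moreover have "1 \<le> (\<Sum>n. \<integral>\<^sup>+ c. (if stay_up (shift n c) then 1 else 0) \<partial>R)"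
  proof -
    have "(\<integral>\<^sup>+ c. 1 \<partial>R) \<le> (\<integral>\<^sup>+ c. (\<Sum>n. if stay_up (shift n c) then 1 else 0) \<partial>R)"
    proof (rule nn_integral_mono_AE)
      show "AE c in R. 1 \<le> (\<Sum>n. if stay_up (shift n c) then 1 else (0::ennreal))"
        using lim
      proof eventually_elim
        case (elim c)
        define S where "S = {n. W n c \<le> 0}"
        have "finite S"
        proof -
          have "eventually (\<lambda>n. 0 < W n c) sequentially"
            using elim by (simp add: filterlim_at_top_dense)
          then obtain N where "\<And>n. n \<ge> N \<Longrightarrow> 0 < W n c" by (auto simp: eventually_sequentially)
          then have "S \<subseteq> {..<N}" by (auto simp: S_def not_le[symmetric])
          then show ?thesis by (rule finite_subset) simp
        qed
        have "0 \<in> S" by (simp add: S_def)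
        \<comment> \<open>The minimum over the finite set \<open>S\<close>, which contains 0, is the
          global one, since the walk is positive outside \<open>S\<close>. Its last location is
          taken because \<open>stay_up\<close> asks for strict inequality.\<close>
        define m where "m = Min ((\<lambda>n. W n c) ` S)"
        define n where "n = Max {n \<in> S. W n c = m}"
        have fin: "finite {n \<in> S. W n c = m}" using \<open>finite S\<close> by simp
        have "m \<in> (\<lambda>n. W n c) ` S" unfolding m_def using \<open>finite S\<close> \<open>0 \<in> S\<close> by (intro Min_in) auto
        then have "{n \<in> S. W n c = m} \<noteq> {}" by auto
        from Max_in[OF fin this] have n: "n \<in> S" "W n c = m" by (auto simp: n_def)
        have "W n c < W k c" if "n < k" for k
        proof (cases "k \<in> S")
          case True
          then have "m \<le> W k c" unfolding m_def using \<open>finite S\<close> by (intro Min_le) auto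
          moreover have "W k c \<noteq> m"
            using True that Max_ge[OF fin, of k] by (auto simp: n_def)
          ultimately show ?thesis using n by simp
        next
          case False
          then show ?thesis using n by (auto simp: S_def)
        qed
        then have "stay_up (shift n c)" unfolding stay_up_def
        proof (intro allI impI)
          fix k :: nat assume "1 \<le> k" and *: "\<And>k. n < k \<Longrightarrow> W n c < W k c"
          then show "0 < W k (shift n c)" using *[of "n + k"] W_add[of n k c] by simp
        qed
        then show ?case
          using le_suminf_ennreal[of "\<lambda>n. if stay_up (shift n c) then 1 else 0" n] by simp
      qed
    qed
    also have "\<dots> = (\<Sum>n. \<integral>\<^sup>+ c. (if stay_up (shift n c) then 1 else 0) \<partial>R)"
      by (rule nn_integral_suminf) measurable
    finally show ?thesis by (simp add: P.emeasure_space_1[simplified])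
  qed
  ultimately show False by simp
qed

lemma emeasure_first_pos:
  assumes "emeasure R {c. stay_up c} > 0"
  shows "measure Q {e. 0 < Y e} > 0"
proof -
  have "emeasure R {c. stay_up c} = (\<integral>\<^sup>+ c. indicator {c. stay_up c} c \<partial>R)"
    using measurable_stay_up by (intro nn_integral_indicator[symmetric]) (simp add: pred_def)
  also have "\<dots> \<le> (\<integral>\<^sup>+ c. indicator {e \<in> space Q. 0 < Y e} (c 0) \<partial>R)"
  proof (intro nn_integral_mono)
    fix c
    have "0 < Y (c 0)" if "stay_up c"
      using that[unfolded stay_up_def, rule_format, of 1] by (simp add: W_def)
    then show "indicator {c. stay_up c} c \<le> (indicator {e \<in> space Q. 0 < Y e} (c 0) :: ennreal)"
      by (simp add: space_Q split: split_indicator)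
  qed
  also have "\<dots> = (\<integral>\<^sup>+ e. indicator {e \<in> space Q. 0 < Y e} e \<partial>Q)"
    by (rule nn_integral_component) measurable
  also have "\<dots> = emeasure Q {e \<in> space Q. 0 < Y e}" by (rule nn_integral_indicator) measurable
  finally have "emeasure R {c. stay_up c} \<le> ennreal (measure Q {e. 0 < Y e})"
    by (simp add: space_Q Q.emeasure_eq_measure)
  with assms have "0 < ennreal (measure Q {e. 0 < Y e})" by (rule less_le_trans)
  then show ?thesis by simp
qed

lemma measurable_least_entry [measurable]:
  "A \<in> sets borel \<Longrightarrow> (\<lambda>c. LEAST n. entry A n c) \<in> R \<rightarrow>\<^sub>M count_space UNIV"
  by (rule measurable_Least) (rule measurable_entry)

text \<open>The fallback values where the walk never becomes positive are chosen such that
  \<open>J (block_depth d c) \<le> block_time c\<close> and \<open>1 \<le> block_time c\<close> hold everywhere.\<close>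

definition block_time :: "(nat \<Rightarrow> 'e) \<Rightarrow> real" where
  "block_time c = (if \<exists>n. entry {0<..} n c then V (LEAST n. entry {0<..} n c) c else 1)"

definition block_depth :: "('e \<Rightarrow> real) \<Rightarrow> (nat \<Rightarrow> 'e) \<Rightarrow> real" where
  "block_depth d c = (if \<exists>n. entry {0<..} n c then \<Sum>k<(LEAST n. entry {0<..} n c). d (c k) else 0)"

lemma measurable_block_time [measurable]: "block_time \<in> borel_measurable R"
proof -
  have "(\<lambda>c. V (LEAST n. entry {0<..} n c) c) \<in> borel_measurable R"
    by (rule measurable_compose_countable[OF measurable_V measurable_least_entry]) simp
  note [measurable] = this
  show ?thesis unfolding block_time_def[abs_def] by measurable
qed

lemma measurable_block_depth [measurable]:
  assumes [measurable]: "d \<in> borel_measurable Q"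
  shows "block_depth d \<in> borel_measurable R"
proof -
  have "(\<lambda>c. \<Sum>k<(LEAST n. entry {0<..} n c). d (c k)) \<in> borel_measurable R"
    by (rule measurable_compose_countable[where f = "\<lambda>n c. \<Sum>k<n. d (c k)", OF _ measurable_least_entry]) auto
  note [measurable] = this
  show ?thesis unfolding block_depth_def[abs_def] by measurable
qed

lemma least_entry: "entry A n c \<Longrightarrow> (LEAST n. entry A n c) = n"
  using entry_unique LeastI by metis

lemma block_time_ge_1: "1 \<le> block_time c"
proof -
  have "1 \<le> V n c" if "entry {0<..} n c" for n using V_ge[of n c] that by (simp add: entry_def)
  then show ?thesis by (auto simp: block_time_def least_entry)
qed

lemma nn_integral_block_time_finite:
  assumes "entry_sum {0<..} (\<lambda>v w. ennreal (v powr s)) < \<infinity>"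
  shows "(\<integral>\<^sup>+ c. ennreal (block_time c powr s) \<partial>R) < \<infinity>"
proof -
  have "(\<integral>\<^sup>+ c. ennreal (block_time c powr s) \<partial>R)
      \<le> (\<integral>\<^sup>+ c. 1 + (\<Sum>n. if entry {0<..} n c then ennreal (V n c powr s) else 0) \<partial>R)"
  proof (intro nn_integral_mono)
    fix c
    show "ennreal (block_time c powr s) \<le> 1 + (\<Sum>n. if entry {0<..} n c then ennreal (V n c powr s) else 0)"
    proof (cases "\<exists>n. entry {0<..} n c")
      case True
      then obtain n where n: "entry {0<..} n c" by blast
      then have "ennreal (block_time c powr s) \<le> (\<Sum>n. if entry {0<..} n c then ennreal (V n c powr s) else 0)"
        using le_suminf_ennreal[of "\<lambda>n. if entry {0<..} n c then ennreal (V n c powr s) else 0" n]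
        by (auto simp: block_time_def least_entry)
      also have "\<dots> \<le> 1 + (\<Sum>n. if entry {0<..} n c then ennreal (V n c powr s) else 0)" by simp
      finally show ?thesis .
    qed (simp add: block_time_def)
  qed
  also have "\<dots> = 1 + entry_sum {0<..} (\<lambda>v w. ennreal (v powr s))"
    by (simp add: nn_integral_add P.emeasure_space_1[simplified] nn_integral_suminf epoch_sum_def)
  also have "\<dots> < \<infinity>" using assms by simp
  finally show ?thesis .
qed

end

section \<open>Last exits bounded by ladder blocks, and hitting times bounded from below\<close>

context iid_walk_up
begin

text \<open>Adding the cycle depths instead of maximising them is harmless: \<open>J\<close> is
  subadditive, and \<open>G\<close>, which \<open>V\<close> adds up, already dominates
  \<open>J\<close> of every single depth.\<close>

lemma J_block_depth_le:
  assumes d: "\<And>e. 0 \<le> d e" "\<And>e. J (d e) \<le> G e"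
  shows "J (block_depth d c) \<le> block_time c"
proof (cases "\<exists>n. entry {0<..} n c")
  case True
  then obtain n where n: "entry {0<..} n c" by blast
  then have "1 \<le> n" by (simp add: entry_def)
  have "J (\<Sum>k<n. d (c k)) \<le> (\<Sum>k<n. J (d (c k)))"
    using \<open>1 \<le> n\<close> d by (intro J_sum_le) (auto simp: lessThan_empty_iff)
  also have "\<dots> \<le> V n c" unfolding V_def by (intro sum_mono d)
  finally show ?thesis using n by (auto simp: block_depth_def block_time_def least_entry)
qed (simp add: block_depth_def block_time_def J_def)

text \<open>From a ladder epoch \<open>m\<close> the path can fall to \<open>x\<close> within its
  block only if \<open>W m\<close> is at most \<open>x\<close> plus the block depth, and the clock
  then reads at most \<open>V m\<close> plus the block time. Adding over all such epochs makes it
  unnecessary to identify the last one.\<close>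

definition last_exit_bound :: "('e \<Rightarrow> real) \<Rightarrow> real \<Rightarrow> real \<Rightarrow> (nat \<Rightarrow> 'e) \<Rightarrow> ennreal" where
  "last_exit_bound d a x c = (\<Sum>m. if ladder {0<..} m c \<and> W m c \<le> x + block_depth d (shift m c)
      then ennreal ((V m c + block_time (shift m c)) powr a) else 0)"

lemma measurable_last_exit_term:
  assumes d: "d \<in> borel_measurable Q"
  shows "(\<lambda>c. if ladder {0<..} m c \<and> W m c \<le> x + block_depth d (shift m c)
      then ennreal ((V m c + block_time (shift m c)) powr a) else 0) \<in> borel_measurable R"
proof -
  define h where "h c = block_depth d (shift m c)" for c
  have [measurable]: "h \<in> borel_measurable R"
    unfolding h_def[abs_def] by (rule measurable_compose[OF measurable_shift measurable_block_depth[OF d]])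
  have 1: "(\<lambda>c. x + h c) \<in> borel_measurable R" by measurable
  have [measurable]: "Measurable.pred R (\<lambda>c. W m c \<le> x + h c)"
    unfolding not_less[symmetric]
    by (rule pred_intros_logic(2)[OF borel_measurable_pred_less[OF 1 measurable_W]])
  show ?thesis unfolding h_def[symmetric] by measurable
qed

lemma measurable_last_exit_bound [measurable]:
  assumes d: "d \<in> borel_measurable Q"
  shows "last_exit_bound d a x \<in> borel_measurable R"
proof -
  show ?thesis
    unfolding last_exit_bound_def[abs_def]
    by (rule borel_measurable_suminf_order) (rule measurable_last_exit_term[OF d])
qed

text \<open>Cycle \<open>k\<close> is assigned to the block that starts where \<open>W\<close> first
  attains its maximum over \<open>{..k}\<close>. By divergence there is a next ladder epoch, and it
  lies beyond \<open>k\<close>; so the depths of the cycles from \<open>m\<close> up to and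
  including \<open>k\<close> are all part of the block depth.\<close>

lemma last_exit_bound_ge:
  assumes a: "0 < a" and d: "\<And>e. 0 \<le> d e" "\<And>e. - d e \<le> Y e"
    and lim: "filterlim (\<lambda>n. W n c) at_top sequentially"
    and k: "W k c - d (c k) \<le> x"
  shows "ennreal (V (Suc k) c powr a) \<le> last_exit_bound d a x c"
proof -
  define w where "w = Max ((\<lambda>j. W j c) ` {..k})"
  \<comment> \<open>The least location of the maximum, so that all earlier values are strictly
    smaller and \<open>m\<close> is a strict ladder epoch.\<close>
  define m where "m = (LEAST j. j \<le> k \<and> W j c = w)"
  have "w \<in> (\<lambda>j. W j c) ` {..k}" unfolding w_def by (intro Max_in) auto
  then have "\<exists>j. j \<le> k \<and> W j c = w" by auto
  then have m: "m \<le> k" "W m c = w" unfolding m_def by (metis (mono_tags, lifting) LeastI_ex)+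
  have le: "W j c \<le> w" if "j \<le> k" for j unfolding w_def using that by (intro Max_ge) auto
  have lad: "ladder {0<..} m c"
    unfolding ladder_def
  proof (intro allI impI)
    fix j assume j: "j < m"
    then have "W j c \<noteq> w" using not_less_Least[of j "\<lambda>j. j \<le> k \<and> W j c = w"] m by (auto simp: m_def)
    then show "W m c - W j c \<in> {0<..}" using le[of j] m j by auto
  qed
  let ?c = "shift m c"
  have "\<exists>n. entry {0<..} n ?c"
  proof -
    have "eventually (\<lambda>n. W m c < W n c \<and> m < n) sequentially"
      using lim eventually_gt_at_top[of m] by (intro eventually_conj) (auto simp: filterlim_at_top_dense)
    then obtain n where n: "W m c < W n c" "m < n" by (auto simp: eventually_sequentially)
    then have "1 \<le> n - m \<and> W (n - m) ?c \<in> {0<..}" using W_add[of m "n - m" c] by auto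
    then show ?thesis
      using exists_least_iff[of "\<lambda>n. 1 \<le> n \<and> W n ?c \<in> {0<..}"] unfolding entry_def by auto
  qed
  then obtain n where n: "entry {0<..} n ?c" by blast
  have "k < m + n"
  proof (rule ccontr)
    assume "\<not> k < m + n"
    then have "W (m + n) c \<le> W m c" using le[of "m + n"] m by simp
    then show False using n W_add[of m n c] by (simp add: entry_def)
  qed
  have "V (Suc k) c \<le> V (m + n) c" using \<open>k < m + n\<close> by (intro V_mono) simp
  then have V: "V (Suc k) c \<le> V m c + block_time ?c"
    using n V_add[of m n c] by (auto simp: block_time_def least_entry)
  have lower: "- (\<Sum>i<j. d (?c i)) \<le> W j ?c" for j
    unfolding W_def sum_negf[symmetric] by (intro sum_mono d)
  have "W m c = W k c - W (k - m) ?c" using W_add[of m "k - m" c] m by simp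
  also have "\<dots> \<le> x + (d (c k) + (\<Sum>i<k - m. d (?c i)))" using lower[of "k - m"] k by simp
  also have "d (c k) + (\<Sum>i<k - m. d (?c i)) = (\<Sum>i<Suc (k - m). d (?c i))" using m by simp
  also have "\<dots> \<le> (\<Sum>i<n. d (?c i))" using \<open>k < m + n\<close> m d by (intro sum_mono2) auto
  also have "\<dots> = block_depth d ?c" using n by (auto simp: block_depth_def least_entry)
  finally have W: "W m c \<le> x + block_depth d ?c" by simp
  have "ennreal (V (Suc k) c powr a) \<le> ennreal ((V m c + block_time ?c) powr a)"
    using V a by (intro ennreal_leI powr_mono2) auto
  also have "\<dots> \<le> last_exit_bound d a x c"
    unfolding last_exit_bound_def
    using le_suminf_ennreal[of "\<lambda>m. if ladder {0<..} m c \<and> W m c \<le> x + block_depth d (shift m c)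
      then ennreal ((V m c + block_time (shift m c)) powr a) else 0" m] lad W by simp
  finally show ?thesis .
qed

lemma last_exit_bound_finite:
  assumes a: "0 < a" and x: "0 \<le> x"
    and d [measurable]: "d \<in> borel_measurable Q" and d0: "\<And>e. 0 \<le> d e" and dY: "\<And>e. - d e \<le> Y e"
    and Jd: "\<And>e. J (d e) \<le> G e"
    and q: "entry_sum {..0} (\<lambda>v w. 1) < 1"
    and G: "(\<integral>\<^sup>+ e. ennreal (G e powr (1 + a)) \<partial>Q) < \<infinity>"
  shows "(\<integral>\<^sup>+ c. last_exit_bound d a x c \<partial>R) < \<infinity>"
proof -
  have JG: "J (max (- Y e) 0) \<le> G e" for e
  proof -
    have "J (max (- Y e) 0) \<le> J (d e)" using d0[of e] dY[of e] by (intro J_mono) auto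
    then show ?thesis using Jd[of e] by simp
  qed
  have M1: "entry_sum {0<..} (\<lambda>v w. ennreal (v powr (1 + a))) < \<infinity>"
    by (rule entry_sum_up_powr_finite[OF a JG q G])
  have "entry_sum {0<..} (\<lambda>v w. ennreal (v powr max 1 a)) \<le> entry_sum {0<..} (\<lambda>v w. ennreal (v powr (1 + a)))"
    using a by (intro entry_sum_mono ennreal_leI powr_mono) auto
  then have M: "entry_sum {0<..} (\<lambda>v w. ennreal (v powr max 1 a)) < \<infinity>" using M1 by (rule le_less_trans)
  have depth0: "0 \<le> block_depth d c" for c by (simp add: block_depth_def d0 sum_nonneg)
  have "(\<Sum>n. \<integral>\<^sup>+ c. (if ladder {0<..} n c \<and> W n c \<le> x + block_depth d (shift n c)
             then ennreal ((V n c + block_time (shift n c)) powr a) else 0) \<partial>R) < \<infinity>"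
  \<comment> \<open>The factor \<open>J x + 1\<close> arises from \<open>J_add_le\<close>,
    \<open>J_block_depth_le\<close> and \<open>1 \<le> block_time c\<close>.\<close>
  proof (rule renewal_sum_le[OF a M, of "J x + 1"])
    show "0 \<le> J x + 1" using J_ge_1[OF x] by simp
    fix c
    have "J (x + block_depth d c) \<le> J x + J (block_depth d c)" by (rule J_add_le[OF x depth0])
    also have "\<dots> \<le> J x * block_time c + block_time c"
      using J_block_depth_le[of d c, OF d0 Jd] J_ge_1[OF x] block_time_ge_1[of c]
      by (intro add_mono) (auto simp: mult_le_cancel_left1)
    finally show "J (x + block_depth d c) \<le> (J x + 1) * block_time c" by (simp add: algebra_simps)
  qed (use x depth0 block_time_ge_1 nn_integral_block_time_finite[OF M1] in auto)
  then show ?thesis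
    unfolding last_exit_bound_def by (subst nn_integral_suminf) (auto intro: measurable_last_exit_term d)
qed

text \<open>If \<open>W k\<close> exceeds \<open>z\<close>, then the positive parts of the steps,
  each truncated at \<open>z\<close>, already add up to at least \<open>z\<close>, whether or not a
  single step reaches \<open>z\<close>. Markov's inequality for this truncated sum gives the
  bound.\<close>

lemma emeasure_W_greater_le:
  assumes z: "0 < z"
  shows "emeasure R {c. z < W k c} \<le> ennreal (real k / J z)"
proof -
  have "{c \<in> space R. z < W k c} \<in> sets R" by measurable
  then have "emeasure R {c. z < W k c} = (\<integral>\<^sup>+ c. indicator {c. z < W k c} c \<partial>R)" by simp
  also have "\<dots> \<le> (\<integral>\<^sup>+ c. (\<Sum>j<k. ennreal (min (max (Y (c j)) 0) z / z)) \<partial>R)"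
  proof (intro nn_integral_mono)
    fix c
    have "1 \<le> (\<Sum>j<k. min (max (Y (c j)) 0) z / z)" if "z < W k c"
    proof (cases "\<exists>j<k. z \<le> Y (c j)")
      case True
      then obtain j where j: "j < k" "z \<le> Y (c j)" by blast
      then have "1 = (\<Sum>j\<in>{j}. min (max (Y (c j)) 0) z / z)" using z by (simp add: min_def max_def)
      also have "\<dots> \<le> (\<Sum>j<k. min (max (Y (c j)) 0) z / z)"
        using j z by (intro sum_mono2) auto
      finally show ?thesis .
    next
      case False
      have "1 \<le> W k c / z" using that z by (simp add: field_simps)
      also have "\<dots> \<le> (\<Sum>j<k. min (max (Y (c j)) 0) z / z)"
        unfolding W_def sum_divide_distrib using False z
        by (intro sum_mono divide_right_mono) (auto simp: not_le)
      finally show ?thesis .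
    qed
    then show "indicator {c. z < W k c} c \<le> (\<Sum>j<k. ennreal (min (max (Y (c j)) 0) z / z))"
      using z by (auto split: split_indicator simp: sum_ennreal simp flip: ennreal_1 intro!: ennreal_leI)
  qed
  also have "\<dots> = (\<Sum>j<k. \<integral>\<^sup>+ e. ennreal (min (max (Y e) 0) z / z) \<partial>Q)"
    by (simp add: nn_integral_sum nn_integral_component[where f = "\<lambda>e. ennreal (min (max (Y e) 0) z / z)"])
  also have "(\<integral>\<^sup>+ e. ennreal (min (max (Y e) 0) z / z) \<partial>Q) = ennreal (trunc_mean z / z)"
    using z integrable_trunc[of z]
    by (subst nn_integral_eq_integral) (auto simp: trunc_mean_def)
  also have "(\<Sum>j<k. ennreal (trunc_mean z / z)) = ennreal (real k * (trunc_mean z / z))"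
    using z trunc_mean_nonneg[of z] by (simp add: ennreal_mult[symmetric] ennreal_of_nat_eq_real_of_nat)
  finally show ?thesis using z by (simp add: J_def)
qed

text \<open>Here \<open>mn\<close> is the minimum inside a cycle, and \<open>fin\<close> is a moment
  of the index of the first cycle that reaches \<open>-x\<close>. For all \<open>k\<close> up to the
  order \<open>J z\<close>, with probability bounded below, no earlier cycle has reached
  \<open>-x\<close> and \<open>W k\<close> is at most \<open>z\<close>; an independent cycle of
  depth at least \<open>x + z\<close> then reaches \<open>-x\<close>. Adding \<open>k powr a\<close>
  over this range gives the order \<open>J z powr (1 + a)\<close>.\<close>

lemma J_moment_of_hitting_moment:
  assumes a: "0 < a" and x: "0 \<le> x"
    and mn [measurable]: "mn \<in> borel_measurable Q" and mnY: "\<And>e. mn e \<le> Y e"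
    and pos: "emeasure R {c. \<forall>j. - x < W j c + mn (c j)} > 0"
    and fin: "(\<Sum>k. \<integral>\<^sup>+ c. (if 1 \<le> k \<and> (\<forall>j<k. - x < W j c + mn (c j)) \<and> W k c + mn (c k) \<le> - x
         then ennreal (real k powr a) else 0) \<partial>R) < \<infinity>"
  shows "(\<integral>\<^sup>+ e. ennreal (J (max (- mn e) 0) powr (1 + a)) \<partial>Q) < \<infinity>"
proof -
  let ?d = "\<lambda>e. max (- mn e) 0"
  let ?F = "\<lambda>k c. \<forall>j<k. - x < W j c + mn (c j)"
  let ?U = "{c. \<forall>j. - x < W j c + mn (c j)}"
  define h where "h k z = emeasure R {c. ?F k c \<and> W k c \<le> z}" for k z
  define r where "r = measure R ?U"
  have Um: "?U \<in> sets R"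
  proof -
    have "{c \<in> space R. \<forall>j. - x < W j c + mn (c j)} \<in> sets R" by measurable
    then show ?thesis by simp
  qed
  have r: "0 < r" using pos by (simp add: r_def P.emeasure_eq_measure)
  have hm: "{c. ?F k c \<and> W k c \<le> z} \<in> sets R" for k z
  proof -
    have "{c \<in> space R. ?F k c \<and> W k c \<le> z} \<in> sets R" by measurable
    then show ?thesis by simp
  qed
  \<comment> \<open>With probability \<open>r\<close> the path never reaches \<open>-x\<close>, and
    by \<open>emeasure_W_greater_le\<close> it is above \<open>z\<close> at time \<open>k\<close>
    with probability at most \<open>r / 2\<close>.\<close>
  have h_ge: "ennreal (r / 2) \<le> h k z" if z: "0 < z" and k: "real k \<le> r / 2 * J z" for k z
  proof -
    have J: "1 \<le> J z" using J_ge_1 z by simp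
    have gm: "{c. z < W k c} \<in> sets R"
    proof -
      have "{c \<in> space R. z < W k c} \<in> sets R" by measurable
      then show ?thesis by simp
    qed
    have "emeasure R ?U \<le> emeasure R ({c. ?F k c \<and> W k c \<le> z} \<union> {c. z < W k c})"
      by (intro emeasure_mono sets.Un hm gm) auto
    also have "\<dots> \<le> h k z + emeasure R {c. z < W k c}"
      unfolding h_def by (intro emeasure_subadditive hm gm)
    also have "\<dots> \<le> h k z + ennreal (r / 2)"
    proof (intro add_left_mono order_trans[OF emeasure_W_greater_le[OF z]] ennreal_leI)
      show "real k / J z \<le> r / 2" using k J by (simp add: field_simps)
    qed
    finally have "ennreal r \<le> h k z + ennreal (r / 2)" by (simp add: r_def P.emeasure_eq_measure)
    moreover have "h k z = ennreal (measure R {c. ?F k c \<and> W k c \<le> z})"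
      by (simp add: h_def P.emeasure_eq_measure)
    ultimately show ?thesis using r
      by (simp add: ennreal_plus[symmetric] measure_nonneg ennreal_le_iff del: ennreal_plus)
  qed
  \<comment> \<open>The contribution to the hitting moment when the given \<open>e\<close> is
    inserted as cycle \<open>k\<close>, after \<open>k\<close> cycles that did not reach
    \<open>-x\<close>.\<close>
  define Z where "Z e = (\<Sum>k. ennreal (real k powr a) * h k (?d e - x))" for e
  \<comment> \<open>The constants collect \<open>J (?d e) \<le> J x + J z\<close>, then
    \<open>J z \<le> 2 / r * (n + 1)\<close>, the splitting of the power of \<open>n + 1\<close>,
    and the comparison of \<open>n powr (1 + a)\<close> with the sum of \<open>k powr a\<close>. The
    last factor \<open>2 / r\<close> of \<open>C'\<close> undoes the lower bound
    \<open>r / 2\<close> for \<open>h\<close>.\<close>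
  define C where "C = 2 powr (1 + a) * J x powr (1 + a) + 2 powr (1 + a) * (4 / r) powr (1 + a)"
  define C' where "C' = 2 powr (1 + a) * (4 / r) powr (1 + a) * (1 + a) * (2 / r)"
  have C0: "0 \<le> C" "0 \<le> C'" using a r by (auto simp: C_def C'_def)
  have pw: "ennreal (J (?d e) powr (1 + a)) \<le> ennreal C + ennreal C' * Z e" for e
  proof (cases "?d e \<le> x")
    case True
    have "J (?d e) powr (1 + a) \<le> J x powr (1 + a)"
      using True x a J_ge_1[of "?d e"] by (intro powr_mono2 J_mono) auto
    also have "\<dots> \<le> 2 powr (1 + a) * J x powr (1 + a)"
      using a ge_one_powr_ge_zero[of 2 "1 + a"] by (simp add: mult_le_cancel_right1)
    also have "\<dots> \<le> C" by (simp add: C_def)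
    finally have "ennreal (J (?d e) powr (1 + a)) \<le> ennreal C" by (rule ennreal_leI)
    also have "\<dots> \<le> ennreal C + ennreal C' * Z e" by simp
    finally show ?thesis .
  next
    case False
    define z where "z = ?d e - x"
    have z: "0 < z" using False unfolding z_def by linarith
    have J: "1 \<le> J z" using J_ge_1 z by simp
    define n where "n = nat \<lfloor>r / 2 * J z\<rfloor>"
    have "real n = real_of_int \<lfloor>r / 2 * J z\<rfloor>" using r J by (simp add: n_def)
    then have n: "real n \<le> r / 2 * J z" "r / 2 * J z \<le> real n + 1" by linarith+
    have "J (?d e) \<le> J x + J z" using J_add_le[of x z] x z by (simp add: z_def)
    then have "J (?d e) powr (1 + a) \<le> (J x + J z) powr (1 + a)"
      using a J_ge_1[of "?d e"] by (intro powr_mono2) auto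
    also have "\<dots> \<le> 2 powr (1 + a) * (J x powr (1 + a) + J z powr (1 + a))"
      using a J J_ge_1[OF x] by (intro powr_add_le_two_powr) auto
    also have "J z powr (1 + a) \<le> (2 / r * (real n + 1)) powr (1 + a)"
      using n(2) r J a by (intro powr_mono2) (auto simp: field_simps)
    also have "\<dots> = (2 / r) powr (1 + a) * (real n + 1) powr (1 + a)" using r by (intro powr_mult)
    also have "(real n + 1) powr (1 + a) \<le> 2 powr (1 + a) * (real n powr (1 + a) + 1 powr (1 + a))"
      using a by (intro powr_add_le_two_powr) auto
    also have "real n powr (1 + a) \<le> (1 + a) * (\<Sum>k\<le>n. real k powr a)"
    proof (induction n)
      case (Suc n)
      have "real (Suc n) powr (1 + a) \<le> real n powr (1 + a) + (1 + a) * real (Suc n) powr a"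
        using powr_Suc_add_le_mvt[of "real n" 1 a] a by (simp add: add.commute)
      with Suc show ?case by (simp add: algebra_simps)
    qed (use a in simp)
    finally have "J (?d e) powr (1 + a) \<le> 2 powr (1 + a) * (J x powr (1 + a)
        + (2 / r) powr (1 + a) * (2 powr (1 + a) * ((1 + a) * (\<Sum>k\<le>n. real k powr a) + 1)))"
      by (simp add: mult_left_mono)
    also have "\<dots> = C + C' * ((\<Sum>k\<le>n. real k powr a) * (r / 2))"
    proof -
      have "(4 / r) powr (1 + a) = (2 / r) powr (1 + a) * 2 powr (1 + a)"
        using r powr_mult[of "2 / r" 2 "1 + a"] by simp
      then show ?thesis using r by (simp add: C_def C'_def algebra_simps)
    qed
    finally have "ennreal (J (?d e) powr (1 + a)) \<le> ennreal (C + C' * ((\<Sum>k\<le>n. real k powr a) * (r / 2)))"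
      by (rule ennreal_leI)
    also have "\<dots> = ennreal C + ennreal C' * (\<Sum>k\<le>n. ennreal (real k powr a) * ennreal (r / 2))"
      using C0 r by (simp add: ennreal_plus ennreal_mult sum_nonneg sum_ennreal sum_distrib_right flip: ennreal_mult)
    also have "\<dots> \<le> ennreal C + ennreal C' * Z e"
    proof (intro add_left_mono mult_left_mono)
      have "(\<Sum>k\<le>n. ennreal (real k powr a) * ennreal (r / 2)) \<le> (\<Sum>k\<le>n. ennreal (real k powr a) * h k z)"
        using n by (intro sum_mono mult_left_mono h_ge z) (auto intro: order_trans)
      also have "\<dots> \<le> Z e" unfolding Z_def z_def by (intro sum_le_suminf summableI) auto
      finally show "(\<Sum>k\<le>n. ennreal (real k powr a) * ennreal (r / 2)) \<le> Z e" .
    qed auto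
    finally show ?thesis .
  qed
  define Fn where "Fn k c e = (if ?F k c \<and> W k c \<le> ?d e - x then ennreal (real k powr a) else 0)" for k c e
  have Fm [measurable]: "(\<lambda>(c, e). Fn k c e) \<in> borel_measurable (R \<Otimes>\<^sub>M Q)" for k
    unfolding Fn_def by measurable
  have Fm': "(\<lambda>(c, c'). Fn k c (c' 0)) \<in> borel_measurable (R \<Otimes>\<^sub>M R)" for k
  proof -
    have "(\<lambda>z. (fst z, snd z 0)) \<in> R \<Otimes>\<^sub>M R \<rightarrow>\<^sub>M R \<Otimes>\<^sub>M Q" by simp
    from measurable_compose[OF this Fm] show ?thesis by (simp add: split_beta')
  qed
  have Zk: "ennreal (real k powr a) * h k (?d e - x) = (\<integral>\<^sup>+ c. Fn k c e \<partial>R)" for k e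
  proof -
    have "(\<integral>\<^sup>+ c. Fn k c e \<partial>R) = (\<integral>\<^sup>+ c. ennreal (real k powr a) * indicator {c. ?F k c \<and> W k c \<le> ?d e - x} c \<partial>R)"
      by (intro nn_integral_cong) (simp add: Fn_def split: split_indicator)
    then show ?thesis using hm by (simp add: nn_integral_cmult h_def)
  qed
  have Zkm [measurable]: "(\<lambda>e. \<integral>\<^sup>+ c. Fn k c e \<partial>R) \<in> borel_measurable Q" for k
  proof -
    have "(\<lambda>(e, c). Fn k c e) \<in> borel_measurable (Q \<Otimes>\<^sub>M R)" unfolding Fn_def by measurable
    then show ?thesis by (rule P.borel_measurable_nn_integral)
  qed
  have Zm [measurable]: "Z \<in> borel_measurable Q" unfolding Z_def[abs_def] Zk by measurable
  have "(\<integral>\<^sup>+ e. Z e \<partial>Q) = (\<Sum>k. \<integral>\<^sup>+ e. \<integral>\<^sup>+ c. Fn k c e \<partial>R \<partial>Q)"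
    unfolding Z_def Zk by (rule nn_integral_suminf) measurable
  also have "\<dots> = (\<Sum>k. \<integral>\<^sup>+ c. Fn k c (c k) \<partial>R)"
  proof (intro suminf_cong)
    fix k
    have "(\<integral>\<^sup>+ c. Fn k c (c k) \<partial>R) = (\<integral>\<^sup>+ c. Fn k c (shift k c 0) \<partial>R)" by simp
    also have "\<dots> = (\<integral>\<^sup>+ c'. \<integral>\<^sup>+ c. Fn k c (c' 0) \<partial>R \<partial>R)"
    proof (rule nn_integral_split_swap[OF Fm'])
      fix c d c' :: "nat \<Rightarrow> 'e" assume *: "\<And>j. j < k \<Longrightarrow> c j = d j"
      have "W j c = W j d" if "j \<le> k" for j using that * by (intro W_cong) auto
      then show "Fn k c (c' 0) = Fn k d (c' 0)" using * by (auto simp: Fn_def)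
    qed
    also have "\<dots> = (\<integral>\<^sup>+ e. \<integral>\<^sup>+ c. Fn k c e \<partial>R \<partial>Q)"
      by (rule nn_integral_component) measurable
    finally show "(\<integral>\<^sup>+ e. \<integral>\<^sup>+ c. Fn k c e \<partial>R \<partial>Q) = (\<integral>\<^sup>+ c. Fn k c (c k) \<partial>R)" by simp
  qed
  also have "\<dots> \<le> (\<Sum>k. \<integral>\<^sup>+ c. (if 1 \<le> k \<and> ?F k c \<and> W k c + mn (c k) \<le> - x
         then ennreal (real k powr a) else 0) \<partial>R)"
  proof (intro suminf_le nn_integral_mono)
    fix k c
    show "Fn k c (c k) \<le> (if 1 \<le> k \<and> ?F k c \<and> W k c + mn (c k) \<le> - x then ennreal (real k powr a) else 0)"
    \<comment> \<open>The term \<open>k = 0\<close> vanishes because \<open>0 powr a = 0\<close>.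
      For larger \<open>k\<close> the minimum of the previous cycle keeps \<open>W k\<close> above
      \<open>-x\<close>, so \<open>W k c \<le> ?d (c k) - x\<close> is possible only with a positive
      depth, where \<open>?d\<close> is \<open>- mn\<close>.\<close>
    proof (cases "k = 0")
      case False
      then obtain j where j: "k = Suc j" by (cases k) auto
      have "W k c + mn (c k) \<le> - x" if "?F k c" "W k c \<le> ?d (c k) - x"
      proof -
        have "- x < W j c + mn (c j)" using that j by simp
        also have "\<dots> \<le> W k c" using mnY[of "c j"] by (simp add: j W_Suc)
        finally show ?thesis using that(2) by (auto simp: max_def split: if_splits)
      qed
      then show ?thesis using False by (auto simp: Fn_def)
    qed (simp add: Fn_def)
  qed auto
  finally have Z: "(\<integral>\<^sup>+ e. Z e \<partial>Q) < \<infinity>" using fin by (rule le_less_trans)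
  have "(\<integral>\<^sup>+ e. ennreal (J (?d e) powr (1 + a)) \<partial>Q) \<le> (\<integral>\<^sup>+ e. ennreal C + ennreal C' * Z e \<partial>Q)"
    by (intro nn_integral_mono pw)
  also have "\<dots> = ennreal C + ennreal C' * (\<integral>\<^sup>+ e. Z e \<partial>Q)"
    by (simp add: nn_integral_add nn_integral_cmult Q.emeasure_space_1)
  also have "\<dots> < \<infinity>" using Z by (simp add: ennreal_mult_less_top)
  finally show ?thesis .
qed

end

section \<open>Regeneration of Markov random walks\<close>

text \<open>Only countable quantifiers occur on the right, so divergence becomes a measurable
  event.\<close>

lemma filterlim_at_top_nat_iff:
  fixes f :: "nat \<Rightarrow> real"
  shows "filterlim f at_top sequentially \<longleftrightarrow> (\<forall>b::nat. \<exists>N. \<forall>n\<ge>N. real b \<le> f n)"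
proof
  assume *: "\<forall>b::nat. \<exists>N. \<forall>n\<ge>N. real b \<le> f n"
  show "filterlim f at_top sequentially"
    unfolding filterlim_at_top eventually_sequentially
  proof
    fix Z :: real
    obtain b :: nat where "Z \<le> real b" using real_arch_simple by blast
    with * show "\<exists>N. \<forall>n\<ge>N. Z \<le> f n" by (meson order_trans)
  qed
qed (auto simp: filterlim_at_top eventually_sequentially)

lemma first_time_eq_enatD:
  assumes "first_time Q = enat n"
  shows "1 \<le> n" "Q n" "\<And>m. 1 \<le> m \<Longrightarrow> Q m \<Longrightarrow> n \<le> m"
proof -
  have *: "\<exists>n\<ge>1. Q n" and n: "n = (LEAST n. 1 \<le> n \<and> Q n)"
    using assms by (auto simp: first_time_def split: if_splits)
  show "1 \<le> n" "Q n" using LeastI_ex[of "\<lambda>n. 1 \<le> n \<and> Q n"] * n by auto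
  show "n \<le> m" if "1 \<le> m" "Q m" for m unfolding n using that by (intro Least_le) auto
qed

lemma first_time_eq_infinity_iff: "first_time Q = \<infinity> \<longleftrightarrow> (\<forall>n\<ge>1. \<not> Q n)"
  by (auto simp: first_time_def)

lemma epow_enat [simp]: "epow (enat n) a = ennreal (real n powr a)"
  and epow_infinity [simp]: "epow \<infinity> a = \<infinity>"
  by (simp_all add: epow_def)

lemma epow_mono: "0 \<le> a \<Longrightarrow> s \<le> t \<Longrightarrow> epow s a \<le> epow t a"
  by (cases s; cases t) (auto intro!: ennreal_leI powr_mono2)

text \<open>Think of \<open>c0\<close> as reading off the first cycle and of \<open>r\<close> as
  deleting it: \<open>eq\<close> says that the rest is independent of that cycle and again has law
  \<open>L\<close>. Finite products follow by induction and determine the law of the whole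
  sequence.\<close>

lemma distr_iterate_eq_PiM:
  assumes L: "prob_space L" and c0 [measurable]: "c0 \<in> L \<rightarrow>\<^sub>M E" and r [measurable]: "r \<in> L \<rightarrow>\<^sub>M L"
    and eq: "distr L (E \<Otimes>\<^sub>M L) (\<lambda>z. (c0 z, r z)) = distr L E c0 \<Otimes>\<^sub>M L"
  shows "distr L (PiM UNIV (\<lambda>_. E)) (\<lambda>z k. c0 ((r ^^ k) z)) = PiM UNIV (\<lambda>_::nat. distr L E c0)"
proof -
  interpret L: prob_space L by fact
  let ?Q = "distr L E c0"
  interpret Q: prob_space ?Q by (rule L.prob_space_distr) fact
  interpret product_prob_space "\<lambda>_. ?Q" "UNIV :: nat set" by unfold_locales
  have [measurable]: "(r ^^ k) \<in> L \<rightarrow>\<^sub>M L" for k by (induction k) auto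
  have [measurable]: "(\<lambda>z k. c0 ((r ^^ k) z)) \<in> L \<rightarrow>\<^sub>M PiM UNIV (\<lambda>_. E)"
    by (rule measurable_abs_UNIV) measurable
  have one: "emeasure L {z \<in> space L. c0 z \<in> A \<and> r z \<in> B} = emeasure ?Q A * emeasure L B"
    if [measurable]: "A \<in> sets E" "B \<in> sets L" for A B
  proof -
    have "emeasure ?Q A * emeasure L B = emeasure (?Q \<Otimes>\<^sub>M L) (A \<times> B)"
      by (rule L.emeasure_pair_measure_Times[symmetric]) auto
    also have "\<dots> = emeasure (distr L (E \<Otimes>\<^sub>M L) (\<lambda>z. (c0 z, r z))) (A \<times> B)" by (simp add: eq)
    also have "\<dots> = emeasure L {z \<in> space L. c0 z \<in> A \<and> r z \<in> B}"
      by (subst emeasure_distr) (auto intro!: arg_cong[where f = "emeasure L"])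
    finally show ?thesis by simp
  qed
  have fin: "emeasure L {z \<in> space L. \<forall>k<n. c0 ((r ^^ k) z) \<in> A k} = (\<Prod>k<n. emeasure ?Q (A k))"
    if "\<And>k. A k \<in> sets E" for n A
    using that
  proof (induction n arbitrary: A)
    case 0
    then show ?case by (simp add: L.emeasure_space_1)
  next
    case (Suc n)
    note Suc.prems [measurable]
    have "{z \<in> space L. \<forall>k<Suc n. c0 ((r ^^ k) z) \<in> A k}
        = {z \<in> space L. c0 z \<in> A 0 \<and> r z \<in> {z \<in> space L. \<forall>k<n. c0 ((r ^^ k) z) \<in> A (Suc k)}}"
      using measurable_space[OF r]
      by (auto simp: All_less_Suc2 funpow_Suc_right simp del: funpow.simps)
    also have "emeasure L \<dots> = emeasure ?Q (A 0) * emeasure L {z \<in> space L. \<forall>k<n. c0 ((r ^^ k) z) \<in> A (Suc k)}"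
      by (rule one) auto
    also have "\<dots> = (\<Prod>k<Suc n. emeasure ?Q (A k))"
      by (subst Suc.IH) (auto simp: Suc.prems prod.lessThan_Suc_shift simp del: prod.lessThan_Suc)
    finally show ?case .
  qed
  show ?thesis
  proof (rule PiM_eq)
    show "sets (distr L (PiM UNIV (\<lambda>_. E)) (\<lambda>z k. c0 ((r ^^ k) z))) = sets (PiM UNIV (\<lambda>_::nat. ?Q))"
      by (simp cong: sets_PiM_cong)
    fix J F assume J: "finite J" "J \<subseteq> (UNIV :: nat set)" "\<And>j. j \<in> J \<Longrightarrow> F j \<in> sets ?Q"
    obtain n where n: "J \<subseteq> {..<n}" using finite_nat_bounded[OF J(1)] by blast
    define A where "A k = (if k \<in> J then F k else space E)" for k
    have A [measurable]: "A k \<in> sets E" for k using J by (auto simp: A_def)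
    let ?X = "prod_emb UNIV (\<lambda>_. ?Q) J (\<Pi>\<^sub>E j\<in>J. F j)"
    have X: "?X \<in> sets (PiM UNIV (\<lambda>_. ?Q))" using J by (intro sets_PiM_I) auto
    then have "?X \<in> sets (PiM UNIV (\<lambda>_. E))" by (simp cong: sets_PiM_cong)
    then have "emeasure (distr L (PiM UNIV (\<lambda>_. E)) (\<lambda>z k. c0 ((r ^^ k) z))) ?X
        = emeasure L ((\<lambda>z k. c0 ((r ^^ k) z)) -` ?X \<inter> space L)"
      by (intro emeasure_distr) auto
    also have "(\<lambda>z k. c0 ((r ^^ k) z)) -` ?X \<inter> space L = {z \<in> space L. \<forall>k<n. c0 ((r ^^ k) z) \<in> A k}"
    proof -
      have "c0 ((r ^^ k) z) \<in> space E" if "z \<in> space L" for z k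
        using measurable_space[of "\<lambda>z. c0 ((r ^^ k) z)" L E z] that by simp
      then show ?thesis using n by (auto simp: prod_emb_def A_def PiE_iff subset_eq)
    qed
    also have "emeasure L \<dots> = (\<Prod>k<n. emeasure ?Q (A k))" by (rule fin) simp
    also have "\<dots> = (\<Prod>k\<in>J. emeasure ?Q (F k))"
    proof (rule prod.mono_neutral_cong_right)
      show "\<forall>i\<in>{..<n} - J. emeasure ?Q (A i) = 1"
        using Q.emeasure_space_1 by (auto simp: A_def)
    qed (use n in \<open>auto simp: A_def\<close>)
    finally show "emeasure (distr L (PiM UNIV (\<lambda>_. E)) (\<lambda>z k. c0 ((r ^^ k) z))) ?X = (\<Prod>k\<in>J. emeasure ?Q (F k))" .
  qed
qed

section \<open>Path laws and the Markov property\<close>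

abbreviation step_space :: "('s \<times> real) measure" where
  "step_space \<equiv> count_space UNIV \<Otimes>\<^sub>M borel"

abbreviation path_space :: "(nat \<Rightarrow> 's \<times> real) measure" where
  "path_space \<equiv> PiM UNIV (\<lambda>_. step_space)"

lemma space_path_space [simp]: "space path_space = UNIV"
  by (auto simp: space_PiM space_pair_measure)

definition cylinder :: "nat \<Rightarrow> (nat \<Rightarrow> 's) \<Rightarrow> (nat \<Rightarrow> real set) \<Rightarrow> (nat \<Rightarrow> 's \<times> real) set" where
  "cylinder n js Bs = {z. \<forall>k<n. fst (z k) = js k \<and> snd (z k) \<in> Bs k}"

lemma measurable_path_component [measurable]:
  "(\<lambda>z. z k) \<in> path_space \<rightarrow>\<^sub>M step_space"
  by simp

lemma measurable_path_fst [measurable]: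
  "(\<lambda>z. fst (z k)) \<in> path_space \<rightarrow>\<^sub>M count_space UNIV"
  by measurable

lemma sets_cylinder [measurable]:
  assumes [measurable]: "\<And>k. Bs k \<in> sets borel"
  shows "cylinder n js Bs \<in> sets path_space"
proof -
  have "{z \<in> space path_space. \<forall>k<n. fst (z k) = js k \<and> snd (z k) \<in> Bs k} \<in> sets path_space"
    by measurable
  then show ?thesis by (simp add: cylinder_def)
qed

text \<open>Since there are countably many states, every finite-dimensional rectangle is a countable
  disjoint union of cylinders with prescribed states, the events whose probabilities
  \<open>is_MRW\<close> specifies.\<close>

lemma path_measure_eqI:
  fixes \<mu> \<nu> :: "(nat \<Rightarrow> 's::countable \<times> real) measure"
  assumes s [simp]: "sets \<mu> = sets path_space" "sets \<nu> = sets path_space" and fin: "finite_measure \<mu>"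
    and eq: "\<And>n js Bs. (\<And>k. Bs k \<in> sets borel) \<Longrightarrow> emeasure \<mu> (cylinder n js Bs) = emeasure \<nu> (cylinder n js Bs)"
  shows "\<mu> = \<nu>"
proof (rule measure_eqI_PiM_infinite[OF s _ fin])
  fix A :: "nat \<Rightarrow> ('s \<times> real) set" and J :: "nat set"
  assume J: "finite J" "J \<subseteq> UNIV" "\<And>i. i \<in> J \<Longrightarrow> A i \<in> sets step_space"
  obtain n where n: "J \<subseteq> {..<n}" using finite_nat_bounded[OF J(1)] by blast
  define A' where "A' k = (if k \<in> J then A k else UNIV)" for k
  have A' [measurable]: "A' k \<in> sets step_space" for k
    using J sets.top[of "step_space :: ('s \<times> real) measure"] by (auto simp: A'_def space_pair_measure)
  define Bs where "Bs js k = {x. (js k, x) \<in> A' k}" for js :: "nat \<Rightarrow> 's" and k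
  have B [measurable]: "Bs js k \<in> sets borel" for js k
    using sets_Pair1[OF A', of "js k" k] by (simp add: Bs_def vimage_def)
  let ?I = "PiE {..<n} (\<lambda>_. UNIV) :: (nat \<Rightarrow> 's) set"
  have U: "prod_emb UNIV (\<lambda>_. step_space) J (Pi\<^sub>E J A) = (\<Union>js\<in>?I. cylinder n js (Bs js))"
  proof safe
    fix z assume "z \<in> prod_emb UNIV (\<lambda>_. step_space) J (Pi\<^sub>E J A)"
    then have "z k \<in> A' k" for k by (auto simp: prod_emb_def A'_def PiE_iff)
    then show "z \<in> (\<Union>js\<in>?I. cylinder n js (Bs js))"
      by (intro UN_I[of "restrict (\<lambda>k. fst (z k)) {..<n}"]) (auto simp: cylinder_def Bs_def)
  next
    fix z js assume "z \<in> cylinder n js (Bs js)"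
    then have *: "fst (z k) = js k \<and> snd (z k) \<in> Bs js k" if "k < n" for k
      using that by (auto simp: cylinder_def)
    have "z k \<in> A k" if "k \<in> J" for k
    proof -
      have "k < n" using n that by auto
      with *[of k] have "(fst (z k), snd (z k)) \<in> A' k" by (simp add: Bs_def)
      then show ?thesis using that by (simp add: A'_def)
    qed
    then show "z \<in> prod_emb UNIV (\<lambda>_. step_space) J (Pi\<^sub>E J A)"
      by (auto simp: prod_emb_def space_pair_measure PiE_iff)
  qed
  have ct: "countable ?I" by (rule countable_PiE) auto
  have disj: "disjoint_family_on (\<lambda>js. cylinder n js (Bs js)) ?I"
    unfolding disjoint_family_on_def
  proof safe
    fix js js' z assume "js \<in> ?I" "js' \<in> ?I" "js \<noteq> js'"
      and z: "z \<in> cylinder n js (Bs js)" "z \<in> cylinder n js' (Bs js')"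
    then obtain k where "k < n" "js k \<noteq> js' k" by (metis PiE_ext lessThan_iff)
    with z have False by (auto simp: cylinder_def)
    then show "z \<in> {}" ..
  qed
  have "emeasure \<rho> (\<Union>js\<in>?I. cylinder n js (Bs js)) = (\<integral>\<^sup>+ js. emeasure \<rho> (cylinder n js (Bs js)) \<partial>count_space ?I)"
    if "sets \<rho> = sets path_space" for \<rho> :: "(nat \<Rightarrow> 's \<times> real) measure"
    by (rule emeasure_UN_countable) (auto simp: that ct disj)
  then show "emeasure \<mu> (prod_emb UNIV (\<lambda>_. step_space) J (Pi\<^sub>E J A)) = emeasure \<nu> (prod_emb UNIV (\<lambda>_. step_space) J (Pi\<^sub>E J A))"
    unfolding U by (simp add: eq)
qed

locale mrw =
  fixes P :: "'s::countable \<Rightarrow> 'w measure"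
    and M :: "nat \<Rightarrow> 'w \<Rightarrow> 's" and X :: "nat \<Rightarrow> 'w \<Rightarrow> real"
    and p :: "'s \<Rightarrow> 's \<Rightarrow> real" and K :: "'s \<Rightarrow> 's \<Rightarrow> real measure"
  assumes MRW: "is_MRW P M X p K"
begin

lemma p_nonneg: "0 \<le> p i j"
  and p_has_sum: "(p i has_sum 1) UNIV"
  and prob_space_K: "prob_space (K i j)"
  and sets_K [measurable_cong]: "sets (K i j) = sets borel"
  and prob_space_P: "prob_space (P i)"
  and measurable_M [measurable]: "M n \<in> P i \<rightarrow>\<^sub>M count_space UNIV"
  and measurable_X [measurable]: "X n \<in> borel_measurable (P i)"
  using MRW unfolding is_MRW_def by blast+

lemma space_K [simp]: "space (K i j) = UNIV"
  using sets_eq_imp_space_eq[OF sets_K] by simp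

lemma fin_dim:
  assumes "\<And>k. Bs k \<in> sets borel"
  shows "measure (P i) {\<omega> \<in> space (P i). (\<forall>k\<le>n. M k \<omega> = js k) \<and> (\<forall>k\<in>{1..n}. X k \<omega> \<in> Bs k)}
        = (if js 0 = i then 1 else 0) *
          (\<Prod>k\<in>{1..n}. p (js (k - 1)) (js k) * measure (K (js (k - 1)) (js k)) (Bs k))"
  using MRW assms unfolding is_MRW_def by blast

lemma AE_M_0: "AE \<omega> in P i. M 0 \<omega> = i"
proof -
  interpret prob_space "P i" by (rule prob_space_P)
  have "measure (P i) {\<omega> \<in> space (P i). M 0 \<omega> = i} = 1"
    using fin_dim[of "\<lambda>_. UNIV" i 0 "\<lambda>_. i"] by simp
  then show ?thesis by (subst (asm) prob_Collect_eq_1) auto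
qed

text \<open>Entry \<open>n\<close> describes time \<open>n + 1\<close>. The initial state is left
  out because it is almost surely constant; a path cut at a visit to \<open>j\<close> is then again
  a path of law \<open>L j\<close>.\<close>

definition path :: "'w \<Rightarrow> nat \<Rightarrow> 's \<times> real" where
  "path \<omega> = (\<lambda>n. (M (Suc n) \<omega>, X (Suc n) \<omega>))"

lemma measurable_path [measurable]: "path \<in> P i \<rightarrow>\<^sub>M path_space"
  unfolding path_def by (rule measurable_abs_UNIV) measurable

definition L :: "'s \<Rightarrow> (nat \<Rightarrow> 's \<times> real) measure" where
  "L i = distr (P i) path_space path"

lemma sets_L [simp, measurable_cong]: "sets (L i) = sets path_space" by (simp add: L_def)
lemma space_L [simp]: "space (L i) = UNIV" by (simp add: L_def)

lemma prob_space_L: "prob_space (L i)"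
  unfolding L_def by (rule prob_space.prob_space_distr[OF prob_space_P]) measurable

lemma nn_integral_L: "f \<in> borel_measurable path_space \<Longrightarrow> (\<integral>\<^sup>+ z. f z \<partial>L i) = (\<integral>\<^sup>+ \<omega>. f (path \<omega>) \<partial>P i)"
  unfolding L_def by (rule nn_integral_distr) auto

lemma AE_L: "Measurable.pred path_space Q \<Longrightarrow> (AE z in L i. Q z) \<longleftrightarrow> (AE \<omega> in P i. Q (path \<omega>))"
  unfolding L_def by (subst AE_distr_iff) (auto simp: pred_def)

lemma emeasure_cylinder:
  assumes B [measurable]: "\<And>k. Bs k \<in> sets borel"
  shows "emeasure (L i) (cylinder n js Bs)
    = ennreal (\<Prod>k<n. p (case_nat i js k) (js k) * measure (K (case_nat i js k) (js k)) (Bs k))"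
proof -
  interpret P: prob_space "P i" by (rule prob_space_P)
  have "emeasure (L i) (cylinder n js Bs) = emeasure (P i) (path -` cylinder n js Bs \<inter> space (P i))"
    unfolding L_def by (rule emeasure_distr) auto
  also have "\<dots> = emeasure (P i) {\<omega> \<in> space (P i). path \<omega> \<in> cylinder n js Bs}"
    by (rule arg_cong[where f = "emeasure (P i)"]) auto
  also have "\<dots> = emeasure (P i) {\<omega> \<in> space (P i). (\<forall>k\<le>n. M k \<omega> = case_nat i js k) \<and> (\<forall>k\<in>{1..n}. X k \<omega> \<in> case_nat UNIV Bs k)}"
  proof (rule emeasure_eq_AE)
    have [measurable]: "case_nat UNIV Bs k \<in> sets borel" for k by (cases k) auto
    show "AE \<omega> in P i. \<omega> \<in> {\<omega> \<in> space (P i). path \<omega> \<in> cylinder n js Bs} \<longleftrightarrow>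
       \<omega> \<in> {\<omega> \<in> space (P i). (\<forall>k\<le>n. M k \<omega> = case_nat i js k) \<and> (\<forall>k\<in>{1..n}. X k \<omega> \<in> case_nat UNIV Bs k)}"
      using AE_M_0
    proof eventually_elim
      fix \<omega> assume 0: "M 0 \<omega> = i"
      have "(\<forall>k<n. M (Suc k) \<omega> = js k) \<longleftrightarrow> (\<forall>k\<le>n. M k \<omega> = case_nat i js k)"
        using 0 by (auto split: nat.split simp: Suc_le_eq)
      moreover have "(\<forall>k<n. X (Suc k) \<omega> \<in> Bs k) \<longleftrightarrow> (\<forall>k\<in>{1..n}. X k \<omega> \<in> case_nat UNIV Bs k)"
        by (auto split: nat.split simp: Suc_le_eq)
      ultimately show "\<omega> \<in> {\<omega> \<in> space (P i). path \<omega> \<in> cylinder n js Bs} \<longleftrightarrow>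
       \<omega> \<in> {\<omega> \<in> space (P i). (\<forall>k\<le>n. M k \<omega> = case_nat i js k) \<and> (\<forall>k\<in>{1..n}. X k \<omega> \<in> case_nat UNIV Bs k)}"
        by (auto simp: cylinder_def path_def)
    qed
  qed (measurable; simp split: nat.split)+
  also have "\<dots> = ennreal (\<Prod>k\<in>{1..n}. p (case_nat i js (k - 1)) (case_nat i js k)
      * measure (K (case_nat i js (k - 1)) (case_nat i js k)) (case_nat UNIV Bs k))"
    unfolding P.emeasure_eq_measure
    by (subst fin_dim) (auto split: nat.split)
  also have "(\<Prod>k\<in>{1..n}. p (case_nat i js (k - 1)) (case_nat i js k)
      * measure (K (case_nat i js (k - 1)) (case_nat i js k)) (case_nat UNIV Bs k))
    = (\<Prod>k<n. p (case_nat i js k) (js k) * measure (K (case_nat i js k) (js k)) (Bs k))"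
    by (rule prod.reindex_bij_witness[of _ Suc "\<lambda>k. k - 1"]) (auto split: nat.split)
  finally show ?thesis .
qed

definition step_pmf :: "'s \<Rightarrow> 's pmf" where
  "step_pmf i = embed_pmf (p i)"

lemma pmf_step_pmf: "pmf (step_pmf i) j = p i j"
  unfolding step_pmf_def
proof (rule pmf_embed_pmf)
  have "p i summable_on UNIV" using p_has_sum by (rule has_sum_imp_summable)
  note abs = iffD1[OF abs_summable_equivalent iffD1[OF summable_on_iff_abs_summable_on_real this]]
  have "(\<integral>\<^sup>+ j. ennreal (p i j) \<partial>count_space UNIV) = ennreal (infsum (p i) UNIV)"
    using nn_integral_conv_infsetsum[OF abs p_nonneg] infsetsum_infsum[OF abs] by simp
  also have "infsum (p i) UNIV = 1" using p_has_sum by (rule infsumI)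
  finally show "(\<integral>\<^sup>+ j. ennreal (p i j) \<partial>count_space UNIV) = 1" by simp
qed (rule p_nonneg)

definition first_step :: "'s \<Rightarrow> 's \<Rightarrow> (nat \<Rightarrow> 's \<times> real) measure" where
  "first_step i j = distr (K i j \<Otimes>\<^sub>M L j) path_space (\<lambda>(x, z). case_nat (j, x) z)"

lemma measurable_first_step_map [measurable]:
  "(\<lambda>(x, z). case_nat (j, x) z) \<in> K i j \<Otimes>\<^sub>M L j' \<rightarrow>\<^sub>M path_space"
proof -
  have "(\<lambda>xz. case_nat (j, fst xz) (snd xz) k) \<in> K i j \<Otimes>\<^sub>M L j' \<rightarrow>\<^sub>M step_space" for k
    by (cases k) simp_all
  then show ?thesis by (simp add: split_beta' measurable_abs_UNIV)
qed

lemma prob_space_first_step: "prob_space (first_step i j)"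
proof -
  interpret K: prob_space "K i j" by (rule prob_space_K)
  interpret L: prob_space "L j" by (rule prob_space_L)
  interpret KL: pair_prob_space "K i j" "L j" ..
  show ?thesis unfolding first_step_def by (rule KL.prob_space_distr) measurable
qed

lemma measurable_first_step: "first_step i \<in> measure_pmf q \<rightarrow>\<^sub>M subprob_algebra path_space"
  using prob_space_first_step
  by (auto simp: space_subprob_algebra first_step_def intro!: prob_space_imp_subprob_space)

lemma emeasure_first_step_cylinder:
  assumes B [measurable]: "\<And>k. Bs k \<in> sets borel"
  shows "emeasure (first_step i j) (cylinder (Suc n) js Bs)
    = (if j = js 0 then ennreal (measure (K i j) (Bs 0)) * emeasure (L j) (cylinder n (\<lambda>k. js (Suc k)) (\<lambda>k. Bs (Suc k))) else 0)"
proof -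
  interpret K: prob_space "K i j" by (rule prob_space_K)
  interpret L: prob_space "L j" by (rule prob_space_L)
  let ?f = "\<lambda>(x, z). case_nat (j, x) z"
  have cyl: "cylinder n (\<lambda>k. js (Suc k)) (\<lambda>k. Bs (Suc k)) \<in> sets path_space"
    by (rule sets_cylinder) (rule B)
  have T: "emeasure (K i j \<Otimes>\<^sub>M L j) (Bs 0 \<times> cylinder n (\<lambda>k. js (Suc k)) (\<lambda>k. Bs (Suc k)))
      = emeasure (K i j) (Bs 0) * emeasure (L j) (cylinder n (\<lambda>k. js (Suc k)) (\<lambda>k. Bs (Suc k)))"
    by (rule L.emeasure_pair_measure_Times) (auto simp: sets_K cyl)
  have "emeasure (first_step i j) (cylinder (Suc n) js Bs)
      = emeasure (K i j \<Otimes>\<^sub>M L j) (?f -` cylinder (Suc n) js Bs \<inter> space (K i j \<Otimes>\<^sub>M L j))"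
    unfolding first_step_def by (rule emeasure_distr) measurable
  also have "?f -` cylinder (Suc n) js Bs \<inter> space (K i j \<Otimes>\<^sub>M L j)
      = (if j = js 0 then Bs 0 \<times> cylinder n (\<lambda>k. js (Suc k)) (\<lambda>k. Bs (Suc k)) else {})"
    by (auto simp: cylinder_def All_less_Suc2 space_pair_measure)
  also have "emeasure (K i j \<Otimes>\<^sub>M L j) \<dots>
      = (if j = js 0 then emeasure (K i j) (Bs 0) * emeasure (L j) (cylinder n (\<lambda>k. js (Suc k)) (\<lambda>k. Bs (Suc k))) else 0)"
    using T by (cases "j = js 0") auto
  finally show ?thesis unfolding K.emeasure_eq_measure .
qed

text \<open>Checked on cylinders, where the product formula for \<open>n + 1\<close> steps factors
  into the first step and a product for \<open>n\<close> steps. All Markov properties are derived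
  from this decomposition.\<close>

lemma L_eq_bind: "L i = measure_pmf (step_pmf i) \<bind> first_step i"
proof (rule path_measure_eqI)
  have ms [measurable]: "first_step i \<in> measure_pmf (step_pmf i) \<rightarrow>\<^sub>M subprob_algebra path_space"
    by (rule measurable_first_step)
  show "sets (measure_pmf (step_pmf i) \<bind> first_step i) = sets path_space"
    by (rule sets_bind[OF sets_kernel[OF ms]]) auto
  show "finite_measure (L i)" using prob_space_L[of i] by (simp add: prob_space_def)
  fix n js and Bs :: "nat \<Rightarrow> real set" assume B [measurable]: "\<And>k. Bs k \<in> sets borel"
  have "emeasure (measure_pmf (step_pmf i) \<bind> first_step i) (cylinder n js Bs)
      = (\<integral>\<^sup>+ j. emeasure (first_step i j) (cylinder n js Bs) \<partial>measure_pmf (step_pmf i))"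
    by (rule emeasure_bind[OF _ ms]) auto
  also have "\<dots> = emeasure (L i) (cylinder n js Bs)"
  proof (cases n)
    case 0
    have "emeasure (first_step i j) UNIV = 1" for j
      using prob_space.emeasure_space_1[OF prob_space_first_step[of i j]] by (simp add: first_step_def)
    then show ?thesis using 0 prob_space.emeasure_space_1[OF prob_space_L[of i]] by (simp add: cylinder_def)
  next
    case (Suc m)
    have cs: "case_nat (js 0) (\<lambda>k. js (Suc k)) = js" by (auto split: nat.split)
    let ?c = "ennreal (measure (K i (js 0)) (Bs 0)) * emeasure (L (js 0)) (cylinder m (\<lambda>k. js (Suc k)) (\<lambda>k. Bs (Suc k)))"
    have "(\<integral>\<^sup>+ j. emeasure (first_step i j) (cylinder n js Bs) \<partial>measure_pmf (step_pmf i))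
        = (\<integral>\<^sup>+ j. ?c * indicator {js 0} j \<partial>measure_pmf (step_pmf i))"
      unfolding Suc by (intro nn_integral_cong) (simp add: emeasure_first_step_cylinder split: split_indicator)
    also have "\<dots> = ?c * ennreal (p i (js 0))"
      by (subst nn_integral_cmult) (auto simp: emeasure_pmf_single pmf_step_pmf)
    also have "\<dots> = emeasure (L i) (cylinder n js Bs)"
      unfolding Suc by (simp add: emeasure_cylinder prod.lessThan_Suc_shift ennreal_mult[symmetric] prod_nonneg p_nonneg mult_ac
            cs del: prod.lessThan_Suc)
    finally show ?thesis .
  qed
  finally show "emeasure (L i) (cylinder n js Bs) = emeasure (measure_pmf (step_pmf i) \<bind> first_step i) (cylinder n js Bs)"
    by simp
qed simp

lemma nn_integral_one_step:
  assumes f [measurable]: "f \<in> borel_measurable path_space"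
  shows "(\<integral>\<^sup>+ z. f z \<partial>L i)
    = (\<integral>\<^sup>+ j. \<integral>\<^sup>+ x. \<integral>\<^sup>+ z. f (case_nat (j, x) z) \<partial>L j \<partial>K i j \<partial>measure_pmf (step_pmf i))"
proof -
  have "(\<integral>\<^sup>+ z. f z \<partial>L i) = (\<integral>\<^sup>+ j. \<integral>\<^sup>+ z. f z \<partial>first_step i j \<partial>measure_pmf (step_pmf i))"
    unfolding L_eq_bind[of i] by (rule nn_integral_bind[OF f measurable_first_step])
  also have "\<dots> = (\<integral>\<^sup>+ j. \<integral>\<^sup>+ x. \<integral>\<^sup>+ z. f (case_nat (j, x) z) \<partial>L j \<partial>K i j \<partial>measure_pmf (step_pmf i))"
  proof (intro nn_integral_cong)
    fix j
    interpret L: prob_space "L j" by (rule prob_space_L)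
    have "(\<integral>\<^sup>+ z. f z \<partial>first_step i j) = (\<integral>\<^sup>+ xz. f (case_nat (j, fst xz) (snd xz)) \<partial>(K i j \<Otimes>\<^sub>M L j))"
      unfolding first_step_def by (subst nn_integral_distr) (auto simp: split_beta')
    also have "\<dots> = (\<integral>\<^sup>+ x. \<integral>\<^sup>+ z. f (case_nat (j, x) z) \<partial>L j \<partial>K i j)"
    proof -
      have "(\<lambda>xz. f (case_nat (j, fst xz) (snd xz))) \<in> borel_measurable (K i j \<Otimes>\<^sub>M L j)"
        using measurable_compose[OF measurable_first_step_map f] by (simp add: split_beta')
      from L.nn_integral_fst[OF this] show ?thesis by simp
    qed
    finally show "(\<integral>\<^sup>+ z. f z \<partial>first_step i j) = (\<integral>\<^sup>+ x. \<integral>\<^sup>+ z. f (case_nat (j, x) z) \<partial>L j \<partial>K i j)" .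
  qed
  finally show ?thesis .
qed

definition state_at :: "'s \<Rightarrow> nat \<Rightarrow> (nat \<Rightarrow> 's \<times> real) \<Rightarrow> 's" where
  "state_at i n z = (case n of 0 \<Rightarrow> i | Suc m \<Rightarrow> fst (z m))"

text \<open>The past is carried by \<open>f\<close>, which vanishes unless the state at time
  \<open>n\<close> is \<open>j\<close>; this replaces conditioning. The induction removes steps at
  the front, so the starting state and \<open>f\<close> vary.\<close>

lemma markov_property:
  assumes f: "f \<in> borel_measurable path_space" and g [measurable]: "g \<in> borel_measurable path_space"
    and dep: "\<And>z z'. (\<And>k. k < n \<Longrightarrow> z k = z' k) \<Longrightarrow> f z = f z'"
    and st: "\<And>z. f z \<noteq> 0 \<Longrightarrow> state_at i n z = j"
  shows "(\<integral>\<^sup>+ z. f z * g (shift n z) \<partial>L i) = (\<integral>\<^sup>+ z. f z \<partial>L i) * (\<integral>\<^sup>+ z. g z \<partial>L j :: ennreal)"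
  using f dep st
proof (induction n arbitrary: f i)
  case 0
  interpret L: prob_space "L i" by (rule prob_space_L)
  obtain c where c: "f = (\<lambda>_. c)" using 0(2) by (metis not_less0)
  show ?case
  proof (cases "c = 0")
    case False
    then have "i = j" using 0(3) c by (simp add: state_at_def)
    then show ?thesis using c L.emeasure_space_1 by (simp add: nn_integral_cmult)
  qed (simp add: c)
next
  case (Suc n)
  note Suc.prems(1) [measurable]
  have IH: "(\<integral>\<^sup>+ z. f (case_nat (j', x) z) * g (shift n z) \<partial>L j')
      = (\<integral>\<^sup>+ z. f (case_nat (j', x) z) \<partial>L j') * (\<integral>\<^sup>+ z. g z \<partial>L j)" for j' x
  proof (rule Suc.IH)
    have "(\<lambda>z. case_nat (j', x) z) \<in> path_space \<rightarrow>\<^sub>M path_space"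
      by (rule measurable_abs_UNIV) (simp split: nat.split)
    then show "(\<lambda>z. f (case_nat (j', x) z)) \<in> borel_measurable path_space"
      by (rule measurable_compose) (rule Suc.prems)
    show "f (case_nat (j', x) z) = f (case_nat (j', x) z')" if "\<And>k. k < n \<Longrightarrow> z k = z' k" for z z'
      using that by (intro Suc.prems) (auto split: nat.split)
    show "state_at j' n z = j" if "f (case_nat (j', x) z) \<noteq> 0" for z
      using Suc.prems(3)[OF that] by (simp add: state_at_def split: nat.splits)
  qed
  have m [measurable]: "(\<lambda>x. \<integral>\<^sup>+ z. f (case_nat (j', x) z) \<partial>L j') \<in> borel_measurable (K i j')" for j'
  proof -
    interpret L: prob_space "L j'" by (rule prob_space_L)
    have "(\<lambda>(x, z). f (case_nat (j', x) z)) \<in> borel_measurable (K i j' \<Otimes>\<^sub>M L j')"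
      using measurable_compose[OF measurable_first_step_map Suc.prems(1)] by (simp add: split_beta')
    then show ?thesis by (rule L.borel_measurable_nn_integral)
  qed
  have "(\<integral>\<^sup>+ z. f z * g (shift (Suc n) z) \<partial>L i)
      = (\<integral>\<^sup>+ j'. \<integral>\<^sup>+ x. \<integral>\<^sup>+ z. f (case_nat (j', x) z) * g (shift n z) \<partial>L j' \<partial>K i j' \<partial>measure_pmf (step_pmf i))"
    by (subst nn_integral_one_step) simp_all
  also have "\<dots> = (\<integral>\<^sup>+ j'. \<integral>\<^sup>+ x. \<integral>\<^sup>+ z. f (case_nat (j', x) z) \<partial>L j' \<partial>K i j' \<partial>measure_pmf (step_pmf i)) * (\<integral>\<^sup>+ z. g z \<partial>L j)"
    unfolding IH by (simp add: nn_integral_multc)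
  also have "\<dots> = (\<integral>\<^sup>+ z. f z \<partial>L i) * (\<integral>\<^sup>+ z. g z \<partial>L j)"
    by (subst nn_integral_one_step[OF Suc.prems(1)]) simp
  finally show ?case .
qed

section \<open>Regeneration at the visits to a state\<close>

definition cyc_len :: "'s \<Rightarrow> (nat \<Rightarrow> 's \<times> real) \<Rightarrow> nat" where
  "cyc_len i z = Suc (LEAST n. fst (z n) = i)"

lemma measurable_cyc_len [measurable]: "cyc_len i \<in> path_space \<rightarrow>\<^sub>M count_space UNIV"
  unfolding cyc_len_def[abs_def] by measurable

definition next_cyc :: "'s \<Rightarrow> (nat \<Rightarrow> 's \<times> real) \<Rightarrow> nat \<Rightarrow> 's \<times> real" where
  "next_cyc i z = shift (cyc_len i z) z"

lemma measurable_next_cyc [measurable]: "next_cyc i \<in> path_space \<rightarrow>\<^sub>M path_space"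
  unfolding next_cyc_def[abs_def]
  by (rule measurable_compose_countable[OF measurable_shift measurable_cyc_len])

definition first_visit :: "'s \<Rightarrow> nat \<Rightarrow> (nat \<Rightarrow> 's \<times> real) \<Rightarrow> bool" where
  "first_visit i n z \<longleftrightarrow> fst (z n) = i \<and> (\<forall>k<n. fst (z k) \<noteq> i)"

lemma measurable_first_visit [measurable]: "Measurable.pred path_space (first_visit i n)"
  unfolding first_visit_def by measurable

lemma first_visit_cyc_len: "first_visit i n z \<Longrightarrow> cyc_len i z = Suc n"
  unfolding first_visit_def cyc_len_def by (metis (mono_tags, lifting) Least_equality not_le)

lemma ex_first_visit: "fst (z n) = i \<Longrightarrow> \<exists>n. first_visit i n z"
  unfolding first_visit_def using exists_least_iff[of "\<lambda>n. fst (z n) = i"] by auto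

lemma first_visit_unique: "first_visit i m z \<Longrightarrow> first_visit i n z \<Longrightarrow> m = n"
  using first_visit_cyc_len[of i m z] first_visit_cyc_len[of i n z] by simp

text \<open>The strong Markov property at the first visit to \<open>j\<close>, obtained by adding
  the Markov property over all possible times of that visit; \<open>dep\<close> makes
  \<open>f\<close> a function of the path up to the visit.\<close>

lemma nn_integral_regeneration:
  assumes rec: "AE z in L i. \<exists>n. fst (z n) = j"
    and f [measurable]: "f \<in> borel_measurable path_space" and g [measurable]: "g \<in> borel_measurable path_space"
    and dep: "\<And>z z' n. first_visit j n z \<Longrightarrow> (\<And>k. k \<le> n \<Longrightarrow> z k = z' k) \<Longrightarrow> f z = f z'"
  shows "(\<integral>\<^sup>+ z. f z * g (next_cyc j z) \<partial>L i) = (\<integral>\<^sup>+ z. f z \<partial>L i) * (\<integral>\<^sup>+ z. g z \<partial>L j :: ennreal)"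
proof -
  let ?f = "\<lambda>n z. if first_visit j n z then f z else 0"
  have sum: "(\<Sum>n. if first_visit j n z then h n else 0) = h m" if "first_visit j m z" for h :: "nat \<Rightarrow> ennreal" and m z
  proof -
    have "(\<Sum>n. if first_visit j n z then h n else 0) = (\<Sum>n\<in>{m}. if first_visit j n z then h n else 0)"
      using that by (intro suminf_finite) (auto dest: first_visit_unique)
    then show ?thesis using that by simp
  qed
  have "(\<integral>\<^sup>+ z. f z * g (next_cyc j z) \<partial>L i) = (\<integral>\<^sup>+ z. (\<Sum>n. ?f n z * g (shift (Suc n) z)) \<partial>L i)"
  proof (rule nn_integral_cong_AE)
    show "AE z in L i. f z * g (next_cyc j z) = (\<Sum>n. ?f n z * g (shift (Suc n) z))"
      using rec
    proof eventually_elim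
      case (elim z)
      then obtain m where m: "first_visit j m z" using ex_first_visit by blast
      have "(\<Sum>n. ?f n z * g (shift (Suc n) z)) = (\<Sum>n. if first_visit j n z then f z * g (shift (Suc n) z) else 0)"
        by (intro suminf_cong) simp
      also have "\<dots> = f z * g (shift (Suc m) z)" by (rule sum[OF m])
      finally show ?case using m by (simp add: next_cyc_def first_visit_cyc_len)
    qed
  qed
  also have "\<dots> = (\<Sum>n. \<integral>\<^sup>+ z. ?f n z * g (shift (Suc n) z) \<partial>L i)"
    by (rule nn_integral_suminf) measurable
  also have "\<dots> = (\<Sum>n. (\<integral>\<^sup>+ z. ?f n z \<partial>L i) * (\<integral>\<^sup>+ z. g z \<partial>L j))"
  proof (intro suminf_cong markov_property)
    fix n and z z' :: "nat \<Rightarrow> 's \<times> real" assume *: "\<And>k. k < Suc n \<Longrightarrow> z k = z' k"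
    then have "first_visit j n z = first_visit j n z'" by (auto simp: first_visit_def)
    then show "?f n z = ?f n z'" using dep[of n z z'] * by simp
  next
    fix n z assume "?f n z \<noteq> 0"
    then show "state_at i (Suc n) z = j" by (auto simp: state_at_def first_visit_def split: if_splits)
  qed measurable
  also have "\<dots> = (\<Sum>n. \<integral>\<^sup>+ z. ?f n z \<partial>L i) * (\<integral>\<^sup>+ z. g z \<partial>L j)" by simp
  also have "(\<Sum>n. \<integral>\<^sup>+ z. ?f n z \<partial>L i) = (\<integral>\<^sup>+ z. (\<Sum>n. ?f n z) \<partial>L i)"
    by (rule nn_integral_suminf[symmetric]) measurable
  also have "\<dots> = (\<integral>\<^sup>+ z. f z \<partial>L i)"
  proof (rule nn_integral_cong_AE)
    show "AE z in L i. (\<Sum>n. ?f n z) = f z"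
      using rec
    proof eventually_elim
      case (elim z)
      then obtain m where "first_visit j m z" using ex_first_visit by blast
      from sum[OF this] show ?case .
    qed
  qed
  finally show ?thesis .
qed

lemma cycles_iid:
  assumes rec: "AE z in L i. \<exists>n. fst (z n) = i"
    and c [measurable]: "c \<in> path_space \<rightarrow>\<^sub>M E"
    and dep: "\<And>z z' n. first_visit i n z \<Longrightarrow> (\<And>k. k \<le> n \<Longrightarrow> z k = z' k) \<Longrightarrow> c z = c z'"
  shows "distr (L i) (PiM UNIV (\<lambda>_. E)) (\<lambda>z k. c ((next_cyc i ^^ k) z)) = PiM UNIV (\<lambda>_::nat. distr (L i) E c)"
proof (rule distr_iterate_eq_PiM[OF prob_space_L])
  interpret L: prob_space "L i" by (rule prob_space_L)
  interpret Q: prob_space "distr (L i) E c" by (rule L.prob_space_distr) measurable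
  show "distr (L i) (E \<Otimes>\<^sub>M L i) (\<lambda>z. (c z, next_cyc i z)) = distr (L i) E c \<Otimes>\<^sub>M L i"
  proof (rule pair_measure_eqI[symmetric])
    fix A B assume [measurable]: "A \<in> sets (distr (L i) E c)" "B \<in> sets (L i)"
    then have [measurable]: "A \<in> sets E" "B \<in> sets path_space" by auto
    have "emeasure (distr (L i) E c) A * emeasure (L i) B
       = (\<integral>\<^sup>+ z. indicator A (c z) \<partial>L i) * (\<integral>\<^sup>+ z. indicator B z \<partial>L i)"
    proof -
      have "emeasure (distr (L i) E c) A = (\<integral>\<^sup>+ e. indicator A e \<partial>distr (L i) E c)"
        by (rule nn_integral_indicator[symmetric]) simp
      also have "\<dots> = (\<integral>\<^sup>+ z. indicator A (c z) \<partial>L i)"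
        by (rule nn_integral_distr) measurable
      finally show ?thesis by simp
    qed
    also have "\<dots> = (\<integral>\<^sup>+ z. indicator A (c z) * indicator B (next_cyc i z) \<partial>L i)"
      by (rule nn_integral_regeneration[OF rec, symmetric]) (measurable, metis dep)
    also have "\<dots> = (\<integral>\<^sup>+ z. indicator (A \<times> B) (c z, next_cyc i z) \<partial>L i)"
      by (intro nn_integral_cong) (simp split: split_indicator)
    also have "\<dots> = (\<integral>\<^sup>+ y. indicator (A \<times> B) y \<partial>distr (L i) (E \<Otimes>\<^sub>M L i) (\<lambda>z. (c z, next_cyc i z)))"
      by (rule nn_integral_distr[symmetric]) measurable
    also have "\<dots> = emeasure (distr (L i) (E \<Otimes>\<^sub>M L i) (\<lambda>z. (c z, next_cyc i z))) (A \<times> B)"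
      by (rule nn_integral_indicator) simp
    finally show "emeasure (distr (L i) E c) A * emeasure (L i) B
       = emeasure (distr (L i) (E \<Otimes>\<^sub>M L i) (\<lambda>z. (c z, next_cyc i z))) (A \<times> B)" .
  next
    show "sigma_finite_measure (distr (L i) E c)" by unfold_locales
    show "sigma_finite_measure (L i)" by unfold_locales
  qed (auto cong: sets_pair_measure_cong)
qed measurable

definition psum :: "(nat \<Rightarrow> 's \<times> real) \<Rightarrow> nat \<Rightarrow> real" where
  "psum z n = (\<Sum>k<n. snd (z k))"

lemma measurable_psum [measurable]: "(\<lambda>z. psum z n) \<in> borel_measurable path_space"
  unfolding psum_def by measurable

lemma psum_0 [simp]: "psum z 0 = 0" by (simp add: psum_def)

lemma psum_add: "psum z (m + n) = psum z m + psum (shift m z) n"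
  by (induction n) (simp_all add: psum_def)

lemma Ssum_eq_psum: "Ssum X n \<omega> = psum (path \<omega>) n"
proof -
  have "(\<Sum>k\<in>{1..n}. X k \<omega>) = (\<Sum>k<n. X (Suc k) \<omega>)"
    by (rule sum.reindex_bij_witness[of _ Suc "\<lambda>k. k - 1"]) auto
  then show ?thesis by (simp add: Ssum_def psum_def path_def)
qed

text \<open>For \<open>s > 0\<close> the supremum is the \<open>s\<close>-th power of the first
  positive time in state \<open>i\<close>. It is measurable term by term and infinite if
  \<open>i\<close> is never visited, whereas \<open>cyc_len\<close> is then arbitrary.\<close>

definition hit_moment :: "'s \<Rightarrow> real \<Rightarrow> (nat \<Rightarrow> 's \<times> real) \<Rightarrow> ennreal" where
  "hit_moment i s z = (SUP n. if \<forall>k<n. fst (z k) \<noteq> i then ennreal ((real n + 1) powr s) else 0)"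

lemma measurable_hit_moment [measurable]: "hit_moment i s \<in> borel_measurable path_space"
  unfolding hit_moment_def[abs_def] by measurable

lemma SUP_powr_eq_top:
  assumes s: "0 < s" and f: "\<And>N :: nat. \<exists>n. ennreal (real N powr s) \<le> f n"
  shows "(SUP n. f n :: ennreal) = \<infinity>"
proof -
  have "\<exists>N::nat. real b \<le> real N powr s" for b :: nat
  proof -
    obtain N :: nat where N: "(real b + 1) powr (1 / s) \<le> real N" using real_arch_simple by blast
    have "real b + 1 = ((real b + 1) powr (1 / s)) powr s" using s by (simp add: powr_powr)
    also have "\<dots> \<le> real N powr s" using N s by (intro powr_mono2) auto
    finally show ?thesis by (intro exI[of _ N]) simp
  qed
  then have *: "\<exists>n. of_nat b \<le> f n" for b :: nat
    using f by (metis ennreal_leI ennreal_of_nat_eq_real_of_nat order_trans)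
  have "\<exists>n. x < f n" if x: "x < top" for x
  proof -
    obtain b :: nat where "x < of_nat b" using ennreal_Ex_less_of_nat[OF x] by blast
    with *[of b] show ?thesis by (meson less_le_trans)
  qed
  then show ?thesis by (simp add: SUP_eq_top_iff)
qed

lemma hit_moment_eq:
  assumes s: "0 < s"
  shows "hit_moment i s z = (if \<exists>n. fst (z n) = i then ennreal (real (cyc_len i z) powr s) else \<infinity>)"
proof (cases "\<exists>n. fst (z n) = i")
  case True
  then obtain m where m: "first_visit i m z" using ex_first_visit by blast
  then have len: "cyc_len i z = Suc m" by (rule first_visit_cyc_len)
  have "hit_moment i s z = ennreal ((real m + 1) powr s)"
    unfolding hit_moment_def
  proof (rule antisym)
    show "(SUP n. if \<forall>k<n. fst (z k) \<noteq> i then ennreal ((real n + 1) powr s) else 0) \<le> ennreal ((real m + 1) powr s)"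
    proof (intro SUP_least)
      fix n
      show "(if \<forall>k<n. fst (z k) \<noteq> i then ennreal ((real n + 1) powr s) else 0) \<le> ennreal ((real m + 1) powr s)"
      proof (cases "\<forall>k<n. fst (z k) \<noteq> i")
        case True
        then have "n \<le> m" using m by (auto simp: first_visit_def not_less[symmetric])
        then show ?thesis using s by (auto intro!: ennreal_leI powr_mono2)
      qed auto
    qed
    show "ennreal ((real m + 1) powr s) \<le> (SUP n. if \<forall>k<n. fst (z k) \<noteq> i then ennreal ((real n + 1) powr s) else 0)"
      by (rule SUP_upper2[of m]) (use m in \<open>auto simp: first_visit_def\<close>)
  qed
  then show ?thesis using True len by (simp add: add.commute)
next
  case False
  have "hit_moment i s z = \<infinity>"
    unfolding hit_moment_def
  proof (rule SUP_powr_eq_top[OF s])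
    fix N :: nat
    show "\<exists>n. ennreal (real N powr s) \<le> (if \<forall>k<n. fst (z k) \<noteq> i then ennreal ((real n + 1) powr s) else 0)"
      using False s by (intro exI[of _ N]) (auto intro!: ennreal_leI powr_mono2)
  qed
  then show ?thesis using False by simp
qed

lemma return_time_eq:
  "return_time M i \<omega> = (if \<exists>n. fst (path \<omega> n) = i then enat (cyc_len i (path \<omega>)) else \<infinity>)"
proof (cases "\<exists>n. fst (path \<omega> n) = i")
  case True
  then obtain m where m: "first_visit i m (path \<omega>)" using ex_first_visit by blast
  have "(LEAST n. 1 \<le> n \<and> M n \<omega> = i) = Suc m"
  proof (rule Least_equality)
    show "1 \<le> Suc m \<and> M (Suc m) \<omega> = i" using m by (simp add: first_visit_def path_def)
    fix n assume n: "1 \<le> n \<and> M n \<omega> = i"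
    then have "\<not> n - 1 < m" using m by (auto simp: first_visit_def path_def)
    then show "Suc m \<le> n" using conjunct1[OF n] by linarith
  qed
  moreover have "\<exists>n\<ge>1. M n \<omega> = i" using m by (intro exI[of _ "Suc m"]) (simp add: first_visit_def path_def)
  ultimately show ?thesis
    using True first_visit_cyc_len[OF m] by (simp add: return_time_def first_time_def)
next
  case False
  then have "\<forall>n\<ge>1. M n \<omega> \<noteq> i"
    unfolding path_def by (metis Suc_le_D One_nat_def fst_conv)
  then show ?thesis using False by (auto simp: return_time_def first_time_def)
qed

lemma epow_return_time: "0 < s \<Longrightarrow> epow (return_time M i \<omega>) s = hit_moment i s (path \<omega>)"
  by (auto simp: hit_moment_eq return_time_eq)

lemma AE_hit_of_moment:
  assumes s: "0 < s" and fin: "(\<integral>\<^sup>+ z. hit_moment i s z \<partial>L j) < \<infinity>"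
  shows "AE z in L j. \<exists>n. fst (z n) = i"
proof -
  have "AE z in L j. hit_moment i s z \<noteq> \<infinity>"
    using fin by (intro nn_integral_noteq_infinite) auto
  then show ?thesis by eventually_elim (auto simp: hit_moment_eq[OF s] split: if_splits)
qed

lemma hit_moment_shift_le:
  assumes s: "0 < s" and z: "\<forall>k<n. fst (z k) \<noteq> i"
  shows "hit_moment i s (shift n z) \<le> hit_moment i s z"
  unfolding hit_moment_def
proof (intro SUP_mono)
  fix m
  have "\<forall>k<n + m. fst (z k) \<noteq> i" if *: "\<forall>k<m. fst (z (n + k)) \<noteq> i"
  proof (intro allI impI)
    fix k assume k: "k < n + m"
    show "fst (z k) \<noteq> i"
    proof (cases "k < n")
      case False
      then have "z k = z (n + (k - n))" "k - n < m" using k by auto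
      then show ?thesis using * by metis
    qed (use z in auto)
  qed
  then show "\<exists>m'\<in>UNIV. (if \<forall>k<m. fst (shift n z k) \<noteq> i then ennreal ((real m + 1) powr s) else 0)
     \<le> (if \<forall>k<m'. fst (z k) \<noteq> i then ennreal ((real m' + 1) powr s) else 0)"
    using s by (intro bexI[of _ "n + m"]) (auto intro!: ennreal_leI powr_mono2)
qed

primrec tau :: "'s \<Rightarrow> nat \<Rightarrow> (nat \<Rightarrow> 's \<times> real) \<Rightarrow> nat" where
  "tau i 0 z = 0"
| "tau i (Suc k) z = tau i k z + cyc_len i (shift (tau i k z) z)"

lemma next_cyc_funpow: "(next_cyc i ^^ k) z = shift (tau i k z) z"
proof (induction k)
  case (Suc k)
  have "(next_cyc i ^^ Suc k) z = next_cyc i (shift (tau i k z) z)"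
    by (simp only: funpow.simps comp_apply Suc)
  also have "\<dots> = shift (tau i (Suc k) z) z" by (simp only: next_cyc_def shift_shift tau.simps)
  finally show ?case .
qed simp

lemma cyc_len_pos: "1 \<le> cyc_len i z" by (simp add: cyc_len_def)

lemma nn_integral_cyc_len_le:
  assumes s: "0 < s"
  shows "(\<integral>\<^sup>+ z. ennreal ((1 + real (cyc_len i z)) powr s) \<partial>L j)
    \<le> ennreal (2 powr s) * (\<integral>\<^sup>+ z. hit_moment i s z \<partial>L j)"
proof -
  have "(\<integral>\<^sup>+ z. ennreal ((1 + real (cyc_len i z)) powr s) \<partial>L j)
      \<le> (\<integral>\<^sup>+ z. ennreal (2 powr s) * hit_moment i s z \<partial>L j)"
  proof (rule nn_integral_mono)
    fix z
    have "(1 + real (cyc_len i z)) powr s \<le> (2 * real (cyc_len i z)) powr s"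
      using cyc_len_pos[of i z] s by (intro powr_mono2) auto
    also have "\<dots> = 2 powr s * real (cyc_len i z) powr s" by (intro powr_mult)
    finally have "ennreal ((1 + real (cyc_len i z)) powr s) \<le> ennreal (2 powr s) * ennreal (real (cyc_len i z) powr s)"
      by (simp add: ennreal_mult[symmetric] ennreal_leI)
    also have "\<dots> \<le> ennreal (2 powr s) * hit_moment i s z"
      by (intro mult_left_mono) (auto simp: hit_moment_eq[OF s])
    finally show "ennreal ((1 + real (cyc_len i z)) powr s) \<le> ennreal (2 powr s) * hit_moment i s z" .
  qed
  also have "\<dots> = ennreal (2 powr s) * (\<integral>\<^sup>+ z. hit_moment i s z \<partial>L j)"
    by (rule nn_integral_cmult) simp
  finally show ?thesis .
qed

lemma le_tau: "k \<le> tau i k z"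
proof (induction k)
  case (Suc k)
  then show ?case using cyc_len_pos[of i "shift (tau i k z) z"] by simp
qed simp

lemma tau_cover:
  assumes "1 \<le> n"
  obtains k where "tau i k z < n" "n \<le> tau i (Suc k) z"
proof -
  let ?m = "LEAST k. n \<le> tau i k z"
  have "n \<le> tau i n z" by (rule le_tau)
  then have m: "n \<le> tau i ?m z" by (rule LeastI)
  then have "?m \<noteq> 0" using assms by (metis le_zero_eq not_one_le_zero tau.simps(1))
  then obtain k where k: "?m = Suc k" using not0_implies_Suc by blast
  then have "\<not> n \<le> tau i k z" using not_less_Least[of k "\<lambda>k. n \<le> tau i k z"] by simp
  then show ?thesis using that[of k] m k by simp
qed

lemma
  assumes rec: "AE z in L i. \<exists>n. fst (z n) = i"
    and c [measurable]: "c \<in> path_space \<rightarrow>\<^sub>M E"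
    and dep: "\<And>z z' n. first_visit i n z \<Longrightarrow> (\<And>k. k \<le> n \<Longrightarrow> z k = z' k) \<Longrightarrow> c z = c z'"
  shows nn_integral_cycles: "f \<in> borel_measurable (PiM UNIV (\<lambda>_::nat. distr (L i) E c)) \<Longrightarrow>
      (\<integral>\<^sup>+ x. f x \<partial>PiM UNIV (\<lambda>_::nat. distr (L i) E c)) = (\<integral>\<^sup>+ z. f (\<lambda>k. c (shift (tau i k z) z)) \<partial>L i)"
    and AE_cycles: "Measurable.pred (PiM UNIV (\<lambda>_::nat. distr (L i) E c)) Q' \<Longrightarrow>
      (AE x in PiM UNIV (\<lambda>_::nat. distr (L i) E c). Q' x) \<longleftrightarrow> (AE z in L i. Q' (\<lambda>k. c (shift (tau i k z) z)))"
proof -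
  have "(next_cyc i ^^ k) \<in> path_space \<rightarrow>\<^sub>M path_space" for k by (induction k) auto
  then have "(\<lambda>z. c ((next_cyc i ^^ k) z)) \<in> L i \<rightarrow>\<^sub>M E" for k
    by (intro measurable_compose[OF _ c]) simp
  then have m: "(\<lambda>z k. c ((next_cyc i ^^ k) z)) \<in> L i \<rightarrow>\<^sub>M PiM UNIV (\<lambda>_. E)"
    by (rule measurable_abs_UNIV)
  have "distr (L i) (PiM UNIV (\<lambda>_. E)) (\<lambda>z k. c ((next_cyc i ^^ k) z)) = PiM UNIV (\<lambda>_::nat. distr (L i) E c)"
    using rec c dep by (rule cycles_iid)
  then have law: "PiM UNIV (\<lambda>_::nat. distr (L i) E c) = distr (L i) (PiM UNIV (\<lambda>_. E)) (\<lambda>z k. c (shift (tau i k z) z))"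
    by (simp only: next_cyc_funpow)
  have m: "(\<lambda>z k. c (shift (tau i k z) z)) \<in> L i \<rightarrow>\<^sub>M PiM UNIV (\<lambda>_. E)"
    using m by (simp only: next_cyc_funpow)
  show "(\<integral>\<^sup>+ x. f x \<partial>PiM UNIV (\<lambda>_::nat. distr (L i) E c)) = (\<integral>\<^sup>+ z. f (\<lambda>k. c (shift (tau i k z) z)) \<partial>L i)"
    if "f \<in> borel_measurable (PiM UNIV (\<lambda>_::nat. distr (L i) E c))"
    using that unfolding law by (rule nn_integral_distr[OF m])
  show "(AE x in PiM UNIV (\<lambda>_::nat. distr (L i) E c). Q' x) \<longleftrightarrow> (AE z in L i. Q' (\<lambda>k. c (shift (tau i k z) z)))"
    if "Measurable.pred (PiM UNIV (\<lambda>_::nat. distr (L i) E c)) Q'"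
    using that unfolding law by (subst AE_distr_iff[OF m]) (simp_all add: pred_def)
qed

section \<open>Return time moments at different states\<close>

lemma AE_next_cyc:
  assumes rec: "AE z in L i. \<exists>n. fst (z n) = i"
    and Q [measurable]: "Measurable.pred path_space Q'" and ae: "AE z in L i. Q' z"
  shows "AE z in L i. Q' (next_cyc i z)"
proof -
  have "(\<integral>\<^sup>+ z. 1 * (if Q' (next_cyc i z) then 0 else 1) \<partial>L i)
      = (\<integral>\<^sup>+ z. 1 \<partial>L i) * (\<integral>\<^sup>+ z. (if Q' z then 0 else 1) \<partial>L i)"
    by (rule nn_integral_regeneration[OF rec]) auto
  also have "(\<integral>\<^sup>+ z. (if Q' z then 0 else 1) \<partial>L i) = 0"
    using ae by (subst nn_integral_0_iff_AE) auto
  finally have "(\<integral>\<^sup>+ z. (if Q' (next_cyc i z) then 0 else 1) \<partial>L i) = 0" by simp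
  then show ?thesis
    by (subst (asm) nn_integral_0_iff_AE) (auto split: if_splits elim: eventually_mono)
qed

lemma cyc_len_le_add:
  assumes "fst (next_cyc i z n) = j"
  shows "cyc_len j z \<le> cyc_len i z + cyc_len j (next_cyc i z)" "\<exists>n. fst (z n) = j"
proof -
  have "fst (next_cyc i z (LEAST n. fst (next_cyc i z n) = j)) = j" using assms by (rule LeastI)
  then have v: "fst (z (cyc_len i z + (LEAST n. fst (next_cyc i z n) = j))) = j"
    by (simp add: next_cyc_def)
  then show "cyc_len j z \<le> cyc_len i z + cyc_len j (next_cyc i z)"
    unfolding cyc_len_def[of j] by (simp add: Least_le)
  show "\<exists>n. fst (z n) = j" using v by blast
qed

text \<open>If the first cycle almost surely missed \<open>j\<close>, then so would every cycle, as
  all have the same law, and \<open>j\<close> would never be reached. That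
  \<open>i \<noteq> j\<close> excludes a visit at time 0.\<close>

lemma visit_before_return_pos:
  assumes ij: "i \<noteq> j" and rec: "AE z in L i. \<exists>n. fst (z n) = i"
    and irr: "measure (P i) {\<omega> \<in> space (P i). \<exists>n. M n \<omega> = j} > 0"
  shows "\<not> (AE z in L i. \<forall>n<cyc_len i z. fst (z n) \<noteq> j)"
proof
  let ?Q = "\<lambda>z. \<forall>n<cyc_len i z. fst (z n) \<noteq> j"
  assume "AE z in L i. ?Q z"
  have nm: "(next_cyc i ^^ k) \<in> path_space \<rightarrow>\<^sub>M path_space" for k by (induction k) auto
  have Qm: "Measurable.pred path_space ?Q" by measurable
  have "AE z in L i. ?Q ((next_cyc i ^^ k) z)" for k
  proof (induction k)
    case (Suc k)
    from AE_next_cyc[OF rec measurable_compose[OF nm Qm] this] show ?case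
      by (simp only: funpow_Suc_right comp_apply)
  qed (use \<open>AE z in L i. ?Q z\<close> in simp)
  then have "AE z in L i. \<forall>k. ?Q ((next_cyc i ^^ k) z)" by (subst AE_all_countable) blast
  then have "AE z in L i. \<forall>n. fst (z n) \<noteq> j"
  proof eventually_elim
    case (elim z)
    show ?case
    proof
      fix n
      obtain k where k: "tau i k z < Suc n" "Suc n \<le> tau i (Suc k) z" using tau_cover[of "Suc n" i z] by auto
      have "?Q (shift (tau i k z) z)" using elim unfolding next_cyc_funpow by blast
      moreover have "n - tau i k z < cyc_len i (shift (tau i k z) z)" using k by simp
      moreover have "z n = shift (tau i k z) z (n - tau i k z)" using k by simp
      ultimately show "fst (z n) \<noteq> j" by metis
    qed
  qed
  then have "AE \<omega> in P i. \<forall>n. fst (path \<omega> n) \<noteq> j" by (subst (asm) AE_L) auto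
  then have "AE \<omega> in P i. \<not> (\<exists>n. M n \<omega> = j)"
    using AE_M_0[of i]
  proof eventually_elim
    case (elim \<omega>)
    have "M n \<omega> \<noteq> j" for n using elim ij by (cases n) (auto simp: path_def)
    then show ?case by simp
  qed
  then have "measure (P i) {\<omega> \<in> space (P i). \<exists>n. M n \<omega> = j} = 0"
    by (subst prob_space.prob_Collect_eq_0[OF prob_space_P]) auto
  then show False using irr by simp
qed

text \<open>With \<open>q < 1\<close> the probability of missing \<open>j\<close> in a cycle, the truncated moments \<open>x\<close> satisfy
  \<open>x \<le> C + c q x\<close>, where \<open>c > 1\<close> can be chosen as close to 1 as desired.\<close>

lemma hit_moment_other_finite:
  assumes s: "0 < s" and ij: "i \<noteq> j"
    and irr: "measure (P i) {\<omega> \<in> space (P i). \<exists>n. M n \<omega> = j} > 0"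
    and fin: "(\<integral>\<^sup>+ z. hit_moment i s z \<partial>L i) < \<infinity>"
  shows "(\<integral>\<^sup>+ z. hit_moment j s z \<partial>L i) < \<infinity>"
proof -
  interpret L: prob_space "L i" by (rule prob_space_L)
  have rec: "AE z in L i. \<exists>n. fst (z n) = i" by (rule AE_hit_of_moment[OF s fin])
  define f where "f z = (if \<forall>n<cyc_len i z. fst (z n) \<noteq> j then 1 else 0 :: ennreal)" for z
  have fm [measurable]: "f \<in> borel_measurable path_space" unfolding f_def[abs_def] by measurable
  have "(\<integral>\<^sup>+ z. f z \<partial>L i) < 1"
  proof (rule ccontr)
    have "(\<integral>\<^sup>+ z. f z \<partial>L i) \<le> (\<integral>\<^sup>+ z. 1 \<partial>L i)" by (intro nn_integral_mono) (simp add: f_def)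
    then have le: "(\<integral>\<^sup>+ z. f z \<partial>L i) \<le> 1" by (simp add: L.emeasure_space_1[simplified])
    assume "\<not> (\<integral>\<^sup>+ z. f z \<partial>L i) < 1"
    with le have "(\<integral>\<^sup>+ z. f z \<partial>L i) = 1" by simp
    moreover have sum: "f z + (1 - f z) = 1" for z by (simp add: f_def)
    have "(\<integral>\<^sup>+ z. f z \<partial>L i) + (\<integral>\<^sup>+ z. 1 - f z \<partial>L i) = (\<integral>\<^sup>+ z. f z + (1 - f z) \<partial>L i)"
      by (rule nn_integral_add[symmetric]) auto
    then have "(\<integral>\<^sup>+ z. f z \<partial>L i) + (\<integral>\<^sup>+ z. 1 - f z \<partial>L i) = (\<integral>\<^sup>+ z. 1 \<partial>L i)"
      by (simp only: sum)
    ultimately have "(\<integral>\<^sup>+ z. 1 - f z \<partial>L i) = 0"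
      by (simp add: L.emeasure_space_1[simplified])
    then have "AE z in L i. 1 - f z = 0" by (subst (asm) nn_integral_0_iff_AE) auto
    then have "AE z in L i. \<forall>n<cyc_len i z. fst (z n) \<noteq> j"
      by eventually_elim (auto simp: f_def split: if_splits)
    then show False using visit_before_return_pos[OF ij rec irr] by simp
  qed
  then obtain r where r: "(\<integral>\<^sup>+ z. f z \<partial>L i) = ennreal r" "0 \<le> r" "r < 1"
    by (cases "\<integral>\<^sup>+ z. f z \<partial>L i") (auto simp: ennreal_less_one_iff top_unique)
  let ?m = "max (s - 1) 0"
  \<comment> \<open>For large \<open>k\<close> the first factor of
    \<open>powr_add_le_weighted\<close> is so close to 1 that its product with \<open>r\<close>
    remains below 1.\<close>
  have "(\<lambda>k. (1 + inverse (real k)) powr ?m * r) \<longlonglongrightarrow> (1 + 0) powr ?m * r"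
    by (intro tendsto_intros LIMSEQ_inverse_real_of_nat lim_inverse_n) auto
  then have "eventually (\<lambda>k. (1 + inverse (real k)) powr ?m * r < 1) sequentially"
    using r by (intro order_tendstoD(2)) auto
  then obtain k where k: "1 \<le> k" "(1 + inverse (real k)) powr ?m * r < 1"
    unfolding eventually_sequentially by (meson max.cobounded1 max.cobounded2)
  define c1 where "c1 = ((real k + 1) / real k) powr ?m"
  define c2 where "c2 = (real k + 1) powr ?m"
  have c: "1 \<le> c1" "1 \<le> c2" "c1 * r < 1"
    using k by (auto simp: c1_def c2_def add_divide_distrib inverse_eq_divide intro!: ge_one_powr_ge_zero)
  let ?A = "\<integral>\<^sup>+ z. hit_moment i s z \<partial>L i"
  obtain A where A: "?A = ennreal A" "0 \<le> A" using fin by (cases ?A) auto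
  \<comment> \<open>Truncation makes the integral finite a priori, so that it can be absorbed into
    the left-hand side.\<close>
  define h where "h N z = min (hit_moment j s z) (ennreal (real N))" for N :: nat and z
  have hm [measurable]: "h N \<in> borel_measurable path_space" for N unfolding h_def[abs_def] by measurable
  have bound: "(\<integral>\<^sup>+ z. h N z \<partial>L i) \<le> ennreal (c2 * A / (1 - c1 * r))" for N
  proof -
    have "AE z in L i. h N z \<le> ennreal c2 * hit_moment i s z + ennreal c1 * (f z * h N (next_cyc i z))"
      using rec
    proof eventually_elim
      case (elim z)
      have i: "hit_moment i s z = ennreal (real (cyc_len i z) powr s)" using elim by (simp add: hit_moment_eq[OF s])
      show ?case
      \<comment> \<open>If \<open>j\<close> occurs in the first cycle, the cycle length bounds the
        hitting time. Otherwise the hitting time is at most the cycle length plus the hitting time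
        of the remaining path; if the latter is truncated, the bound holds because
        \<open>1 \<le> c1\<close>.\<close>
      proof (cases "\<exists>n<cyc_len i z. fst (z n) = j")
        case True
        then obtain n where n: "n < cyc_len i z" "fst (z n) = j" by blast
        then have "cyc_len j z \<le> cyc_len i z" 
          using Least_le[of "\<lambda>n. fst (z n) = j" n] by (simp add: cyc_len_def[of j])
        then have "real (cyc_len j z) powr s \<le> 1 * real (cyc_len i z) powr s" using s by (simp add: powr_mono2)
        also have "\<dots> \<le> c2 * real (cyc_len i z) powr s" using c by (intro mult_right_mono) auto
        finally have "hit_moment j s z \<le> ennreal c2 * hit_moment i s z"
          using n i c by (auto simp: hit_moment_eq[OF s, of j] ennreal_mult[symmetric] intro!: ennreal_leI)
        then have "h N z \<le> ennreal c2 * hit_moment i s z" unfolding h_def by (rule min.coboundedI1)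
        then show ?thesis by (rule order_trans) simp
      next
        case False
        then have f: "f z = 1" by (simp add: f_def)
        show ?thesis
        proof (cases "hit_moment j s (next_cyc i z) \<le> ennreal (real N)")
          case True
          then obtain n where n: "fst (next_cyc i z n) = j"
            by (auto simp: hit_moment_eq[OF s] top_unique split: if_splits)
          have "real (cyc_len j z) powr s \<le> (real (cyc_len j (next_cyc i z)) + real (cyc_len i z)) powr s"
            using cyc_len_le_add(1)[OF n] s by (intro powr_mono2) auto
          also have "\<dots> \<le> c1 * real (cyc_len j (next_cyc i z)) powr s + c2 * real (cyc_len i z) powr s"
            unfolding c1_def c2_def using s k by (intro powr_add_le_weighted) auto
          finally have "ennreal (real (cyc_len j z) powr s)
              \<le> ennreal c1 * ennreal (real (cyc_len j (next_cyc i z)) powr s) + ennreal c2 * ennreal (real (cyc_len i z) powr s)"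
            using c by (simp add: ennreal_mult[symmetric] ennreal_plus[symmetric] ennreal_leI del: ennreal_plus)
          moreover have "hit_moment j s z = ennreal (real (cyc_len j z) powr s)"
            "hit_moment j s (next_cyc i z) = ennreal (real (cyc_len j (next_cyc i z)) powr s)"
            using n cyc_len_le_add(2)[OF n] by (auto simp: hit_moment_eq[OF s])
          ultimately have "hit_moment j s z \<le> ennreal c2 * hit_moment i s z + ennreal c1 * hit_moment j s (next_cyc i z)"
            by (simp only: i add.commute)
          then show ?thesis unfolding h_def f using True by (simp add: min.absorb1 min.coboundedI1)
        next
          case False
          then have "h N (next_cyc i z) = ennreal (real N)" by (simp add: h_def)
          moreover have "ennreal (real N) \<le> ennreal c1 * ennreal (real N)"
            using c by (simp add: ennreal_mult[symmetric] mult_le_cancel_right1 ennreal_leI)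
          ultimately have "h N z \<le> ennreal c1 * (f z * h N (next_cyc i z))"
            unfolding f by (simp add: h_def min.coboundedI2)
          then show ?thesis by (rule order_trans) simp
        qed
      qed
    qed
    then have "(\<integral>\<^sup>+ z. h N z \<partial>L i)
        \<le> (\<integral>\<^sup>+ z. ennreal c2 * hit_moment i s z + ennreal c1 * (f z * h N (next_cyc i z)) \<partial>L i)"
      by (rule nn_integral_mono_AE)
    also have "\<dots> = ennreal c2 * ?A + ennreal c1 * (\<integral>\<^sup>+ z. f z * h N (next_cyc i z) \<partial>L i)"
      by (simp add: nn_integral_add nn_integral_cmult)
    also have "(\<integral>\<^sup>+ z. f z * h N (next_cyc i z) \<partial>L i) = (\<integral>\<^sup>+ z. f z \<partial>L i) * (\<integral>\<^sup>+ z. h N z \<partial>L i)"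
    proof (rule nn_integral_regeneration[OF rec fm hm])
      fix z z' n assume v: "first_visit i n z" and eq: "\<And>k. k \<le> n \<Longrightarrow> z k = z' k"
      then have "first_visit i n z'" by (auto simp: first_visit_def)
      with v have "cyc_len i z = Suc n" "cyc_len i z' = Suc n" by (auto dest: first_visit_cyc_len)
      then show "f z = f z'" using eq by (auto simp: f_def less_Suc_eq_le)
    qed
    finally have le: "(\<integral>\<^sup>+ z. h N z \<partial>L i) \<le> ennreal c2 * ennreal A + ennreal c1 * (ennreal r * (\<integral>\<^sup>+ z. h N z \<partial>L i))"
      by (simp only: A r)
    have "(\<integral>\<^sup>+ z. h N z \<partial>L i) \<le> (\<integral>\<^sup>+ z. ennreal (real N) \<partial>L i)" by (intro nn_integral_mono) (simp add: h_def)
    also have "\<dots> < \<infinity>" by (simp add: L.emeasure_space_1[simplified])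
    finally obtain x where x: "(\<integral>\<^sup>+ z. h N z \<partial>L i) = ennreal x" "0 \<le> x"
      by (cases "\<integral>\<^sup>+ z. h N z \<partial>L i") auto
    have "x \<le> c2 * A + c1 * (r * x)"
      using le c A r x by (simp add: ennreal_mult[symmetric] ennreal_plus[symmetric] del: ennreal_plus)
    then have "x \<le> c2 * A / (1 - c1 * r)" using c by (simp add: pos_le_divide_eq algebra_simps)
    then show ?thesis by (simp add: x ennreal_leI)
  qed
  have hs: "hit_moment j s z = (SUP N. h N z)" for z
  proof -
    have top: "(SUP N. ennreal (real N)) = \<top>"
      using ennreal_SUP_of_nat_eq_top by (simp only: ennreal_of_nat_eq_real_of_nat)
    have "(SUP N. h N z) = inf (hit_moment j s z) (SUP N. ennreal (real N))"
      by (simp only: h_def inf_min[symmetric] inf_SUP[symmetric])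
    then show ?thesis by (simp only: top inf_top_right)
  qed
  have "(\<integral>\<^sup>+ z. hit_moment j s z \<partial>L i) = (\<integral>\<^sup>+ z. (SUP N. h N z) \<partial>L i)"
    by (intro nn_integral_cong) (rule hs)
  also have "\<dots> = (SUP N. \<integral>\<^sup>+ z. h N z \<partial>L i)"
  proof (rule nn_integral_monotone_convergence_SUP)
    show "incseq h"
      unfolding incseq_def le_fun_def h_def by (intro allI impI min.mono ennreal_leI) auto
  qed measurable
  also have "\<dots> \<le> ennreal (c2 * A / (1 - c1 * r))" by (intro SUP_least bound)
  also have "\<dots> < \<infinity>" by simp
  finally show ?thesis .
qed

text \<open>Provides an event at a fixed time, which is the form that \<open>markov_property\<close>
  needs.\<close>

lemma visit_avoiding_pos:
  assumes ij: "i \<noteq> j" and rec: "AE z in L i. \<exists>n. fst (z n) = i"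
    and irr: "measure (P i) {\<omega> \<in> space (P i). \<exists>n. M n \<omega> = j} > 0"
  shows "\<exists>n. emeasure (L i) {z. fst (z n) = j \<and> (\<forall>k\<le>n. fst (z k) \<noteq> i)} > 0"
proof (rule ccontr)
  let ?A = "\<lambda>n. {z \<in> space path_space. fst (z n) = j \<and> (\<forall>k\<le>n. fst (z k) \<noteq> i)}"
  assume "\<not> ?thesis"
  then have "emeasure (L i) (?A n) = 0" for n by simp
  moreover have "?A n \<in> sets (L i)" for n unfolding sets_L by measurable
  ultimately have "?A n \<in> null_sets (L i)" for n by (auto simp: null_sets_def)
  then have "AE z in L i. z \<notin> ?A n" for n by (rule AE_not_in)
  then have "AE z in L i. \<forall>n. z \<notin> ?A n" by (subst AE_all_countable) blast
  then have "AE z in L i. \<forall>n<cyc_len i z. fst (z n) \<noteq> j"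
    using rec
  proof eventually_elim
    case (elim z)
    show ?case
    proof (intro allI impI notI)
      fix n assume n: "n < cyc_len i z" and j: "fst (z n) = j"
      obtain m where m: "first_visit i m z" using elim ex_first_visit by blast
      then have "n \<le> m" using n first_visit_cyc_len by fastforce
      moreover have "n \<noteq> m" using j m ij by (auto simp: first_visit_def)
      ultimately have "\<forall>k\<le>n. fst (z k) \<noteq> i" using m by (auto simp: first_visit_def)
      then show False using elim(1) j by auto
    qed
  qed
  then show False using visit_before_return_pos[OF ij rec irr] by simp
qed

text \<open>On the event that the path from \<open>i\<close> is at \<open>j\<close> before
  returning, the remaining time to \<open>i\<close> is part of a return time to \<open>i\<close>;
  hence hitting \<open>i\<close> from \<open>j\<close> has a finite moment. A return to
  \<open>j\<close> takes at most the way to \<open>i\<close> and from there to \<open>j\<close>, the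
  latter being \<open>hit_moment_other_finite\<close>.\<close>

lemma hit_moment_solidarity:
  assumes s: "0 < s"
    and irr: "\<And>j. measure (P i) {\<omega> \<in> space (P i). \<exists>n. M n \<omega> = j} > 0"
    and fin: "(\<integral>\<^sup>+ z. hit_moment i s z \<partial>L i) < \<infinity>"
  shows "(\<integral>\<^sup>+ z. hit_moment j s z \<partial>L j) < \<infinity>"
proof (cases "i = j")
  case False
  note ij = hit_moment_other_finite[OF s False irr fin]
  obtain n where n: "emeasure (L i) {z. fst (z n) = j \<and> (\<forall>k\<le>n. fst (z k) \<noteq> i)} > 0"
    using visit_avoiding_pos[OF False AE_hit_of_moment[OF s fin] irr] by blast
  define f where "f z = (if fst (z n) = j \<and> (\<forall>k\<le>n. fst (z k) \<noteq> i) then 1 else 0 :: ennreal)" for z :: "nat \<Rightarrow> 's \<times> real"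
  have [measurable]: "f \<in> borel_measurable path_space" unfolding f_def[abs_def] by measurable
  have A: "{z. fst (z n) = j \<and> (\<forall>k\<le>n. fst (z k) \<noteq> i)} \<in> sets (L i)"
  proof -
    have "{z \<in> space path_space. fst (z n) = j \<and> (\<forall>k\<le>n. fst (z k) \<noteq> i)} \<in> sets path_space"
      by measurable
    then show ?thesis by simp
  qed
  have "(\<integral>\<^sup>+ z. f z \<partial>L i) = (\<integral>\<^sup>+ z. indicator {z. fst (z n) = j \<and> (\<forall>k\<le>n. fst (z k) \<noteq> i)} z \<partial>L i)"
    by (intro nn_integral_cong) (simp add: f_def split: split_indicator)
  also have "\<dots> > 0" using n by (simp only: nn_integral_indicator[OF A])
  finally have f: "(\<integral>\<^sup>+ z. f z \<partial>L i) > 0" .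
  have "(\<integral>\<^sup>+ z. f z \<partial>L i) * (\<integral>\<^sup>+ z. hit_moment i s z \<partial>L j)
      = (\<integral>\<^sup>+ z. f z * hit_moment i s (shift (Suc n) z) \<partial>L i)"
  proof (rule markov_property[symmetric])
    show "f z = f z'" if "\<And>k. k < Suc n \<Longrightarrow> z k = z' k" for z z'
      using that by (simp add: f_def less_Suc_eq_le)
    show "state_at i (Suc n) z = j" if "f z \<noteq> 0" for z
      using that by (simp add: f_def state_at_def split: if_splits)
  qed measurable
  also have "\<dots> \<le> (\<integral>\<^sup>+ z. hit_moment i s z \<partial>L i)"
  proof (rule nn_integral_mono)
    fix z
    show "f z * hit_moment i s (shift (Suc n) z) \<le> hit_moment i s z"
      using hit_moment_shift_le[OF s, of "Suc n" z i] by (auto simp: f_def less_Suc_eq_le)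
  qed
  also have "\<dots> < \<infinity>" by (rule fin)
  finally have ji: "(\<integral>\<^sup>+ z. hit_moment i s z \<partial>L j) < \<infinity>"
    using f by (auto simp: ennreal_mult_less_top)
  have rec: "AE z in L j. \<exists>n. fst (z n) = i" by (rule AE_hit_of_moment[OF s ji])
  interpret L: prob_space "L j" by (rule prob_space_L)
  have "(\<integral>\<^sup>+ z. hit_moment j s z \<partial>L j)
      \<le> (\<integral>\<^sup>+ z. ennreal (2 powr s) * (hit_moment i s z + 1 * hit_moment j s (next_cyc i z)) \<partial>L j)"
    using rec
  proof (intro nn_integral_mono_AE, elim eventually_mono)
    fix z :: "nat \<Rightarrow> 's \<times> real" assume "\<exists>n. fst (z n) = i"
    show "hit_moment j s z \<le> ennreal (2 powr s) * (hit_moment i s z + 1 * hit_moment j s (next_cyc i z))"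
    proof (cases "\<exists>n. fst (next_cyc i z n) = j")
      case True
      then obtain n where n: "fst (next_cyc i z n) = j" by blast
      note cyc_len_le_add(1)[OF n]
      then have "real (cyc_len j z) powr s \<le> (real (cyc_len i z) + real (cyc_len j (next_cyc i z))) powr s"
        using s by (intro powr_mono2) auto
      also have "\<dots> \<le> 2 powr s * (real (cyc_len i z) powr s + real (cyc_len j (next_cyc i z)) powr s)"
        using s by (intro powr_add_le_two_powr) auto
      finally have "ennreal (real (cyc_len j z) powr s)
          \<le> ennreal (2 powr s) * (ennreal (real (cyc_len i z) powr s) + ennreal (real (cyc_len j (next_cyc i z)) powr s))"
        by (simp add: ennreal_mult[symmetric] ennreal_plus[symmetric] ennreal_leI del: ennreal_plus)
      then show ?thesis using cyc_len_le_add(2)[OF n] n \<open>\<exists>n. fst (z n) = i\<close> by (auto simp: hit_moment_eq[OF s])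
    qed (simp add: hit_moment_eq[OF s] ennreal_mult_top)
  qed
  also have "\<dots> = ennreal (2 powr s) * ((\<integral>\<^sup>+ z. hit_moment i s z \<partial>L j)
      + (\<integral>\<^sup>+ z. 1 * hit_moment j s (next_cyc i z) \<partial>L j))"
    by (simp add: nn_integral_cmult nn_integral_add)
  also have "(\<integral>\<^sup>+ z. 1 * hit_moment j s (next_cyc i z) \<partial>L j) = (\<integral>\<^sup>+ z. 1 \<partial>L j) * (\<integral>\<^sup>+ z. hit_moment j s z \<partial>L i)"
    by (rule nn_integral_regeneration[OF rec]) auto
  also have "ennreal (2 powr s) * ((\<integral>\<^sup>+ z. hit_moment i s z \<partial>L j)
      + (\<integral>\<^sup>+ z. 1 \<partial>L j) * (\<integral>\<^sup>+ z. hit_moment j s z \<partial>L i)) < \<infinity>"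
    using ji ij by (simp add: ennreal_mult_less_top L.emeasure_space_1[simplified])
  finally show ?thesis .
qed (use fin in simp)

end

section \<open>Fluctuation theory of divergent Markov random walks\<close>

locale mrw_divergent = mrw P M X p K
  for P :: "'s::countable \<Rightarrow> 'w measure" and M X p K +
  assumes irr: "irreducible_chain P M"
    and posrec: "positive_recurrent P M"
    and div: "positive_divergent P X"
begin

lemma AE_return: "AE z in L i. \<exists>n. fst (z n) = i"
proof (rule AE_hit_of_moment[of 1])
  have "(\<integral>\<^sup>+ z. hit_moment i 1 z \<partial>L i) = (\<integral>\<^sup>+ \<omega>. epow (return_time M i \<omega>) 1 \<partial>P i)"
    by (subst nn_integral_L) (simp_all add: epow_return_time)
  then show "(\<integral>\<^sup>+ z. hit_moment i 1 z \<partial>L i) < \<infinity>"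
    using posrec by (simp add: positive_recurrent_def)
qed simp

lemma measurable_psum_at_top [measurable]:
  "Measurable.pred path_space (\<lambda>z. filterlim (psum z) at_top sequentially)"
  unfolding filterlim_at_top_nat_iff by measurable

lemma AE_psum_at_top: "AE z in L i. filterlim (psum z) at_top sequentially"
proof -
  have "AE \<omega> in P i. filterlim (psum (path \<omega>)) at_top sequentially"
    using div by (simp add: positive_divergent_def Ssum_eq_psum)
  then show ?thesis by (simp only: AE_L[OF measurable_psum_at_top])
qed

lemma AE_path_at_top: "AE \<omega> in P i. filterlim (psum (path \<omega>)) at_top sequentially"
  using AE_psum_at_top by (simp only: AE_L[OF measurable_psum_at_top])

lemma irr_measure: "measure (P i) {\<omega> \<in> space (P i). \<exists>n. M n \<omega> = j} > 0"
  using irr by (simp add: irreducible_chain_def)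

text \<open>On divergent paths and for \<open>x \<ge> 0\<close> this is the \<open>a\<close>-th
  power of the last exit time; as a supremum it is visibly measurable.\<close>

definition exit_moment :: "real \<Rightarrow> real \<Rightarrow> (nat \<Rightarrow> 's \<times> real) \<Rightarrow> ennreal" where
  "exit_moment a x z = (SUP n. if psum z n \<le> x then ennreal (real n powr a) else 0)"

lemma measurable_exit_moment [measurable]: "exit_moment a x \<in> borel_measurable path_space"
  unfolding exit_moment_def[abs_def] by measurable

lemma finite_psum_le:
  assumes "filterlim (psum z) at_top sequentially"
  shows "finite {n. psum z n \<le> x}"
proof -
  have "eventually (\<lambda>n. x < psum z n) sequentially" using assms by (simp add: filterlim_at_top_dense)
  then obtain N where "\<And>n. n \<ge> N \<Longrightarrow> x < psum z n" by (auto simp: eventually_sequentially)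
  then have "{n. psum z n \<le> x} \<subseteq> {..<N}" by (auto simp: not_le[symmetric])
  then show ?thesis by (rule finite_subset) simp
qed

lemma epow_rho:
  assumes a: "0 < a" and x: "0 \<le> x" and lim: "filterlim (psum (path \<omega>)) at_top sequentially"
  shows "epow (rho X x \<omega>) a = exit_moment a x (path \<omega>)"
proof -
  let ?S = "{n. psum (path \<omega>) n \<le> x}"
  have fin: "finite ?S" by (rule finite_psum_le[OF lim])
  have "0 \<in> ?S" using x by simp
  then have m: "Max ?S \<in> ?S" using Max_in[OF fin] by blast
  have "exit_moment a x (path \<omega>) = ennreal (real (Max ?S) powr a)"
    unfolding exit_moment_def
  proof (rule antisym)
    show "(SUP n. if psum (path \<omega>) n \<le> x then ennreal (real n powr a) else 0) \<le> ennreal (real (Max ?S) powr a)"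
      using fin a by (intro SUP_least) (auto intro!: ennreal_leI powr_mono2)
    show "ennreal (real (Max ?S) powr a) \<le> (SUP n. if psum (path \<omega>) n \<le> x then ennreal (real n powr a) else 0)"
      by (rule SUP_upper2[of "Max ?S"]) (use m in auto)
  qed
  then show ?thesis using fin by (simp add: rho_def Ssum_eq_psum)
qed

lemma condB_iff:
  assumes "0 < a" "0 \<le> x"
  shows "condB P X a i x \<longleftrightarrow> (\<integral>\<^sup>+ z. exit_moment a x z \<partial>L i) < \<infinity>"
proof -
  have "AE \<omega> in P i. filterlim (psum (path \<omega>)) at_top sequentially"
    by (rule AE_path_at_top)
  then have "(\<integral>\<^sup>+ \<omega>. epow (rho X x \<omega>) a \<partial>P i) = (\<integral>\<^sup>+ \<omega>. exit_moment a x (path \<omega>) \<partial>P i)"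
    by (intro nn_integral_cong_AE) (auto elim!: eventually_mono simp: epow_rho assms)
  then show ?thesis by (simp add: condB_def nn_integral_L)
qed

lemma exit_moment_shift_le:
  assumes a: "0 < a" and z: "psum z n \<le> x" 
  shows "exit_moment a y (shift n z) \<le> exit_moment a (x + y) z"
  unfolding exit_moment_def
proof (rule SUP_mono)
  fix m
  show "\<exists>k\<in>UNIV. (if psum (shift n z) m \<le> y then ennreal (real m powr a) else 0)
     \<le> (if psum z k \<le> x + y then ennreal (real k powr a) else 0)"
    using z psum_add[of z n m] a
    by (intro bexI[of _ "n + m"]) (auto intro!: ennreal_leI powr_mono2)
qed

text \<open>With positive probability the path from \<open>i\<close> is in state \<open>j\<close> at
  some time \<open>n\<close> with partial sum at most some integer \<open>m\<close>; a last exit at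
  level \<open>y\<close> seen from there is part of one at level \<open>m + y\<close> from the
  start. As \<open>m\<close> is not under control, finiteness is assumed at all levels.\<close>

lemma exit_moment_solidarity:
  assumes a: "0 < a" and fin: "\<And>x. 0 \<le> x \<Longrightarrow> (\<integral>\<^sup>+ z. exit_moment a x z \<partial>L i) < \<infinity>" and y: "0 \<le> y"
  shows "(\<integral>\<^sup>+ z. exit_moment a y z \<partial>L j) < \<infinity>"
proof -
  interpret Pi: prob_space "P i" by (rule prob_space_P)
  let ?A = "\<lambda>n m::nat. {\<omega> \<in> space (P i). state_at i n (path \<omega>) = j \<and> psum (path \<omega>) n \<le> real m}"
  have st [measurable]: "state_at i n \<in> path_space \<rightarrow>\<^sub>M count_space UNIV" for n
    unfolding state_at_def[abs_def] by (cases n) simp_all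
  have Am: "?A n m \<in> sets (P i)" for n m by measurable
  have "\<exists>n m. emeasure (P i) (?A n m) > 0"
  proof (rule ccontr)
    assume "\<not> ?thesis"
    then have "?A n m \<in> null_sets (P i)" for n m using Am by (auto simp: null_sets_def)
    then have "AE \<omega> in P i. \<omega> \<notin> ?A n m" for n m by (rule AE_not_in)
    then have "AE \<omega> in P i. \<forall>n m. \<omega> \<notin> ?A n m" unfolding AE_all_countable by blast
    then have "AE \<omega> in P i. \<not> (\<exists>n. M n \<omega> = j)"
      using AE_M_0[of i] AE_space
    proof eventually_elim
      case (elim \<omega>)
      have "M n \<omega> \<noteq> j" for n
      proof
        assume "M n \<omega> = j"
        then have "state_at i n (path \<omega>) = j" using elim by (auto simp: state_at_def path_def split: nat.split)
        moreover obtain m :: nat where "psum (path \<omega>) n \<le> real m" using real_arch_simple by blast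
        ultimately show False using elim by auto
      qed
      then show ?case by simp
    qed
    then have "measure (P i) {\<omega> \<in> space (P i). \<exists>n. M n \<omega> = j} = 0"
      by (subst Pi.prob_Collect_eq_0) auto
    then show False using irr_measure[of i j] by simp
  qed
  then obtain n m where nm: "emeasure (P i) (?A n m) > 0" by blast
  define f where "f z = (if state_at i n z = j \<and> psum z n \<le> real m then 1 else 0 :: ennreal)" for z
  have [measurable]: "f \<in> borel_measurable path_space" unfolding f_def[abs_def] by measurable
  have "(\<integral>\<^sup>+ z. f z \<partial>L i) = (\<integral>\<^sup>+ \<omega>. f (path \<omega>) \<partial>P i)" by (rule nn_integral_L) simp
  also have "\<dots> = (\<integral>\<^sup>+ \<omega>. indicator (?A n m) \<omega> \<partial>P i)"
    by (intro nn_integral_cong) (simp add: f_def split: split_indicator)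
  also have "\<dots> > 0" using nm by (simp only: nn_integral_indicator[OF Am])
  finally have f: "(\<integral>\<^sup>+ z. f z \<partial>L i) > 0" .
  have "(\<integral>\<^sup>+ z. f z \<partial>L i) * (\<integral>\<^sup>+ z. exit_moment a y z \<partial>L j) = (\<integral>\<^sup>+ z. f z * exit_moment a y (shift n z) \<partial>L i)"
  proof (rule markov_property[symmetric])
    fix z z' :: "nat \<Rightarrow> 's \<times> real" assume *: "\<And>k. k < n \<Longrightarrow> z k = z' k"
    then have "state_at i n z = state_at i n z'" by (auto simp: state_at_def split: nat.split)
    moreover have "psum z n = psum z' n" using * by (simp add: psum_def)
    ultimately show "f z = f z'" by (simp add: f_def)
  qed (auto simp: f_def split: if_splits)
  also have "\<dots> \<le> (\<integral>\<^sup>+ z. exit_moment a (real m + y) z \<partial>L i)"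
    by (intro nn_integral_mono) (auto simp: f_def intro!: exit_moment_shift_le[OF a])
  also have "\<dots> < \<infinity>" using y by (intro fin) simp
  finally show ?thesis using f by (auto simp: ennreal_mult_less_top)
qed

text \<open>At a finite passage time the sum is at most \<open>-x\<close>, hence at most
  \<open>y\<close>, so the last exit from level \<open>y\<close> cannot come earlier.\<close>

lemma sigma_moment_of_condB:
  assumes a: "0 < a" and y: "0 \<le> y" and B: "condB P X a i y" and x: "0 \<le> x"
  shows "sigma_moment_finite P X a i x"
proof -
  have le: "(if sigma_le X x \<omega> < \<infinity> then epow (sigma_le X x \<omega>) a else 0) \<le> epow (rho X y \<omega>) a" for \<omega>
  proof (cases "sigma_le X x \<omega>")
    case (enat n)
    then have "Ssum X n \<omega> \<le> - x" unfolding sigma_le_def by (rule first_time_eq_enatD)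
    then have "Ssum X n \<omega> \<le> y" using x y by simp
    then have "sigma_le X x \<omega> \<le> rho X y \<omega>" by (auto simp: rho_def enat)
    then show ?thesis using a by (auto intro: epow_mono)
  qed simp
  show ?thesis
    using B unfolding sigma_moment_finite_def condB_def
    by (rule le_less_trans[rotated]) (intro nn_integral_mono le)
qed

text \<open>If \<open>-x\<close> is ever reached, then the minimal value is at most
  \<open>-x\<close>, so the first passage occurs no later than the first minimum.\<close>

lemma sigma_moment_of_condC:
  assumes a: "0 < a" and C: "condC P X a i"
  shows "sigma_moment_finite P X a i x"
proof -
  have le: "(if sigma_le X x \<omega> < \<infinity> then epow (sigma_le X x \<omega>) a else 0) \<le> epow (sigma_min X \<omega>) a" for \<omega>
  proof (cases "sigma_le X x \<omega>")
    case (enat n)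
    note n = first_time_eq_enatD[OF enat[unfolded sigma_le_def]]
    have "sigma_le X x \<omega> \<le> sigma_min X \<omega>"
    proof (cases "sigma_min X \<omega>")
      case (enat m)
      note m = first_time_eq_enatD[OF enat[unfolded sigma_min_def]]
      have "Ssum X m \<omega> \<le> Ssum X n \<omega>" using m n by blast
      then have "n \<le> m" using n m by (intro n(3)) auto
      then show ?thesis using \<open>sigma_le X x \<omega> = enat n\<close> enat by simp
    qed simp
    then show ?thesis using a by (auto intro: epow_mono)
  qed simp
  show ?thesis
    using C unfolding sigma_moment_finite_def condC_def
    by (rule le_less_trans[rotated]) (intro nn_integral_mono le)
qed

text \<open>A divergent path has only finitely many nonpositive partial sums and is therefore
  bounded below; among the countably many integer levels one must stay unreached with positive
  probability.\<close>

lemma sigma_infinite_pos: "\<exists>x\<ge>0. measure (P i) {\<omega> \<in> space (P i). sigma_le X x \<omega> = \<infinity>} > 0"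
proof (rule ccontr)
  interpret Pi: prob_space "P i" by (rule prob_space_P)
  assume neg: "\<not> ?thesis"
  let ?A = "\<lambda>m::nat. {\<omega> \<in> space (P i). \<forall>n\<ge>1. \<not> psum (path \<omega>) n \<le> - real m}"
  have Am: "?A m \<in> sets (P i)" for m by measurable
  have "measure (P i) (?A m) = 0" for m
  proof -
    have "?A m = {\<omega> \<in> space (P i). sigma_le X (real m) \<omega> = \<infinity>}"
      by (auto simp: sigma_le_def first_time_eq_infinity_iff Ssum_eq_psum)
    moreover have "\<not> measure (P i) {\<omega> \<in> space (P i). sigma_le X (real m) \<omega> = \<infinity>} > 0" using neg by auto
    ultimately show ?thesis using measure_nonneg[of "P i" "?A m"] by (simp add: less_le)
  qed
  then have "?A m \<in> null_sets (P i)" for m using Am by (auto simp: null_sets_def Pi.emeasure_eq_measure)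
  then have "AE \<omega> in P i. \<omega> \<notin> ?A m" for m by (rule AE_not_in)
  then have "AE \<omega> in P i. \<forall>m. \<omega> \<notin> ?A m" by (subst AE_all_countable) blast
  moreover have "AE \<omega> in P i. filterlim (psum (path \<omega>)) at_top sequentially"
    by (rule AE_path_at_top)
  ultimately have "AE \<omega> in P i. False"
    using AE_space
  proof eventually_elim
    case (elim \<omega>)
    let ?S = "{n. psum (path \<omega>) n \<le> 0}"
    have fin: "finite ?S" using elim by (intro finite_psum_le)
    obtain m :: nat where m: "1 + (\<Sum>n\<in>?S. - psum (path \<omega>) n) \<le> real m" using real_arch_simple by blast
    have "\<not> psum (path \<omega>) n \<le> - real m" for n
    proof
      assume n: "psum (path \<omega>) n \<le> - real m"
      then have "n \<in> ?S" by (simp add: order_trans[OF n])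
      then have "- psum (path \<omega>) n \<le> (\<Sum>n\<in>?S. - psum (path \<omega>) n)"
        using fin by (intro member_le_sum) auto
      then show False using n m by simp
    qed
    then show False using elim by auto
  qed
  then show False by simp
qed

text \<open>The minimum is taken over positive times, so comparing it with the initial value 0 gives
  nothing when all later sums are positive. Compared with the value at the first return to
  \<open>i\<close>, it yields that \<open>sigma_min\<close> is at most the return time plus the last
  exit time at level 0 of the path after the return.\<close>

lemma condC_of_condB:
  assumes a: "0 < a" and B: "condB P X a i 0"
    and T: "(\<integral>\<^sup>+ z. hit_moment i (1 + a) z \<partial>L i) < \<infinity>"
  shows "condC P X a i"
proof -
  interpret L: prob_space "L i" by (rule prob_space_L)
  have s: "0 < 1 + a" using a by simp
  have "AE \<omega> in P i. filterlim (psum (path \<omega>)) at_top sequentially"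
    by (rule AE_path_at_top)
  moreover have "AE \<omega> in P i. \<exists>n. fst (path \<omega> n) = i"
    using AE_return[of i] by (subst (asm) AE_L) auto
  ultimately have "AE \<omega> in P i. epow (sigma_min X \<omega>) a
     \<le> ennreal (2 powr a) * (hit_moment i (1 + a) (path \<omega>) + 1 * exit_moment a 0 (next_cyc i (path \<omega>)))"
  proof eventually_elim
    case (elim \<omega>)
    let ?z = "path \<omega>"
    let ?t = "cyc_len i ?z" and ?e = "exit_moment a 0 (next_cyc i ?z)"
    have "\<exists>n\<ge>1. \<forall>k\<ge>1. psum ?z n \<le> psum ?z k"
    proof -
      let ?S = "{n. psum ?z n \<le> psum ?z 1} \<inter> {1..}"
      have fin: "finite ?S" using finite_psum_le[OF elim(1)] by simp
      have "Min (psum ?z ` ?S) \<in> psum ?z ` ?S" using fin by (intro Min_in) auto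
      then obtain n where n: "n \<in> ?S" "psum ?z n = Min (psum ?z ` ?S)" by auto
      have "psum ?z n \<le> psum ?z k" if "1 \<le> k" for k
      proof (cases "k \<in> ?S")
        case True
        then show ?thesis using n(2) fin by simp
      next
        case False
        then show ?thesis using n(1) that by auto
      qed
      then show ?thesis using n by auto
    qed
    then have "sigma_min X \<omega> \<noteq> \<infinity>" by (auto simp: sigma_min_def first_time_eq_infinity_iff Ssum_eq_psum)
    then obtain m where m: "sigma_min X \<omega> = enat m" by auto
    note mm = first_time_eq_enatD[OF m[unfolded sigma_min_def], unfolded Ssum_eq_psum]
    have "real m \<le> real ?t + real (m - ?t)" by linarith
    then have "real m powr a \<le> (real ?t + real (m - ?t)) powr a" using a by (intro powr_mono2) auto
    also have "\<dots> \<le> 2 powr a * (real ?t powr a + real (m - ?t) powr a)"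
      using a by (intro powr_add_le_two_powr) auto
    finally have "ennreal (real m powr a) \<le> ennreal (2 powr a) * (ennreal (real ?t powr a) + ennreal (real (m - ?t) powr a))"
      by (simp add: ennreal_mult[symmetric] ennreal_plus[symmetric] ennreal_leI del: ennreal_plus)
    also have "\<dots> \<le> ennreal (2 powr a) * (hit_moment i (1 + a) ?z + 1 * ?e)"
    proof (intro mult_left_mono add_mono)
      show "ennreal (real ?t powr a) \<le> hit_moment i (1 + a) ?z"
        using elim a cyc_len_pos[of i ?z] by (auto simp: hit_moment_eq[OF s] intro!: ennreal_leI powr_mono)
      show "ennreal (real (m - ?t) powr a) \<le> 1 * ?e"
      proof (cases "?t < m")
        case True
        have "psum ?z m \<le> psum ?z ?t" using mm(2) cyc_len_pos by blast
        then have "psum (next_cyc i ?z) (m - ?t) \<le> 0"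
          using psum_add[of ?z ?t "m - ?t"] True by (simp add: next_cyc_def)
        then have "ennreal (real (m - ?t) powr a) \<le> ?e"
          unfolding exit_moment_def by (intro SUP_upper2[of "m - ?t"]) auto
        then show ?thesis by simp
      qed simp
    qed auto
    finally show ?case using m by simp
  qed
  then have "(\<integral>\<^sup>+ \<omega>. epow (sigma_min X \<omega>) a \<partial>P i)
     \<le> (\<integral>\<^sup>+ \<omega>. ennreal (2 powr a) * (hit_moment i (1 + a) (path \<omega>) + 1 * exit_moment a 0 (next_cyc i (path \<omega>))) \<partial>P i)"
    by (rule nn_integral_mono_AE)
  also have "\<dots> = (\<integral>\<^sup>+ z. ennreal (2 powr a) * (hit_moment i (1 + a) z + 1 * exit_moment a 0 (next_cyc i z)) \<partial>L i)"
    by (rule nn_integral_L[symmetric]) measurable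
  also have "\<dots> = ennreal (2 powr a) * ((\<integral>\<^sup>+ z. hit_moment i (1 + a) z \<partial>L i)
      + (\<integral>\<^sup>+ z. 1 * exit_moment a 0 (next_cyc i z) \<partial>L i))"
    by (simp add: nn_integral_cmult nn_integral_add)
  also have "(\<integral>\<^sup>+ z. 1 * exit_moment a 0 (next_cyc i z) \<partial>L i) = (\<integral>\<^sup>+ z. 1 \<partial>L i) * (\<integral>\<^sup>+ z. exit_moment a 0 z \<partial>L i)"
    by (rule nn_integral_regeneration[OF AE_return]) auto
  also have "ennreal (2 powr a) * ((\<integral>\<^sup>+ z. hit_moment i (1 + a) z \<partial>L i)
      + (\<integral>\<^sup>+ z. 1 \<partial>L i) * (\<integral>\<^sup>+ z. exit_moment a 0 z \<partial>L i)) < \<infinity>"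
    using T B[unfolded condB_iff[OF a order_refl]]
    by (simp add: ennreal_mult_less_top L.emeasure_space_1[simplified])
  finally show ?thesis by (simp add: condC_def)
qed

end

section \<open>The random walk embedded at the visits to \<open>i\<close>\<close>

locale mrw_cycle = mrw_divergent P M X p K
  for P :: "'s::countable \<Rightarrow> 'w measure" and M X p K +
  fixes i :: 's
begin

abbreviation cyc_space :: "(real \<times> real \<times> real) measure" where
  "cyc_space \<equiv> borel \<Otimes>\<^sub>M borel \<Otimes>\<^sub>M borel"

definition cyc :: "(nat \<Rightarrow> 's \<times> real) \<Rightarrow> real \<times> real \<times> real" where
  "cyc z = (psum z (cyc_len i z), Min (psum z ` {1..cyc_len i z}), real (cyc_len i z))"

definition cyc_law :: "(real \<times> real \<times> real) measure" where
  "cyc_law = distr (L i) cyc_space cyc"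

text \<open>The minimum enforces \<open>cyc_min e \<le> fst e\<close> also off the range of \<^const>\<open>cyc\<close>.\<close>

definition cyc_min :: "real \<times> real \<times> real \<Rightarrow> real" where
  "cyc_min e = min (fst (snd e)) (fst e)"

definition cyc_depth :: "real \<times> real \<times> real \<Rightarrow> real" where
  "cyc_depth e = max (- cyc_min e) 0"

text \<open>There is no circularity: \<open>iid_walk.J\<close> depends on the cycle law and the step
  \<open>fst\<close>, not on the weight. The absolute values secure the lower bound 1 everywhere,
  before the sign of \<open>J\<close> is known.\<close>

definition cyc_weight :: "real \<times> real \<times> real \<Rightarrow> real" where
  "cyc_weight e = 1 + \<bar>snd (snd e)\<bar> + \<bar>iid_walk.J cyc_law fst (cyc_depth e)\<bar>"

definition cycs :: "(nat \<Rightarrow> 's \<times> real) \<Rightarrow> nat \<Rightarrow> real \<times> real \<times> real" where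
  "cycs z k = cyc (shift (tau i k z) z)"

lemma measurable_cyc [measurable]: "cyc \<in> path_space \<rightarrow>\<^sub>M cyc_space"
proof -
  have [measurable]: "(\<lambda>z. psum z (cyc_len i z)) \<in> borel_measurable path_space"
    by (rule measurable_compose_countable[where f = "\<lambda>n z. psum z n", OF measurable_psum measurable_cyc_len])
  have [measurable]: "(\<lambda>z. Min (psum z ` {1..cyc_len i z})) \<in> borel_measurable path_space"
    by (rule measurable_compose_countable[where f = "\<lambda>n z. Min (psum z ` {1..n})", OF _ measurable_cyc_len])
      (rule borel_measurable_Min, auto)
  show ?thesis unfolding cyc_def[abs_def] by measurable
qed

lemma cyc_cong:
  assumes v: "first_visit i n z" and eq: "\<And>k. k \<le> n \<Longrightarrow> z k = z' k"
  shows "cyc z = cyc z'"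
proof -
  have "first_visit i n z'" using v eq by (auto simp: first_visit_def)
  then have len: "cyc_len i z = Suc n" "cyc_len i z' = Suc n" using v first_visit_cyc_len by auto
  have ps: "psum z k = psum z' k" if "k \<le> Suc n" for k
    unfolding psum_def using that eq by (intro sum.cong) auto
  then have "psum z ` {1..Suc n} = psum z' ` {1..Suc n}" by (intro image_cong) auto
  then show ?thesis using ps[of "Suc n"] by (simp add: cyc_def len)
qed

lemma prob_space_cyc_law: "prob_space cyc_law"
  unfolding cyc_law_def by (rule prob_space.prob_space_distr[OF prob_space_L]) simp

lemma sets_cyc_law [simp, measurable_cong]: "sets cyc_law = sets cyc_space"
  by (simp add: cyc_law_def)

lemma space_cyc_law: "space cyc_law = UNIV"
  by (simp add: cyc_law_def space_pair_measure)

lemma measurable_cyc_law_components [measurable]: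
  "fst \<in> borel_measurable cyc_law" "(\<lambda>e. fst (snd e)) \<in> borel_measurable cyc_law"
  "(\<lambda>e. snd (snd e)) \<in> borel_measurable cyc_law"
  by (simp_all add: measurable_cong_sets[OF sets_cyc_law refl])

lemma measurable_cyc_min [measurable]: "cyc_min \<in> borel_measurable cyc_law"
  unfolding cyc_min_def[abs_def] by measurable

lemma measurable_cyc_depth [measurable]: "cyc_depth \<in> borel_measurable cyc_law"
  unfolding cyc_depth_def[abs_def] by measurable

lemma measurable_cyc_J [measurable]: "(\<lambda>e. iid_walk.J cyc_law fst (cyc_depth e)) \<in> borel_measurable cyc_law"
proof -
  \<comment> \<open>The constant weight is a placeholder: measurability of \<open>J\<close> is
    needed before \<open>cyc_weight\<close> can serve as the weight of the locale.\<close>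
  interpret c0: iid_walk cyc_law fst "\<lambda>_. 1"
    by (intro iid_walk.intro iid_seq.intro iid_seq_axioms.intro iid_walk_axioms.intro
        prob_space_cyc_law space_cyc_law) auto
  show ?thesis by (rule measurable_compose[OF measurable_cyc_depth c0.measurable_J])
qed

lemma iid_walk_cyc: "iid_walk cyc_law fst cyc_weight"
proof (intro iid_walk.intro iid_seq.intro iid_seq_axioms.intro iid_walk_axioms.intro
    prob_space_cyc_law space_cyc_law)
  show "cyc_weight \<in> borel_measurable cyc_law" unfolding cyc_weight_def[abs_def] by measurable
  show "1 \<le> cyc_weight e" for e by (simp add: cyc_weight_def)
qed simp

sublocale c: iid_walk cyc_law fst cyc_weight by (rule iid_walk_cyc)

lemma nn_integral_cycs:
  assumes "f \<in> borel_measurable c.R"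
  shows "(\<integral>\<^sup>+ x. f x \<partial>c.R) = (\<integral>\<^sup>+ z. f (cycs z) \<partial>L i)"
  using AE_return measurable_cyc cyc_cong assms
  unfolding cyc_law_def cycs_def[abs_def] by (rule nn_integral_cycles)

lemma AE_cycs:
  assumes "Measurable.pred c.R Q'"
  shows "(AE x in c.R. Q' x) \<longleftrightarrow> (AE z in L i. Q' (cycs z))"
  using AE_return measurable_cyc cyc_cong assms
  unfolding cyc_law_def cycs_def[abs_def] by (rule AE_cycles)

lemma measurable_cycs: "cycs \<in> path_space \<rightarrow>\<^sub>M c.R"
  unfolding cycs_def[abs_def]
proof (rule measurable_abs_UNIV)
  fix k
  have "(next_cyc i ^^ k) \<in> path_space \<rightarrow>\<^sub>M path_space" by (induction k) auto
  from measurable_compose[OF this measurable_cyc]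
  show "(\<lambda>z. cyc (shift (tau i k z) z)) \<in> path_space \<rightarrow>\<^sub>M cyc_law"
    by (simp only: next_cyc_funpow measurable_cong_sets[OF refl sets_cyc_law])
qed

lemma nn_integral_cyc_law: "f \<in> borel_measurable cyc_law \<Longrightarrow> (\<integral>\<^sup>+ e. f e \<partial>cyc_law) = (\<integral>\<^sup>+ z. f (cyc z) \<partial>L i)"
  unfolding cyc_law_def by (rule nn_integral_distr) auto

lemma psum_shift: "psum (shift m z) n = psum z (m + n) - psum z m"
  using psum_add[of z m n] by simp

lemma cyc_min_le: "cyc_min e \<le> fst e" by (simp add: cyc_min_def)

lemma cyc_min_cyc: "cyc_min (cyc z) = Min (psum z ` {1..cyc_len i z})"
  using cyc_len_pos[of i z] by (auto simp: cyc_min_def cyc_def min_def intro!: Min_le)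

lemma W_cycs: "c.W k (cycs z) = psum z (tau i k z)"
  by (induction k) (simp_all add: c.W_Suc cycs_def cyc_def psum_shift del: shift_apply)

lemma V_cycs: "real (tau i k z) \<le> c.V k (cycs z)"
proof (induction k)
  case (Suc k)
  have "real (cyc_len i (shift (tau i k z) z)) \<le> cyc_weight (cycs z k)"
    by (simp add: cyc_weight_def cycs_def cyc_def del: shift_apply)
  with Suc show ?case by (simp add: c.V_Suc del: shift_apply)
qed simp

lemma cycle_min_le:
  assumes "tau i k z < n" "n \<le> tau i (Suc k) z"
  shows "c.W k (cycs z) + cyc_min (cycs z k) \<le> psum z n"
proof -
  let ?z = "shift (tau i k z) z"
  have "cyc_min (cycs z k) \<le> psum ?z (n - tau i k z)"
    unfolding cycs_def cyc_min_cyc using assms by (intro Min_le imageI) auto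
  also have "\<dots> = psum z n - psum z (tau i k z)" using assms by (simp add: psum_shift del: shift_apply)
  finally show ?thesis by (simp add: W_cycs)
qed

lemma cycle_min_attained:
  obtains n where "tau i k z < n" "n \<le> tau i (Suc k) z" "psum z n = c.W k (cycs z) + cyc_min (cycs z k)"
proof -
  let ?z = "shift (tau i k z) z"
  have "cyc_min (cycs z k) \<in> psum ?z ` {1..cyc_len i ?z}"
    unfolding cycs_def cyc_min_cyc using cyc_len_pos[of i ?z] by (intro Min_in) auto
  then obtain m where m: "1 \<le> m" "m \<le> cyc_len i ?z" "cyc_min (cycs z k) = psum ?z m" by auto
  then show ?thesis
    by (intro that[of "tau i k z + m"]) (auto simp: W_cycs psum_shift simp del: shift_apply)
qed

lemma AE_W_at_top: "AE x in c.R. filterlim (\<lambda>n. c.W n x) at_top sequentially"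
proof -
  have "AE z in L i. filterlim (\<lambda>n. c.W n (cycs z)) at_top sequentially"
    using AE_psum_at_top
  proof eventually_elim
    case (elim z)
    have "filterlim (\<lambda>k. tau i k z) sequentially sequentially"
      by (rule filterlim_at_top_mono[OF filterlim_ident]) (simp add: le_tau)
    from filterlim_compose[OF elim this] show ?case by (simp add: W_cycs)
  qed
  moreover have "Measurable.pred c.R (\<lambda>x. filterlim (\<lambda>n. c.W n x) at_top sequentially)"
    unfolding filterlim_at_top_nat_iff by measurable
  ultimately show ?thesis by (simp only: AE_cycs)
qed

lemma stay_up_pos: "emeasure c.R {x. c.stay_up x} > 0"
  by (rule c.emeasure_stay_up_pos[OF AE_W_at_top])

text \<open>The embedded walk inherits divergence, so it stays positive with positive probability;
  in particular its first step is positive with positive probability.\<close>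

sublocale c: iid_walk_up cyc_law fst cyc_weight
  by unfold_locales (rule c.emeasure_first_pos[OF stay_up_pos])

lemma S_tau_eq: "\<exists>n. fst (path \<omega> n) = i \<Longrightarrow> S_tau M X i \<omega> = fst (cyc (path \<omega>))"
  by (simp add: S_tau_def return_time_eq Ssum_eq_psum cyc_def)

lemma D_var_eq:
  assumes "\<exists>n. fst (path \<omega> n) = i"
  shows "D_var M X i \<omega> = cyc_depth (cyc (path \<omega>))"
proof -
  let ?I = "{1..cyc_len i (path \<omega>)}" and ?s = "psum (path \<omega>)"
  have ne: "?s ` ?I \<noteq> {}" using cyc_len_pos[of i "path \<omega>"] by auto
  have "Max ((\<lambda>k. max (- ?s k) 0) ` ?I) = max (- Min (?s ` ?I)) 0"
  proof (rule Max_eqI)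
    fix y assume "y \<in> (\<lambda>k. max (- ?s k) 0) ` ?I"
    then obtain k where k: "k \<in> ?I" "y = max (- ?s k) 0" by blast
    then have "Min (?s ` ?I) \<le> ?s k" by (intro Min_le) auto
    then show "y \<le> max (- Min (?s ` ?I)) 0"
      unfolding k(2) by (intro max.mono le_imp_neg_le order_refl)
  next
    have "Min (?s ` ?I) \<in> ?s ` ?I" using ne by (intro Min_in) auto
    then show "max (- Min (?s ` ?I)) 0 \<in> (\<lambda>k. max (- ?s k) 0) ` ?I" by auto
  qed simp
  then show ?thesis
    using assms by (simp add: D_var_def return_time_eq Ssum_eq_psum cyc_depth_def cyc_min_cyc)
qed

lemma AE_path_return: "AE \<omega> in P i. \<exists>n. fst (path \<omega> n) = i"
  using AE_return[of i] by (subst (asm) AE_L) auto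

lemma measurable_cyc_path [measurable]: "(\<lambda>\<omega>. cyc (path \<omega>)) \<in> P i \<rightarrow>\<^sub>M cyc_space"
  by (rule measurable_compose[OF measurable_path measurable_cyc])

lemma cyc_law_eq: "cyc_law = distr (P i) cyc_space (\<lambda>\<omega>. cyc (path \<omega>))"
  unfolding cyc_law_def L_def by (subst distr_distr) (auto simp: comp_def)

lemma measurable_S_tau [measurable]: "S_tau M X i \<in> borel_measurable (P i)"
proof -
  have "S_tau M X i = (\<lambda>\<omega>. if \<exists>n. fst (path \<omega> n) = i then fst (cyc (path \<omega>)) else 0)"
  proof
    fix \<omega>
    show "S_tau M X i \<omega> = (if \<exists>n. fst (path \<omega> n) = i then fst (cyc (path \<omega>)) else 0)"
    proof (cases "\<exists>n. fst (path \<omega> n) = i")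
      case True
      then show ?thesis using S_tau_eq by simp
    qed (simp add: S_tau_def return_time_eq)
  qed
  moreover have "Measurable.pred (P i) (\<lambda>\<omega>. \<exists>n. fst (path \<omega> n) = i)"
    by measurable
  ultimately show ?thesis by simp
qed

text \<open>An almost surely nonpositive cycle increment would contradict \<open>c.pos_up\<close>;
  so for \<open>x > 0\<close> the quotient in the definition of \<open>J_fun\<close> is the relevant
  case.\<close>

lemma J_fun_eq:
  assumes x: "0 \<le> x"
  shows "J_fun P M X i x = c.J x"
proof -
  interpret Pi: prob_space "P i" by (rule prob_space_P)
  have "measure (P i) {\<omega> \<in> space (P i). S_tau M X i \<omega> > 0} > 0"
  proof (rule ccontr)
    assume "\<not> ?thesis"
    then have "measure (P i) {\<omega> \<in> space (P i). S_tau M X i \<omega> > 0} = 0"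
      using measure_nonneg[of "P i"] by (meson antisym_conv1 not_less)
    then have "AE \<omega> in P i. \<not> S_tau M X i \<omega> > 0"
      by (subst (asm) Pi.prob_Collect_eq_0) auto
    then have "AE \<omega> in P i. \<not> fst (cyc (path \<omega>)) > 0"
      using AE_path_return by eventually_elim (simp only: S_tau_eq not_False_eq_True)
    then have "AE e in cyc_law. \<not> fst e > 0"
    proof -
      have "{e \<in> space cyc_space. \<not> 0 < fst e} \<in> sets cyc_space" by measurable
      from AE_distr_iff[OF measurable_cyc_path this] show ?thesis
        unfolding cyc_law_eq using \<open>AE \<omega> in P i. \<not> fst (cyc (path \<omega>)) > 0\<close> by simp
    qed
    moreover have S: "{e \<in> space cyc_law. 0 < fst e} \<in> sets cyc_law" by measurable
    ultimately have "measure cyc_law {e \<in> space cyc_law. 0 < fst e} = 0"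
      using c.Q.prob_Collect_eq_0[OF S] by simp
    then show False using c.pos_up by (simp add: space_cyc_law)
  qed
  moreover have "(\<integral>\<omega>. min (max (S_tau M X i \<omega>) 0) x \<partial>P i) = c.trunc_mean x"
  proof -
    have "(\<integral>\<omega>. min (max (S_tau M X i \<omega>) 0) x \<partial>P i) = (\<integral>\<omega>. min (max (fst (cyc (path \<omega>))) 0) x \<partial>P i)"
    proof (rule integral_cong_AE)
      show "AE \<omega> in P i. min (max (S_tau M X i \<omega>) 0) x = min (max (fst (cyc (path \<omega>))) 0) x"
        using AE_path_return by eventually_elim (simp only: S_tau_eq)
    qed auto
    also have "\<dots> = c.trunc_mean x"
      unfolding c.trunc_mean_def unfolding cyc_law_eq by (rule integral_distr[symmetric]) auto
    finally show ?thesis .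
  qed
  ultimately show ?thesis by (simp add: J_fun_def c.J_def)
qed

lemma condA_iff: "condA P M X a i \<longleftrightarrow> (\<integral>\<^sup>+ e. ennreal (c.J (cyc_depth e) powr (1 + a)) \<partial>cyc_law) < \<infinity>"
proof -
  have "(\<integral>\<^sup>+ \<omega>. ennreal (J_fun P M X i (D_var M X i \<omega>) powr (1 + a)) \<partial>P i)
      = (\<integral>\<^sup>+ \<omega>. ennreal (c.J (cyc_depth (cyc (path \<omega>))) powr (1 + a)) \<partial>P i)"
  proof (rule nn_integral_cong_AE)
    show "AE \<omega> in P i. ennreal (J_fun P M X i (D_var M X i \<omega>) powr (1 + a))
        = ennreal (c.J (cyc_depth (cyc (path \<omega>))) powr (1 + a))"
      using AE_path_return
    proof eventually_elim
      case (elim \<omega>)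
      have "0 \<le> cyc_depth (cyc (path \<omega>))" by (simp add: cyc_depth_def)
      then show ?case using elim by (simp only: D_var_eq J_fun_eq)
    qed
  qed
  also have "\<dots> = (\<integral>\<^sup>+ e. ennreal (c.J (cyc_depth e) powr (1 + a)) \<partial>cyc_law)"
  proof -
    have "(\<lambda>e. ennreal (c.J (cyc_depth e) powr (1 + a))) \<in> borel_measurable cyc_space"
      using measurable_cyc_J by (simp add: measurable_cong_sets[OF sets_cyc_law refl])
    then show ?thesis unfolding cyc_law_eq[THEN arg_cong, of "\<lambda>Q. nn_integral Q _"]
      by (subst nn_integral_distr) auto
  qed
  finally show ?thesis by (simp add: condA_def)
qed

text \<open>A time \<open>n\<close> with sum at most \<open>x\<close> lies in some cycle
  \<open>k\<close>; then \<open>W k\<close> minus the depth of that cycle is at most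
  \<open>x\<close>, and \<open>V (Suc k)\<close> dominates \<open>n\<close>. The weight has a moment
  of order \<open>1 + a\<close> by the type assumption for the cycle length and by (a) for
  \<open>J\<close>.\<close>

lemma condB_of_condA:
  assumes a: "0 < a" and A: "condA P M X a i" and T: "(\<integral>\<^sup>+ z. hit_moment i (1 + a) z \<partial>L i) < \<infinity>"
    and x: "0 \<le> x"
  shows "condB P X a i x"
proof -
  have s: "0 < 1 + a" using a by simp
  have J0: "0 \<le> c.J (cyc_depth e)" for e
    using c.J_ge_1[of "cyc_depth e"] by (simp add: cyc_depth_def)
  have G: "(\<integral>\<^sup>+ e. ennreal (cyc_weight e powr (1 + a)) \<partial>cyc_law) < \<infinity>"
  proof -
    let ?k = "2 powr (1 + a)"
    have "(\<integral>\<^sup>+ e. ennreal (cyc_weight e powr (1 + a)) \<partial>cyc_law)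
        \<le> (\<integral>\<^sup>+ e. ennreal ?k * (ennreal ((1 + \<bar>snd (snd e)\<bar>) powr (1 + a)) + ennreal (c.J (cyc_depth e) powr (1 + a))) \<partial>cyc_law)"
    proof (rule nn_integral_mono)
      fix e
      have "cyc_weight e powr (1 + a) \<le> ?k * ((1 + \<bar>snd (snd e)\<bar>) powr (1 + a) + c.J (cyc_depth e) powr (1 + a))"
        unfolding cyc_weight_def using powr_add_le_two_powr[of "1 + \<bar>snd (snd e)\<bar>" "c.J (cyc_depth e)" "1 + a"] J0[of e] a by simp
      then show "ennreal (cyc_weight e powr (1 + a))
          \<le> ennreal ?k * (ennreal ((1 + \<bar>snd (snd e)\<bar>) powr (1 + a)) + ennreal (c.J (cyc_depth e) powr (1 + a)))"
        by (simp add: ennreal_mult[symmetric] ennreal_plus[symmetric] ennreal_leI del: ennreal_plus)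
    qed
    also have "\<dots> = ennreal ?k * ((\<integral>\<^sup>+ e. ennreal ((1 + \<bar>snd (snd e)\<bar>) powr (1 + a)) \<partial>cyc_law)
        + (\<integral>\<^sup>+ e. ennreal (c.J (cyc_depth e) powr (1 + a)) \<partial>cyc_law))"
      using measurable_cyc_J by (simp add: nn_integral_cmult nn_integral_add)
    also have "(\<integral>\<^sup>+ e. ennreal ((1 + \<bar>snd (snd e)\<bar>) powr (1 + a)) \<partial>cyc_law)
        = (\<integral>\<^sup>+ z. ennreal ((1 + real (cyc_len i z)) powr (1 + a)) \<partial>L i)"
      by (subst nn_integral_cyc_law) (auto simp: cyc_def)
    also have "\<dots> \<le> ennreal ?k * (\<integral>\<^sup>+ z. hit_moment i (1 + a) z \<partial>L i)"
      by (rule nn_integral_cyc_len_le[OF s])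
    finally have "(\<integral>\<^sup>+ e. ennreal (cyc_weight e powr (1 + a)) \<partial>cyc_law)
        \<le> ennreal ?k * (ennreal ?k * (\<integral>\<^sup>+ z. hit_moment i (1 + a) z \<partial>L i)
           + (\<integral>\<^sup>+ e. ennreal (c.J (cyc_depth e) powr (1 + a)) \<partial>cyc_law))"
      by (simp add: add_right_mono mult_left_mono)
    also have "\<dots> < \<infinity>" using T A by (simp add: condA_iff ennreal_mult_less_top)
    finally show ?thesis .
  qed
  have dY: "- cyc_depth e \<le> fst e" for e using cyc_min_le[of e] by (simp add: cyc_depth_def)
  have fin: "(\<integral>\<^sup>+ y. c.last_exit_bound cyc_depth a x y \<partial>c.R) < \<infinity>"
  proof (rule c.last_exit_bound_finite[OF a x])
    show "c.J (cyc_depth e) \<le> cyc_weight e" for e by (simp add: cyc_weight_def)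
    show "c.entry_sum {..0} (\<lambda>v w. 1) < 1" by (rule c.entry_sum_down_less_1[OF stay_up_pos])
  qed (use G dY in \<open>auto simp: cyc_depth_def[of e for e]\<close>)
  have "(\<integral>\<^sup>+ z. exit_moment a x z \<partial>L i) \<le> (\<integral>\<^sup>+ z. c.last_exit_bound cyc_depth a x (cycs z) \<partial>L i)"
  proof (rule nn_integral_mono_AE)
    have "AE z in L i. filterlim (\<lambda>n. c.W n (cycs z)) at_top sequentially"
    proof -
      have "Measurable.pred c.R (\<lambda>x. filterlim (\<lambda>n. c.W n x) at_top sequentially)"
        unfolding filterlim_at_top_nat_iff by measurable
      from AE_cycs[OF this] show ?thesis using AE_W_at_top by simp
    qed
    then show "AE z in L i. exit_moment a x z \<le> c.last_exit_bound cyc_depth a x (cycs z)"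
    proof eventually_elim
      case (elim z)
      show ?case unfolding exit_moment_def
      proof (rule SUP_least)
        fix n
        show "(if psum z n \<le> x then ennreal (real n powr a) else 0) \<le> c.last_exit_bound cyc_depth a x (cycs z)"
        proof (cases "psum z n \<le> x \<and> 1 \<le> n")
          case True
          then obtain k where k: "tau i k z < n" "n \<le> tau i (Suc k) z" using tau_cover[of n i z] by blast
          have "c.W k (cycs z) - cyc_depth (cycs z k) \<le> c.W k (cycs z) + cyc_min (cycs z k)"
            by (simp add: cyc_depth_def)
          also have "\<dots> \<le> x" using cycle_min_le[OF k] True by simp
          finally have le: "ennreal (c.V (Suc k) (cycs z) powr a) \<le> c.last_exit_bound cyc_depth a x (cycs z)"
            by (intro c.last_exit_bound_ge a dY elim) (simp add: cyc_depth_def)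
          have "real n \<le> c.V (Suc k) (cycs z)" using k(2) V_cycs[of "Suc k" z] by linarith
          then have "ennreal (real n powr a) \<le> ennreal (c.V (Suc k) (cycs z) powr a)"
            using a by (intro ennreal_leI powr_mono2) auto
          from order_trans[OF this le] show ?thesis using True by simp
        qed (auto simp: not_le)
      qed
    qed
  qed
  also have "\<dots> = (\<integral>\<^sup>+ y. c.last_exit_bound cyc_depth a x y \<partial>c.R)"
    by (rule nn_integral_cycs[symmetric]) simp
  finally show ?thesis unfolding condB_iff[OF a x] using fin by (rule le_less_trans)
qed

text \<open>Every cycle takes at least one unit of time, so the index of the first cycle that
  reaches \<open>-x\<close> is at most the passage time, and its moment is finite by (d). By
  \<open>sig\<close>, never reaching \<open>-x\<close> means the same for cycles and for the
  path.\<close>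

lemma condA_of_condD:
  assumes a: "0 < a" and D: "condD P X a i"
  shows "condA P M X a i"
proof -
  obtain x where x: "0 \<le> x" and pos: "measure (P i) {\<omega> \<in> space (P i). sigma_le X x \<omega> = \<infinity>} > 0"
    and fin: "sigma_moment_finite P X a i x"
    using D unfolding condD_def by blast
  interpret Pi: prob_space "P i" by (rule prob_space_P)
  let ?m = "\<lambda>y j. c.W j y + cyc_min (y j)"
  have m: "(\<lambda>y. ?m y j) \<in> borel_measurable c.R" for j
    by (intro borel_measurable_add c.measurable_W measurable_compose[OF _ measurable_cyc_min]) simp
  have lt [measurable]: "Measurable.pred c.R (\<lambda>y. - x < ?m y j)" for j
    by (rule borel_measurable_pred_less[OF borel_measurable_const m])
  have [measurable]: "Measurable.pred c.R (\<lambda>y. ?m y j \<le> - x)" for j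
    unfolding not_less[symmetric] by (rule pred_intros_logic(2)[OF lt])
  have pm: "Measurable.pred c.R (\<lambda>y. \<forall>j. - x < ?m y j)"
    by (intro pred_intros_countable lt)
  have sig: "(\<forall>j. - x < ?m (cycs (path \<omega>)) j) \<longleftrightarrow> sigma_le X x \<omega> = \<infinity>" for \<omega>
  proof
    assume *: "\<forall>j. - x < ?m (cycs (path \<omega>)) j"
    have "- x < psum (path \<omega>) n" if n: "1 \<le> n" for n
    proof -
      obtain k where k: "tau i k (path \<omega>) < n" "n \<le> tau i (Suc k) (path \<omega>)" using tau_cover[OF n] by blast
      show ?thesis using cycle_min_le[OF k] *[rule_format, of k] by simp
    qed
    then show "sigma_le X x \<omega> = \<infinity>"
      by (auto simp: sigma_le_def first_time_eq_infinity_iff Ssum_eq_psum not_le)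
  next
    assume *: "sigma_le X x \<omega> = \<infinity>"
    show "\<forall>j. - x < ?m (cycs (path \<omega>)) j"
    proof
      fix j
      obtain n where n: "tau i j (path \<omega>) < n" "psum (path \<omega>) n = ?m (cycs (path \<omega>)) j"
        using cycle_min_attained[of j "path \<omega>"] by metis
      then have "1 \<le> n" by simp
      then show "- x < ?m (cycs (path \<omega>)) j"
        using * unfolding n(2)[symmetric] by (auto simp: sigma_le_def first_time_eq_infinity_iff Ssum_eq_psum not_le)
    qed
  qed
  have "(\<integral>\<^sup>+ e. ennreal (c.J (max (- cyc_min e) 0) powr (1 + a)) \<partial>cyc_law) < \<infinity>"
  proof (rule c.J_moment_of_hitting_moment[OF a x _ cyc_min_le])
    show "emeasure c.R {y. \<forall>j. - x < ?m y j} > 0"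
    proof (rule ccontr)
      assume "\<not> ?thesis"
      then have "{y \<in> space c.R. \<forall>j. - x < ?m y j} \<in> null_sets c.R"
        using pm by (auto simp: null_sets_def pred_def)
      then have "AE y in c.R. \<not> (\<forall>j. - x < ?m y j)" by (drule_tac AE_not_in) simp
      then have "AE z in L i. \<not> (\<forall>j. - x < ?m (cycs z) j)"
        by (simp only: AE_cycs[OF pred_intros_logic(2)[OF pm]])
      then have "AE z in P i. \<not> (\<forall>j. - x < ?m (cycs (path z)) j)"
        unfolding L_def by (rule AE_distrD[rotated]) simp
      moreover have "Measurable.pred (P i) (\<lambda>\<omega>. \<forall>j. - x < ?m (cycs (path \<omega>)) j)"
        by (rule measurable_compose[OF measurable_compose[OF measurable_path measurable_cycs] pm])
      ultimately have "measure (P i) {\<omega> \<in> space (P i). \<forall>j. - x < ?m (cycs (path \<omega>)) j} = 0"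
        by (subst Pi.prob_Collect_eq_0) (simp_all add: pred_def)
      then show False using pos by (simp only: sig)
    qed
    \<comment> \<open>At most one \<open>k\<close> satisfies this, so the sum over \<open>k\<close>
      is a moment of the first deep cycle index; the infinite passage time is excluded through
      \<open>sig\<close>.\<close>
    let ?E = "\<lambda>k y. 1 \<le> k \<and> (\<forall>j<k. - x < ?m y j) \<and> ?m y k \<le> - x"
    have [measurable]: "Measurable.pred c.R (?E k)" for k by measurable
    have "(\<Sum>k. \<integral>\<^sup>+ y. (if ?E k y then ennreal (real k powr a) else 0) \<partial>c.R)
        = (\<integral>\<^sup>+ y. (\<Sum>k. if ?E k y then ennreal (real k powr a) else 0) \<partial>c.R)"
      by (rule nn_integral_suminf[symmetric]) measurable
    also have "\<dots> = (\<integral>\<^sup>+ z. (\<Sum>k. if ?E k (cycs z) then ennreal (real k powr a) else 0) \<partial>L i)"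
      by (rule nn_integral_cycs) measurable
    also have "\<dots> = (\<integral>\<^sup>+ \<omega>. (\<Sum>k. if ?E k (cycs (path \<omega>)) then ennreal (real k powr a) else 0) \<partial>P i)"
    proof (rule nn_integral_L)
      have "(\<lambda>y. \<Sum>k. if ?E k y then ennreal (real k powr a) else 0) \<in> borel_measurable c.R"
        by measurable
      from measurable_compose[OF measurable_cycs this]
      show "(\<lambda>z. \<Sum>k. if ?E k (cycs z) then ennreal (real k powr a) else 0) \<in> borel_measurable path_space" .
    qed
    also have "\<dots> \<le> (\<integral>\<^sup>+ \<omega>. (if sigma_le X x \<omega> < \<infinity> then epow (sigma_le X x \<omega>) a else 0) \<partial>P i)"
    proof (rule nn_integral_mono)
      fix \<omega>
      let ?y = "cycs (path \<omega>)"
      show "(\<Sum>k. if ?E k ?y then ennreal (real k powr a) else 0)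
         \<le> (if sigma_le X x \<omega> < \<infinity> then epow (sigma_le X x \<omega>) a else 0)"
      proof (cases "\<exists>k. ?E k ?y")
        case True
        then obtain k where k: "?E k ?y" by blast
        have uniq: "l = k" if "?E l ?y" for l
        proof (rule ccontr)
          assume "l \<noteq> k"
          then consider "l < k" | "k < l" by linarith
          then show False using k that by cases (meson not_le)+
        qed
        have "(\<Sum>l. if ?E l ?y then ennreal (real l powr a) else 0) = (\<Sum>l\<in>{k}. if ?E l ?y then ennreal (real l powr a) else 0)"
          by (rule suminf_finite) (use uniq in auto)
        also have "\<dots> = ennreal (real k powr a)" using k by simp
        also have "\<dots> \<le> (if sigma_le X x \<omega> < \<infinity> then epow (sigma_le X x \<omega>) a else 0)"
        proof (cases "sigma_le X x \<omega>")
          case (enat n)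
          note n = first_time_eq_enatD[OF enat[unfolded sigma_le_def], unfolded Ssum_eq_psum]
          obtain l where l: "tau i l (path \<omega>) < n" "n \<le> tau i (Suc l) (path \<omega>)" using tau_cover[OF n(1)] by blast
          have "?m ?y l \<le> - x" using cycle_min_le[OF l] n(2) by simp
          then have "k \<le> l" using k by (meson not_le)
          also have "l \<le> tau i l (path \<omega>)" by (rule le_tau)
          also have "\<dots> \<le> n" using l by simp
          finally show ?thesis using a by (auto simp: enat intro!: ennreal_leI powr_mono2)
        next
          case infinity
          then have "- x < ?m ?y k" using sig[of \<omega>] by blast
          then show ?thesis using k by simp
        qed
        finally show ?thesis .
      next
        case False
        then have "(\<lambda>k. if ?E k ?y then ennreal (real k powr a) else 0) = (\<lambda>_. 0)" by auto
        then show ?thesis by simp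
      qed
    qed
    also have "\<dots> < \<infinity>" using fin by (simp add: sigma_moment_finite_def)
    finally show "(\<Sum>k. \<integral>\<^sup>+ y. (if ?E k y then ennreal (real k powr a) else 0) \<partial>c.R) < \<infinity>" .
  qed simp
  then show ?thesis by (simp add: condA_iff cyc_depth_def)
qed

end

theorem theorem6p3:
  fixes P :: "'s::countable \<Rightarrow> 'w measure"
    and M :: "nat \<Rightarrow> 'w \<Rightarrow> 's" and X :: "nat \<Rightarrow> 'w \<Rightarrow> real"
    and p :: "'s \<Rightarrow> 's \<Rightarrow> real" and K :: "'s \<Rightarrow> 's \<Rightarrow> real measure"
    and \<pi> :: "'s \<Rightarrow> real" and \<alpha> :: real
  assumes "\<alpha> > 0"
    and "is_MRW P M X p K"
    and "irreducible_chain P M"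
    and "positive_recurrent P M"
    and "stationary_distr p \<pi>"
    and "\<not> null_homologous P M X \<pi>"
    and "positive_divergent P X"
    and "of_type P M \<alpha>"
  shows "((\<exists>i. condA P M X \<alpha> i) \<longleftrightarrow> (\<forall>i. condA P M X \<alpha> i))
       \<and> ((\<exists>i. \<exists>x\<ge>0. condB P X \<alpha> i x) \<longleftrightarrow> (\<forall>i. \<forall>x\<ge>0. condB P X \<alpha> i x))
       \<and> ((\<exists>i. condC P X \<alpha> i) \<longleftrightarrow> (\<forall>i. condC P X \<alpha> i))
       \<and> ((\<exists>i. condD P X \<alpha> i) \<longleftrightarrow> (\<forall>i. condD P X \<alpha> i))
       \<and> ((\<exists>i. condD P X \<alpha> i) \<longrightarrow> (\<forall>i. \<forall>x\<ge>0. sigma_moment_finite P X \<alpha> i x))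
       \<and> ((\<exists>i. condA P M X \<alpha> i) \<longleftrightarrow> (\<exists>i. \<exists>x\<ge>0. condB P X \<alpha> i x))
       \<and> ((\<exists>i. condA P M X \<alpha> i) \<longleftrightarrow> (\<exists>i. condC P X \<alpha> i))
       \<and> ((\<exists>i. condA P M X \<alpha> i) \<longleftrightarrow> (\<exists>i. condD P X \<alpha> i))"
proof -
  interpret mrw_divergent P M X p K by unfold_locales fact+
  have cycle: "mrw_cycle P M X p K" by unfold_locales
  obtain i0 where "(\<integral>\<^sup>+ \<omega>. epow (return_time M i0 \<omega>) (1 + \<alpha>) \<partial>P i0) < \<infinity>"
    using assms(8) unfolding of_type_def by blast
  then have "(\<integral>\<^sup>+ z. hit_moment i0 (1 + \<alpha>) z \<partial>L i0) < \<infinity>"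
    using assms(1) by (simp add: epow_return_time nn_integral_L)
  then have T: "(\<integral>\<^sup>+ z. hit_moment i (1 + \<alpha>) z \<partial>L i) < \<infinity>" for i
    by (rule hit_moment_solidarity[OF _ irr_measure, rotated]) (use assms(1) in simp)
  have AB: "condB P X \<alpha> i x" if "condA P M X \<alpha> i" "0 \<le> x" for i x
    using mrw_cycle.condB_of_condA[OF cycle assms(1) that(1) T that(2)] .
  have DA: "condA P M X \<alpha> i" if "condD P X \<alpha> i" for i
    using mrw_cycle.condA_of_condD[OF cycle assms(1) that] .
  have BS: "sigma_moment_finite P X \<alpha> i y" if "condB P X \<alpha> i x" "0 \<le> x" "0 \<le> y" for i x y
    using sigma_moment_of_condB[OF assms(1) that(2) that(1) that(3)] .
  have CS: "sigma_moment_finite P X \<alpha> i y" if "condC P X \<alpha> i" for i y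
    using sigma_moment_of_condC[OF assms(1) that] .
  \<comment> \<open>The level supplied by \<open>sigma_infinite_pos\<close> cannot be chosen, hence
    the moments are required at every level.\<close>
  have D: "condD P X \<alpha> i" if "\<And>y. 0 \<le> y \<Longrightarrow> sigma_moment_finite P X \<alpha> i y" for i
    using sigma_infinite_pos[of i] that unfolding condD_def by blast
  have BC: "condC P X \<alpha> i" if "condB P X \<alpha> i 0" for i
    by (rule condC_of_condB[OF assms(1) that T])
  have BB: "condB P X \<alpha> j y" if "\<And>x. 0 \<le> x \<Longrightarrow> condB P X \<alpha> i x" "0 \<le> y" for i j y
    using exit_moment_solidarity[OF assms(1), of i y j] that by (simp add: condB_iff[OF assms(1)])
  \<comment> \<open>This strongest form of (b) is the hub: each condition at a single state implies
    it, and it implies each condition at every state. From (b) at a single level it is reached by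
    way of (d) and (a), because \<open>BS\<close> turns one level of \<open>condB\<close> into all
    levels of the passage moments.\<close>
  let ?all = "\<forall>i. \<forall>x\<ge>0. condB P X \<alpha> i x"
  have A_all: "?all" if "condA P M X \<alpha> i" for i using AB[OF that] BB by blast
  have D_all: "?all" if "condD P X \<alpha> i" for i using DA[OF that] A_all by blast
  have B_all: "?all" if "condB P X \<alpha> i x" "0 \<le> x" for i x using BS[OF that] D D_all by blast
  have C_all: "?all" if "condC P X \<alpha> i" for i using CS[OF that] D D_all by blast
  have all_S: "sigma_moment_finite P X \<alpha> i y" if ?all "0 \<le> y" for i y
    using BS[of i 0 y] that by simp
  have all_D: "condD P X \<alpha> i" if ?all for i using all_S[OF that] D by blast
  have all_A: "condA P M X \<alpha> i" if ?all for i using all_D[OF that] DA by blast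
  have all_C: "condC P X \<alpha> i" if ?all for i using that BC by simp
  show ?thesis
    using A_all B_all C_all D_all all_A all_C all_D all_S by (meson order_refl)
qed

end
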